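(* Let $K$ be an abstract elementary class with amalgamation, let $\kappa$ be an infinite cardinal, and assume $K$ is $(<\kappa)$-tame. The following are equivalent: (1) $K$ is stable in some cardinal $\lambda\ge\mathrm{LS}(K)+\kappa^-$. (2) $K$ does not have the order property. (3) $K$ does not have the $(<\kappa)$-order property. (4) There exist cardinals $\mu$ and $\lambda_0$ with $\mu\le\lambda_0<h^*(\kappa+\mathrm{LS}(K)^+)$ such that $K$ is stable in every $\lambda\ge\lambda_0$ with $\lambda^{<\mu}=\lambda$. In particular, $K$ is stable if and only if $K$ does not have the order property.
   Context: $K$ is an abstract elementary class (AEC) in the sense of Shelah, with strong substructure relation $\le$ and Löwenheim–Skolem number $\mathrm{LS}(K)$. A $K$-embedding $f:M\to N$ is an isomorphism of $M$ onto some $f[M]\le N$. $K$ has amalgamation if whenever $M_0\le M_1$ and $M_0\le M_2$ in $K$ there are $N\in K$ and $K$-embeddings $f_\ell:M_\ell\to N$ fixing $M_0$ pointwise. Galois types: $(\bar b_1,A_1,N_1)E_{\mathrm{at}}(\bar b_2,A_2,N_2)$ iff $A_1=A_2=:A$ and there are $N\in K$ and $K$-embeddings $f_\ell:N_\ell\to N$ fixing $A$ pointwise with $f_1(\bar b_1)=f_2(\bar b_2)$; $E$ is the transitive closure of $E_{\mathrm{at}}$ and $\mathrm{gtp}(\bar b/A;N)$ is the $E$-class. For $M\in K$, $\mathrm{gS}(M)$ is the set of $\mathrm{gtp}(b/M;N)$ with $M\le N$ and $b$ a single element. $K$ is $(<\kappa)$-tame if for all $M\in K$ and $p\ne q$ in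 $\mathrm{gS}(M)$ there is $A_0\subseteq|M|$ with $|A_0|<\kappa$ and $p\upharpoonright A_0\ne q\upharpoonright A_0$ (restriction of the domain). Stability: $K$ is stable in $\lambda$ if for every $N\in K$ and $A\subseteq|N|$ with $|A|\le\lambda$, $|\{\mathrm{gtp}(b/A;N):b\in|N|\}|\le\lambda$. $K$ is stable if it is stable in unboundedly many cardinals. Order property: $M\in K$ has the $\alpha$-order property of length $\mu$ if there is $\langle\bar a_i:i<\mu\rangle$ in $M$ with $\ell(\bar a_i)=\alpha$ such that for all $i_0<j_0<\mu$, $i_1<j_1<\mu$, $\mathrm{gtp}(\bar a_{i_0}\bar a_{j_0}/\emptyset;M)\ne\mathrm{gtp}(\bar a_{j_1}\bar a_{i_1}/\emptyset;M)$. $K$ has the $\alpha$-order property if for every cardinal $\mu$ some $M\in K$ has the $\alpha$-order property of length $\mu$. $K$ has the $(<\kappa)$-order property if it has the $\alpha$-order property for some cardinal $\alpha<\kappa$, and the order property if it has the $\alpha$-order property for some cardinal $\alpha$. Cardinal notation: for an infinite cardinal $\lambda$, $\lambda^-$ is $\lambda$ if $\lambda$ is a limit cardinal and the unique $\lambda_0$ with $\lambda_0^+=\lambda$ if $\lambda$ is a successor; $h(\lambda):=\beth_{(2^\lambda)^+}$ and $h^*(\lambda):=h(\lambda^-)$.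
   Formalization: In (4) the cardinal μ is required to be infinite: with μ = 0 or 1 the condition λ^{<μ} = λ is never met for large λ, so (4) would hold vacuously and the equivalence fail; finite μ ≥ 2 reduces to μ = ℵ₀. *)

theory Defs
  imports Main "HOL-Library.FuncSet"
begin

unbundle cardinal_syntax

section \<open>The set-theoretic universe\<close>

text \<open>
  An abstract elementary class is a proper class of structures, and the theorem quantifies over
  all cardinals. HOL has no proper classes, so sets are taken relative to a universe: a type whose
  cardinality is strongly inaccessible (uncountable, regular, strong limit), presented as the
  well-order of the ordinals below that inaccessible. The sets of the universe are the subsets of
  the type of smaller cardinality; a collection of structures that is not small plays the role of
  a proper class. An element \<open>x\<close> of the type is an ordinal, identified with \<open>{..<x}\<close>, and the
  points of structures are drawn from the same type. By global choice any small structure is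
  isomorphic to one of this kind, so that nothing is lost for classes closed under isomorphism.
\<close>

class universe = wellorder +
  assumes initial_segment_small: "|{..<x::'a}| <o |UNIV::'a set|"
    and uncountable_universe: "\<exists>x::'a. infinite {..<x}"
    and regular_universe: "|A::'a set| <o |UNIV::'a set| \<Longrightarrow> \<exists>x. \<forall>a\<in>A. a < x"
    and strong_limit_universe: "|Pow {..<x::'a}| <o |UNIV::'a set|"

definition small :: "'u::universe set \<Rightarrow> bool" where
  "small A \<longleftrightarrow> |A| <o |UNIV::'u set|"


section \<open>Ordinals and cardinals\<close>

definition is_zero :: "'u::universe \<Rightarrow> bool" where
  "is_zero x \<longleftrightarrow> (\<forall>y. \<not> y < x)"

definition succ_of :: "'u::universe \<Rightarrow> 'u \<Rightarrow> bool" where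
  "succ_of y x \<longleftrightarrow> y < x \<and> (\<forall>z. \<not> (y < z \<and> z < x))"

definition limit_ordinal :: "'u::universe \<Rightarrow> bool" where
  "limit_ordinal x \<longleftrightarrow> \<not> is_zero x \<and> (\<nexists>y. succ_of y x)"

definition cardinal :: "'u::universe \<Rightarrow> bool" where
  "cardinal k \<longleftrightarrow> (\<forall>x<k. |{..<x}| <o |{..<k}| )"

definition infinite_cardinal :: "'u::universe \<Rightarrow> bool" where
  "infinite_cardinal k \<longleftrightarrow> cardinal k \<and> infinite {..<k}"

definition cardinality :: "'b set \<Rightarrow> 'u::universe" where
  "cardinality A = (LEAST x. |A| \<le>o |{..<x}| )"

definition aleph0 :: "'u::universe" where
  "aleph0 = (LEAST x. infinite {..<x})"

definition card_succ :: "'u::universe \<Rightarrow> 'u" where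
  "card_succ k = (LEAST l. cardinal l \<and> k < l)"

definition card_add :: "'u::universe \<Rightarrow> 'u \<Rightarrow> 'u" where
  "card_add k l = cardinality ({..<k} <+> {..<l})"

definition card_power :: "'u::universe \<Rightarrow> 'u \<Rightarrow> 'u" where
  "card_power k l = cardinality ({..<l} \<rightarrow>\<^sub>E {..<k})"

definition two_power :: "'u::universe \<Rightarrow> 'u" where
  "two_power k = cardinality (Pow {..<k})"

definition card_power_less :: "'u::universe \<Rightarrow> 'u \<Rightarrow> 'u" where
  "card_power_less k m = (LEAST s. \<forall>t. cardinal t \<and> t < m \<longrightarrow> card_power k t \<le> s)"

definition card_minus :: "'u::universe \<Rightarrow> 'u" where
  "card_minus k =
    (if \<exists>l. cardinal l \<and> card_succ l = k then THE l. cardinal l \<and> card_succ l = k else k)"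

function beth :: "'u::universe \<Rightarrow> 'u" where
  "beth x =
    (if is_zero x then aleph0
     else if \<exists>y. succ_of y x then two_power (beth (THE y. succ_of y x))
     else (LEAST s. \<forall>y\<in>{..<x}. beth y \<le> s))"
  by pat_completeness auto

lemma succ_of_unique: "succ_of y x \<Longrightarrow> succ_of z x \<Longrightarrow> y = z"
  unfolding succ_of_def by (meson linorder_neqE)

lemma the_succ_of: "succ_of y x \<Longrightarrow> (THE y. succ_of y x) = y"
  using succ_of_unique by blast

termination beth
proof (relation "{(x, y). x < y}")
  show "wf {(x::'u::universe, y). x < y}"
    by (rule wf)
next
  fix x :: "'u::universe"
  assume "\<exists>y. succ_of y x"
  then show "(THE y. succ_of y x, x) \<in> {(x, y). x < y}"
    using the_succ_of by (auto simp: succ_of_def)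
qed auto

declare beth.simps [simp del]

definition hanf :: "'u::universe \<Rightarrow> 'u" where
  "hanf l = beth (card_succ (two_power l))"

definition hanf_star :: "'u::universe \<Rightarrow> 'u" where
  "hanf_star l = hanf (card_minus l)"


section \<open>Structures in a finitary vocabulary\<close>

text \<open>A vocabulary maps its function and relation symbols to their arities.\<close>

record 'u vocabulary =
  fun_arity :: "'u \<rightharpoonup> nat"
  rel_arity :: "'u \<rightharpoonup> nat"

definition symbols :: "'u vocabulary \<Rightarrow> ('u + 'u) set" where
  "symbols V = dom (fun_arity V) <+> dom (rel_arity V)"

record 'u struct =
  points :: "'u set"
  fun_int :: "'u \<Rightarrow> 'u list \<Rightarrow> 'u"
  rel_int :: "'u \<Rightarrow> 'u list set"

text \<open>
  Interpretations take default values off the vocabulary and off the universe of the structure,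
  so that equality of structures is equality in HOL.
\<close>

definition is_structure :: "'u::universe vocabulary \<Rightarrow> 'u struct \<Rightarrow> bool" where
  "is_structure V M \<longleftrightarrow>
    points M \<noteq> {} \<and> small (points M) \<and>
    (\<forall>s xs. if fun_arity V s = Some (length xs) \<and> set xs \<subseteq> points M
            then fun_int M s xs \<in> points M else fun_int M s xs = undefined) \<and>
    (\<forall>s. \<forall>xs\<in>rel_int M s. rel_arity V s = Some (length xs) \<and> set xs \<subseteq> points M)"

definition substructure :: "'u::universe vocabulary \<Rightarrow> 'u struct \<Rightarrow> 'u struct \<Rightarrow> bool" where
  "substructure V M N \<longleftrightarrow>
    is_structure V M \<and> is_structure V N \<and> points M \<subseteq> points N \<and>
    (\<forall>s xs. fun_arity V s = Some (length xs) \<and> set xs \<subseteq> points M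
            \<longrightarrow> fun_int M s xs = fun_int N s xs) \<and>
    (\<forall>s xs. rel_arity V s = Some (length xs) \<and> set xs \<subseteq> points M
            \<longrightarrow> (xs \<in> rel_int M s \<longleftrightarrow> xs \<in> rel_int N s))"

definition isomorphism ::
  "'u::universe vocabulary \<Rightarrow> ('u \<Rightarrow> 'u) \<Rightarrow> 'u struct \<Rightarrow> 'u struct \<Rightarrow> bool" where
  "isomorphism V f M N \<longleftrightarrow>
    is_structure V M \<and> is_structure V N \<and> bij_betw f (points M) (points N) \<and>
    (\<forall>s xs. fun_arity V s = Some (length xs) \<and> set xs \<subseteq> points M
            \<longrightarrow> f (fun_int M s xs) = fun_int N s (map f xs)) \<and>
    (\<forall>s xs. rel_arity V s = Some (length xs) \<and> set xs \<subseteq> points M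
            \<longrightarrow> (xs \<in> rel_int M s \<longleftrightarrow> map f xs \<in> rel_int N s))"

definition chain_union :: "'u::universe \<Rightarrow> ('u \<Rightarrow> 'u struct) \<Rightarrow> 'u struct" where
  "chain_union d M =
    \<lparr> points = (\<Union>i<d. points (M i)),
      fun_int = (\<lambda>s xs. if \<exists>i<d. set xs \<subseteq> points (M i)
        then fun_int (M (LEAST i. i < d \<and> set xs \<subseteq> points (M i))) s xs else undefined),
      rel_int = (\<lambda>s. \<Union>i<d. rel_int (M i) s) \<rparr>"


section \<open>Abstract elementary classes\<close>

record 'u abstract_class =
  vocab :: "'u vocabulary"
  models :: "'u struct set"
  strong :: "'u struct \<Rightarrow> 'u struct \<Rightarrow> bool"

definition LS_bound :: "'u::universe abstract_class \<Rightarrow> 'u \<Rightarrow> bool" where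
  "LS_bound K l \<longleftrightarrow>
    infinite_cardinal l \<and> |symbols (vocab K)| \<le>o |{..<l}| \<and>
    (\<forall>M\<in>models K. \<forall>A\<subseteq>points M. \<exists>M0. strong K M0 M \<and> A \<subseteq> points M0 \<and>
       |points M0| \<le>o |A| +c |{..<l}| )"

definition LS :: "'u::universe abstract_class \<Rightarrow> 'u" where
  "LS K = (LEAST l. LS_bound K l)"

locale aec =
  fixes K :: "'u::universe abstract_class"
  assumes model_structure: "M \<in> models K \<Longrightarrow> is_structure (vocab K) M"
    and strong_models: "strong K M N \<Longrightarrow> M \<in> models K \<and> N \<in> models K"
    and strong_substructure: "strong K M N \<Longrightarrow> substructure (vocab K) M N"
    and strong_refl: "M \<in> models K \<Longrightarrow> strong K M M"
    and strong_trans: "strong K M0 M1 \<Longrightarrow> strong K M1 M2 \<Longrightarrow> strong K M0 M2"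
    and strong_antisym: "strong K M N \<Longrightarrow> strong K N M \<Longrightarrow> M = N"
    and models_iso: "M \<in> models K \<Longrightarrow> isomorphism (vocab K) f M N \<Longrightarrow> N \<in> models K"
    and strong_iso: "strong K M N \<Longrightarrow> isomorphism (vocab K) f N N' \<Longrightarrow>
      isomorphism (vocab K) f M M' \<Longrightarrow> strong K M' N'"
    and coherence: "strong K M0 M2 \<Longrightarrow> strong K M1 M2 \<Longrightarrow> substructure (vocab K) M0 M1 \<Longrightarrow>
      strong K M0 M1"
    and chain_union_model: "limit_ordinal d \<Longrightarrow> (\<And>i. i < d \<Longrightarrow> C i \<in> models K) \<Longrightarrow>
      (\<And>i j. i \<le> j \<Longrightarrow> j < d \<Longrightarrow> strong K (C i) (C j)) \<Longrightarrow> chain_union d C \<in> models K"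
    and chain_union_upper: "limit_ordinal d \<Longrightarrow> (\<And>i. i < d \<Longrightarrow> C i \<in> models K) \<Longrightarrow>
      (\<And>i j. i \<le> j \<Longrightarrow> j < d \<Longrightarrow> strong K (C i) (C j)) \<Longrightarrow> i < d \<Longrightarrow>
      strong K (C i) (chain_union d C)"
    and smoothness: "limit_ordinal d \<Longrightarrow> (\<And>i. i < d \<Longrightarrow> C i \<in> models K) \<Longrightarrow>
      (\<And>i j. i \<le> j \<Longrightarrow> j < d \<Longrightarrow> strong K (C i) (C j)) \<Longrightarrow> N \<in> models K \<Longrightarrow>
      (\<And>i. i < d \<Longrightarrow> strong K (C i) N) \<Longrightarrow> strong K (chain_union d C) N"
    and Lowenheim_Skolem: "\<exists>l. LS_bound K l"

definition embedding ::
  "'u::universe abstract_class \<Rightarrow> ('u \<Rightarrow> 'u) \<Rightarrow> 'u struct \<Rightarrow> 'u struct \<Rightarrow> bool" where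
  "embedding K f M N \<longleftrightarrow> (\<exists>M'. isomorphism (vocab K) f M M' \<and> strong K M' N)"

definition amalgamation :: "'u::universe abstract_class \<Rightarrow> bool" where
  "amalgamation K \<longleftrightarrow>
    (\<forall>M0 M1 M2. strong K M0 M1 \<and> strong K M0 M2 \<longrightarrow>
      (\<exists>N\<in>models K. \<exists>f1 f2. embedding K f1 M1 N \<and> embedding K f2 M2 N \<and>
         (\<forall>x\<in>points M0. f1 x = x \<and> f2 x = x)))"


section \<open>Galois types\<close>

text \<open>
  A tuple is an extensional function on an index set \<open>I\<close> of arbitrary type; a sequence of
  length \<open>\<alpha>\<close> has index set \<open>{..<\<alpha>}\<close>.
\<close>

type_synonym ('i, 'u) triple = "('i \<Rightarrow> 'u) \<times> 'u set \<times> 'u struct"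

definition triples :: "'u::universe abstract_class \<Rightarrow> 'i set \<Rightarrow> ('i, 'u) triple set" where
  "triples K I = {(b, A, N). N \<in> models K \<and> A \<subseteq> points N \<and> b \<in> I \<rightarrow>\<^sub>E points N}"

definition E_at :: "'u::universe abstract_class \<Rightarrow> 'i set \<Rightarrow> ('i, 'u) triple rel" where
  "E_at K I = {((b1, A1, N1), (b2, A2, N2)).
     (b1, A1, N1) \<in> triples K I \<and> (b2, A2, N2) \<in> triples K I \<and> A1 = A2 \<and>
     (\<exists>N\<in>models K. \<exists>f1 f2. embedding K f1 N1 N \<and> embedding K f2 N2 N \<and>
        (\<forall>x\<in>A1. f1 x = x \<and> f2 x = x) \<and> (\<forall>i\<in>I. f1 (b1 i) = f2 (b2 i)))}"

definition gtp :: "'u::universe abstract_class \<Rightarrow> 'i set \<Rightarrow> ('i \<Rightarrow> 'u) \<Rightarrow> 'u set \<Rightarrow> 'u struct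
    \<Rightarrow> ('i, 'u) triple set" where
  "gtp K I b A N = (E_at K I)\<^sup>+ `` {(b, A, N)}"

definition gtp1 :: "'u::universe abstract_class \<Rightarrow> 'u \<Rightarrow> 'u set \<Rightarrow> 'u struct
    \<Rightarrow> (unit, 'u) triple set" where
  "gtp1 K b A N = gtp K {()} (\<lambda>_. b) A N"

definition gS :: "'u::universe abstract_class \<Rightarrow> 'u struct \<Rightarrow> (unit, 'u) triple set set" where
  "gS K M = {gtp1 K b (points M) N | b N. strong K M N \<and> b \<in> points N}"

text \<open>
  The restriction of \<open>gtp(b/A;N)\<close> to \<open>A0\<close> is \<open>gtp(b/A0;N)\<close>. The union over all
  representatives is over equal sets; this is lemma \<open>gtp_restrict_gtp\<close> below.
\<close>

definition gtp_restrict :: "'u::universe abstract_class \<Rightarrow> 'i set \<Rightarrow> ('i, 'u) triple set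
    \<Rightarrow> 'u set \<Rightarrow> ('i, 'u) triple set" where
  "gtp_restrict K I p A0 = (\<Union>(b, A, N)\<in>p. gtp K I b A0 N)"

definition tame_below :: "'u::universe abstract_class \<Rightarrow> 'u \<Rightarrow> bool" where
  "tame_below K k \<longleftrightarrow>
    (\<forall>M\<in>models K. \<forall>p\<in>gS K M. \<forall>q\<in>gS K M. p \<noteq> q \<longrightarrow>
      (\<exists>A0\<subseteq>points M. |A0| <o |{..<k}| \<and> gtp_restrict K {()} p A0 \<noteq> gtp_restrict K {()} q A0))"


section \<open>Stability and the order property\<close>

definition stable_in :: "'u::universe abstract_class \<Rightarrow> 'u \<Rightarrow> bool" where
  "stable_in K l \<longleftrightarrow>
    (\<forall>N\<in>models K. \<forall>A\<subseteq>points N. |A| \<le>o |{..<l}| \<longrightarrow>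
      |{gtp1 K b A N | b. b \<in> points N}| \<le>o |{..<l}| )"

definition is_stable :: "'u::universe abstract_class \<Rightarrow> bool" where
  "is_stable K \<longleftrightarrow> (\<forall>m. cardinal m \<longrightarrow> (\<exists>l\<ge>m. cardinal l \<and> stable_in K l))"

text \<open>The concatenation of two sequences of length \<open>\<alpha>\<close> is indexed by \<open>{..<\<alpha>} <+> {..<\<alpha>}\<close>.\<close>

definition has_order_property_of_length ::
  "'u::universe abstract_class \<Rightarrow> 'u struct \<Rightarrow> 'u \<Rightarrow> 'u \<Rightarrow> bool" where
  "has_order_property_of_length K M \<alpha> m \<longleftrightarrow>
    (\<exists>a. (\<forall>i<m. a i \<in> {..<\<alpha>} \<rightarrow>\<^sub>E points M) \<and>
      (\<forall>i0 j0 i1 j1. i0 < j0 \<and> j0 < m \<and> i1 < j1 \<and> j1 < m \<longrightarrow>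
         gtp K ({..<\<alpha>} <+> {..<\<alpha>}) (case_sum (a i0) (a j0)) {} M
         \<noteq> gtp K ({..<\<alpha>} <+> {..<\<alpha>}) (case_sum (a j1) (a i1)) {} M))"

definition order_property_at :: "'u::universe abstract_class \<Rightarrow> 'u \<Rightarrow> bool" where
  "order_property_at K \<alpha> \<longleftrightarrow>
    (\<forall>m. cardinal m \<longrightarrow> (\<exists>M\<in>models K. has_order_property_of_length K M \<alpha> m))"

definition order_property_below :: "'u::universe abstract_class \<Rightarrow> 'u \<Rightarrow> bool" where
  "order_property_below K k \<longleftrightarrow> (\<exists>\<alpha><k. cardinal \<alpha> \<and> order_property_at K \<alpha>)"

definition order_property :: "'u::universe abstract_class \<Rightarrow> bool" where
  "order_property K \<longleftrightarrow> (\<exists>\<alpha>. cardinal \<alpha> \<and> order_property_at K \<alpha>)"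


section \<open>Restriction of Galois types is well defined\<close>

lemma (in aec) embedding_refl:
  assumes "M \<in> models K"
  shows "embedding K (\<lambda>x. x) M M"
  unfolding embedding_def isomorphism_def
  using assms model_structure[OF assms] strong_refl[OF assms] by (auto simp: bij_betw_def)

lemma E_at_iff:
  "((b1, A1, N1), (b2, A2, N2)) \<in> E_at K I \<longleftrightarrow>
     (b1, A1, N1) \<in> triples K I \<and> (b2, A2, N2) \<in> triples K I \<and> A1 = A2 \<and>
     (\<exists>N\<in>models K. \<exists>f1 f2. embedding K f1 N1 N \<and> embedding K f2 N2 N \<and>
        (\<forall>x\<in>A1. f1 x = x \<and> f2 x = x) \<and> (\<forall>i\<in>I. f1 (b1 i) = f2 (b2 i)))"
  by (simp add: E_at_def)

lemma (in aec) triples_E_at_refl: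
  assumes "(b, A, N) \<in> triples K I"
  shows "((b, A, N), (b, A, N)) \<in> E_at K I"
proof -
  have "N \<in> models K"
    using assms by (simp add: triples_def)
  moreover from this have "embedding K (\<lambda>x. x) N N"
    by (rule embedding_refl)
  ultimately show ?thesis
    unfolding E_at_iff using assms by blast
qed

lemma sym_E_at: "sym (E_at K I)"
proof (rule symI)
  fix s t
  assume "(s, t) \<in> E_at K I"
  then show "(t, s) \<in> E_at K I"
    by (cases s; cases t) (simp only: E_at_iff, metis)
qed

lemma E_at_mono_domain:
  assumes "((b1, A1, N1), (b2, A2, N2)) \<in> E_at K I" and "A0 \<subseteq> A1"
  shows "A2 = A1" and "((b1, A0, N1), (b2, A0, N2)) \<in> E_at K I"
proof -
  from assms(1) show eq: "A2 = A1"
    by (simp add: E_at_iff)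
  have "(b1, A0, N1) \<in> triples K I" "(b2, A0, N2) \<in> triples K I"
    using assms eq by (auto simp: E_at_iff triples_def)
  then show "((b1, A0, N1), (b2, A0, N2)) \<in> E_at K I"
    using assms unfolding E_at_iff by (meson subsetD)
qed

lemma E_at_trancl_mono_domain:
  assumes "(t1, t2) \<in> (E_at K I)\<^sup>+" and "A0 \<subseteq> fst (snd t1)"
  shows "fst (snd t2) = fst (snd t1) \<and>
    ((fst t1, A0, snd (snd t1)), (fst t2, A0, snd (snd t2))) \<in> (E_at K I)\<^sup>+"
  using assms
proof (induction rule: trancl_induct)
  case (base y)
  obtain b1 A1 N1 b2 A2 N2 where "t1 = (b1, A1, N1)" "y = (b2, A2, N2)"
    by (cases t1; cases y)
  then show ?case
    using E_at_mono_domain[of b1 A1 N1 b2 A2 N2 K I A0] base by auto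
next
  case (step y z)
  obtain b1 A1 N1 b2 A2 N2 where yz: "y = (b1, A1, N1)" "z = (b2, A2, N2)"
    by (cases y; cases z)
  have IH: "A1 = fst (snd t1)" "((fst t1, A0, snd (snd t1)), (b1, A0, N1)) \<in> (E_at K I)\<^sup>+"
    using step yz by auto
  have "A2 = A1" "((b1, A0, N1), (b2, A0, N2)) \<in> E_at K I"
    using E_at_mono_domain[of b1 A1 N1 b2 A2 N2 K I A0] step.hyps(2) step.prems IH(1) yz by auto
  then show ?case
    using IH yz by (simp add: trancl.trancl_into_trancl)
qed

lemma gtp_eqI:
  assumes "((b1, A1, N1), (b2, A2, N2)) \<in> (E_at K I)\<^sup>+"
  shows "gtp K I b1 A1 N1 = gtp K I b2 A2 N2"
proof -
  have "((b2, A2, N2), (b1, A1, N1)) \<in> (E_at K I)\<^sup>+"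
    using assms sym_trancl[OF sym_E_at] by (meson symD)
  then show ?thesis
    unfolding gtp_def using assms by (auto intro: trancl_trans)
qed

lemma (in aec) gtp_restrict_gtp:
  assumes "(b, A, N) \<in> triples K I" and "A0 \<subseteq> A"
  shows "gtp_restrict K I (gtp K I b A N) A0 = gtp K I b A0 N"
proof -
  have self: "(b, A, N) \<in> gtp K I b A N"
    unfolding gtp_def using triples_E_at_refl[OF assms(1)] by auto
  have "gtp K I b' A0 N' = gtp K I b A0 N" if "(b', A', N') \<in> gtp K I b A N" for b' A' N'
    using that E_at_trancl_mono_domain[of "(b, A, N)" "(b', A', N')" K I A0] assms(2)
    unfolding gtp_def[of K I b A N] by (auto dest: gtp_eqI)
  then have "(\<lambda>(b, A, N). gtp K I b A0 N) t = gtp K I b A0 N" if "t \<in> gtp K I b A N" for t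
    using that by (cases t) simp
  then show ?thesis
    unfolding gtp_restrict_def using self by (intro SUP_eq_const) auto
qed

end

theory Submission
  imports Defs "HOL-Library.Equipollence"
begin

text \<open>
  Suppose that (4) fails. Let \<open>\<chi>\<close> be the argument of the Hanf number, \<open>\<rho> = \<beth>\<^sub>i \<ge> 2\<^sup>\<chi>\<close>, and
  let \<open>K\<close> be unstable in some \<open>\<lambda> = \<lambda>\<^sup>\<rho> \<ge> 2^2^\<rho>\<close>. Over a suitably saturated model of size \<open>\<lambda>\<close>, tameness
  leaves at most \<open>\<lambda>\<close> types that do not split over a set of size \<open>\<rho>\<close>; so some type splits over
  all of them, and this yields elements \<open>c\<^sub>i\<close> and tuples \<open>a\<^sub>i\<close>, \<open>b\<^sub>i\<close> of length \<open>< \<kappa>\<close> for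
  \<open>i < \<rho>\<^sup>+\<close> with \<open>gtp(c\<^sub>i a\<^sub>j) = gtp(c\<^sub>i b\<^sub>j)\<close> iff \<open>i < j\<close>. Such sequences of all lengths below the
  Hanf number give, by Erdos-Rado and Ehrenfeucht-Mostowski models, the same configuration along
  every linear order. Along well-orders this is the \<open>(<\<kappa>)\<close>-order property; along an order with a
  dense subset of size \<open>\<lambda>\<close> and more than \<open>\<lambda>\<close> cuts it gives, because the \<open>c\<^sub>i\<close> are single elements,
  instability in every \<open>\<lambda> \<ge> LS(K) + \<kappa>\<^sup>-\<close>. Conversely, (4) supplies cardinals \<open>\<lambda> = \<lambda>\<^sup>\<alpha>\<close> in which
  \<open>K\<close> is stable; there it is also stable for types of \<open>\<alpha>\<close>-tuples, which the \<open>\<alpha>\<close>-order property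
  along a linear order with many cuts contradicts.

  The Ehrenfeucht-Mostowski models are built without terms: a finite set of indices generates a
  submodel that is enumerated in a fixed way, and the colour of the set is the atomic diagram of
  that enumeration.
\<close>

section \<open>Cardinal arithmetic on sets\<close>

text \<open>An abstract elementary class has no formulas and no compactness, so an order cannot be
  recorded by the truth value of a formula. Equality or inequality of two types over the empty set
  takes that place: it is decided by the type of the finitely many indices involved, and so survives
  the passage to another linear order. The bound in (4) comes from counting. For \<Theta> = \<kappa>
  + LS(K)^+, the cardinal \<chi> = \<Theta>^- bounds LS(K) and every cardinal below \<kappa>, while
  \<kappa> is at most \<chi>^+. Diagrams on \<chi> names number at most 2^\<chi>. The ordinal
  (2^\<chi>)^+ is regular and a limit: regularity makes one colour recur cofinally, and the limit
  leaves room for the finitely many beth steps that Erdos-Rado consumes at each finite size. Failure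
  of (4) is exploited at every i below (2^\<chi>)^+, with \<mu> = \<rho>^+ and \<lambda>_0 two beth
  steps above \<rho>. The implications proved are: if (4) fails then (1) and (3) fail; (4) implies
  (2) and stability in unboundedly many cardinals. The others are immediate.\<close>

lemma not_card_of_ordLeq_iff: "\<not> |A| \<le>o |B| \<longleftrightarrow> |B| <o |A|"
  by (meson card_of_Well_order not_ordLeq_iff_ordLess)

lemma not_card_of_ordLess_iff: "\<not> |A| <o |B| \<longleftrightarrow> |B| \<le>o |A|"
  by (meson card_of_Well_order not_ordLess_iff_ordLeq)

lemma card_of_image_le: "|A| \<le>o |B| \<Longrightarrow> |f ` A| \<le>o |B|"
  by (meson card_of_image ordLeq_transitive)

lemma card_of_subset_le: "A \<subseteq> A' \<Longrightarrow> |A'| \<le>o |B| \<Longrightarrow> |A| \<le>o |B|"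
  by (meson card_of_mono1 ordLeq_transitive)

lemma card_of_inj_on_le: "inj_on f A \<Longrightarrow> f ` A \<subseteq> B \<Longrightarrow> |A| \<le>o |B|"
  using card_of_ordLeq by blast

lemma card_of_le_surj:
  assumes "|A| \<le>o |B|" "A \<noteq> {}"
  obtains g where "g ` B = A"
  using assms card_of_ordLeq2 by metis

text \<open>Counting by invariants: types are later counted by bounding the diagrams or profiles
  that determine them.\<close>

lemma card_of_le_if_factors:
  assumes "\<And>x y. x \<in> X \<Longrightarrow> y \<in> X \<Longrightarrow> g x = g y \<Longrightarrow> f x = f y" and "|g ` X| \<le>o |B|"
  shows "|f ` X| \<le>o |B|"
proof -
  have "f ` X = (\<lambda>z. f (SOME x. x \<in> X \<and> g x = z)) ` (g ` X)"
  proof -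
    have "f (SOME y. y \<in> X \<and> g y = g x) = f x" if "x \<in> X" for x
    proof -
      have "(SOME y. y \<in> X \<and> g y = g x) \<in> X \<and> g (SOME y. y \<in> X \<and> g y = g x) = g x"
        by (rule someI[of _ x]) (use that in auto)
      then show ?thesis using assms(1) that by blast
    qed
    then show ?thesis by (force simp: image_image)
  qed
  then show ?thesis using card_of_image_le[OF assms(2)] by simp
qed

lemma card_of_Times_le:
  assumes "infinite B" "|A1| \<le>o |B|" "|A2| \<le>o |B|"
  shows "|A1 \<times> A2| \<le>o |B|"
  using card_of_Sigma_ordLeq_infinite[of B A1 "\<lambda>_. A2"] assms by simp

lemma card_of_Un_le:
  assumes "infinite B" "|A1| \<le>o |B|" "|A2| \<le>o |B|"
  shows "|A1 \<union> A2| \<le>o |B|"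
  by (rule card_of_Un_ordLeq_infinite_Field) (use assms card_of_Card_order[of B] in \<open>auto simp: Field_card_of\<close>)

lemma card_of_Plus_le:
  assumes "infinite B" "|A1| \<le>o |B|" "|A2| \<le>o |B|"
  shows "|A1 <+> A2| \<le>o |B|"
  by (rule card_of_Plus_ordLeq_infinite_Field) (use assms card_of_Card_order[of B] in \<open>auto simp: Field_card_of\<close>)

lemma card_of_UN_le:
  assumes "infinite B" "|I| \<le>o |B|" "\<And>i. i \<in> I \<Longrightarrow> |A i| \<le>o |B|"
  shows "|\<Union>i\<in>I. A i| \<le>o |B|"
  using assms by (intro card_of_UNION_ordLeq_infinite) auto

lemma card_of_finite_less: "finite A \<Longrightarrow> infinite B \<Longrightarrow> |A| <o |B|"
  by (rule finite_ordLess_infinite[OF card_of_Well_order card_of_Well_order]) (auto simp: Field_card_of)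

lemma card_of_finite_le: "infinite B \<Longrightarrow> finite A \<Longrightarrow> |A| \<le>o |B|"
  by (meson card_of_finite_less ordLess_imp_ordLeq)

lemma card_of_psubset_less:
  assumes "A \<subset> B" "finite B"
  shows "|A| <o |B|"
proof (rule ccontr)
  assume "\<not> ?thesis"
  then obtain f where "inj_on f B" "f ` B \<subseteq> A"
    using not_card_of_ordLess_iff card_of_ordLeq by metis
  then have "card B \<le> card A" using assms finite_subset by (intro card_inj_on_le[of f]) auto
  then show False using psubset_card_mono[OF assms(2,1)] by simp
qed

lemma card_of_csum_le:
  assumes "infinite B" "|A1| \<le>o |B|" "|A2| \<le>o |B|"
  shows "|A1| +c |A2| \<le>o |B|"
  using card_of_Plus_le[OF assms] by (simp add: csum_def Field_card_of)

lemma infinite_card_of_le: "infinite A \<Longrightarrow> |A| \<le>o |B| \<Longrightarrow> infinite B"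
  using card_of_ordLeq_infinite by blast

lemma card_of_lists_le:
  assumes "infinite B" "|A| \<le>o |B|"
  shows "|lists A| \<le>o |B|"
proof -
  have *: "|{xs \<in> lists A. length xs = n}| \<le>o |B|" for n
  proof (induction n)
    case 0
    show ?case by (rule card_of_finite_le[OF assms(1)]) (rule finite_subset[of _ "{[]}"], auto)
  next
    case (Suc n)
    have "{xs \<in> lists A. length xs = Suc n} \<subseteq> (\<lambda>(x, xs). x # xs) ` (A \<times> {xs \<in> lists A. length xs = n})"
      by (auto simp: length_Suc_conv image_iff)
    then show ?case
      by (rule card_of_subset_le[OF _ card_of_image_le[OF card_of_Times_le[OF assms(1) assms(2) Suc]]])
  qed
  have "|UNIV :: nat set| \<le>o |B|" using assms(1) infinite_iff_card_of_nat by blast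
  then have "|\<Union>n. {xs \<in> lists A. length xs = n}| \<le>o |B|" by (intro card_of_UN_le assms(1) *)
  then show ?thesis by (rule card_of_subset_le[rotated]) auto
qed

lemma card_of_Fpow_le:
  assumes "infinite B" "|A| \<le>o |B|"
  shows "|Fpow A| \<le>o |B|"
proof -
  have "Fpow A \<subseteq> set ` lists A"
  proof
    fix F assume "F \<in> Fpow A"
    then have "F \<subseteq> A" "finite F" by (auto simp: Fpow_def)
    then obtain xs where "set xs = F" using finite_list by blast
    then show "F \<in> set ` lists A" using \<open>F \<subseteq> A\<close> by auto
  qed
  then show ?thesis by (rule card_of_subset_le[OF _ card_of_image_le[OF card_of_lists_le[OF assms]]])
qed

lemma card_of_Pow_mono: "|A| \<le>o |B| \<Longrightarrow> |Pow A| \<le>o |Pow B|"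
proof -
  assume "|A| \<le>o |B|"
  then obtain f where "inj_on f A" "f ` A \<subseteq> B" unfolding card_of_ordLeq[symmetric] by blast
  then show ?thesis
    by (intro card_of_inj_on_le[OF inj_on_image_Pow]) auto
qed

lemma card_of_le_Pow: "|A| \<le>o |Pow A|"
  by (simp add: card_of_Pow ordLess_imp_ordLeq)

lemma card_of_PiE_mono:
  assumes "|A| \<le>o |A'|" "|B| \<le>o |B'|" "B \<noteq> {}"
  shows "|A \<rightarrow>\<^sub>E B| \<le>o |A' \<rightarrow>\<^sub>E B'|"
  using lepoll_funcset[of B A A' B'] assms unfolding lepoll_def card_of_ordLeq by blast

text \<open>The law (2^c)^a = 2^(ca) for a \<le> c: a function into \<open>Pow C\<close> is coded by
  a subset of \<open>A \<times> C\<close>.\<close>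

lemma card_of_PiE_le_Pow:
  assumes "infinite C" "|A| \<le>o |C|" "|B| \<le>o |Pow C|"
  shows "|A \<rightarrow>\<^sub>E B| \<le>o |Pow C|"
proof -
  obtain f where f: "inj_on f B" "f ` B \<subseteq> Pow C" using assms(3) card_of_ordLeq by metis
  let ?h = "\<lambda>g. {(a, c). a \<in> A \<and> c \<in> f (g a)}"
  have "inj_on ?h (A \<rightarrow>\<^sub>E B)"
  proof (rule inj_onI)
    fix g g' assume g: "g \<in> A \<rightarrow>\<^sub>E B" "g' \<in> A \<rightarrow>\<^sub>E B" and eq: "?h g = ?h g'"
    show "g = g'"
    proof (rule PiE_ext[OF g])
      fix a assume a: "a \<in> A"
      then have "f (g a) = f (g' a)" using eq by blast
      then show "g a = g' a" using f(1) g a by (meson PiE_mem inj_onD)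
    qed
  qed
  moreover have "?h ` (A \<rightarrow>\<^sub>E B) \<subseteq> Pow (A \<times> C)" using f(2) by fastforce
  ultimately have "|A \<rightarrow>\<^sub>E B| \<le>o |Pow (A \<times> C)|" by (rule card_of_inj_on_le)
  also have "|Pow (A \<times> C)| \<le>o |Pow C|"
    using assms by (intro card_of_Pow_mono card_of_Times_le) (auto intro: card_of_refl ordIso_imp_ordLeq)
  finally show ?thesis .
qed

lemma card_of_Pow_insert:
  assumes "infinite B" "|Pow A| \<le>o |B|"
  shows "|Pow (insert a A)| \<le>o |B|"
  unfolding Pow_insert by (intro card_of_Un_le card_of_image_le assms)

text \<open>If every fibre had size at most |B|, then so would the union of the at most |B| many
  fibres.\<close>

lemma pigeonhole_card:
  assumes "infinite B" "|S| \<le>o |B|" "|B| <o |X|" "f ` X \<subseteq> S"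
  obtains s where "s \<in> S" "|B| <o |{x \<in> X. f x = s}|"
proof -
  have "\<exists>s\<in>S. |B| <o |{x \<in> X. f x = s}|"
  proof (rule ccontr)
    assume "\<not> ?thesis"
    then have "|{x \<in> X. f x = s}| \<le>o |B|" if "s \<in> S" for s
      using that not_card_of_ordLess_iff by blast
    then have "|\<Union>s\<in>S. {x \<in> X. f x = s}| \<le>o |B|"
      by (intro card_of_UN_le assms)
    moreover have "(\<Union>s\<in>S. {x \<in> X. f x = s}) = X" using assms(4) by auto
    ultimately show False using assms(3) not_ordLess_ordLeq by auto
  qed
  then show ?thesis using that by blast
qed

lemma card_of_subsets_le:
  assumes "|R \<rightarrow>\<^sub>E L| \<le>o |L|" "|A| \<le>o |L|" "infinite L" 
  shows "|{B. B \<subseteq> A \<and> |B| \<le>o |R|}| \<le>o |L|"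
proof -
  \<comment> \<open>Every nonempty set in question is the range of a function on \<open>R\<close>;
    only the empty set needs a place of its own.\<close>
  have "{B. B \<subseteq> A \<and> |B| \<le>o |R|} \<subseteq> insert {} ((\<lambda>f. f ` R) ` (R \<rightarrow>\<^sub>E A))"
  proof
    fix B assume "B \<in> {B. B \<subseteq> A \<and> |B| \<le>o |R|}"
    then have B: "B \<subseteq> A" "|B| \<le>o |R|" by auto
    show "B \<in> insert {} ((\<lambda>f. f ` R) ` (R \<rightarrow>\<^sub>E A))"
    proof (cases "B = {}")
      case False
      then obtain g where g: "g ` R = B" using B card_of_le_surj by metis
      then have "restrict g R \<in> R \<rightarrow>\<^sub>E A" "B = restrict g R ` R" using B by auto
      then show ?thesis by blast
    qed simp
  qed
  moreover have "|insert {} ((\<lambda>f. f ` R) ` (R \<rightarrow>\<^sub>E A))| \<le>o |L|"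
  proof -
    have "|R \<rightarrow>\<^sub>E A| \<le>o |L|"
    proof (cases "A = {}")
      case True
      then show ?thesis
        by (intro card_of_finite_le assms) (rule finite_subset[of _ "{\<lambda>_. undefined}"], auto simp: PiE_def extensional_def)
    next
      case False
      have "|R \<rightarrow>\<^sub>E A| \<le>o |R \<rightarrow>\<^sub>E L|" by (intro card_of_PiE_mono assms False card_of_mono1) simp
      then show ?thesis using assms(1) ordLeq_transitive by blast
    qed
    then have "|{{}} \<union> ((\<lambda>f. f ` R) ` (R \<rightarrow>\<^sub>E A))| \<le>o |L|"
      using card_of_image_le card_of_finite_le[OF assms(3), of "{{}}"] by (intro card_of_Un_le assms) auto
    then show ?thesis by simp
  qed
  ultimately show ?thesis by (rule card_of_subset_le)
qed

section \<open>Ordinals and cardinals of the universe\<close>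

lemma infinite_universe: "infinite (UNIV :: 'u::universe set)"
proof -
  obtain x :: 'u where "infinite {..<x}" using uncountable_universe by (elim exE)
  then show ?thesis by (rule infinite_super[OF subset_UNIV])
qed

lemma ex_ordinal_ge:
  assumes "|A| <o |UNIV :: 'u::universe set|"
  shows "\<exists>x::'u. |A| \<le>o |{..<x}|"
proof -
  obtain f :: "'a \<Rightarrow> 'u" where f: "inj_on f A"
    using ordLess_imp_ordLeq[OF assms] unfolding card_of_ordLeq[symmetric] by blast
  have "|f ` A| <o |UNIV :: 'u set|"
    using assms card_of_image ordLeq_ordLess_trans by blast
  then obtain x where "\<forall>a\<in>f ` A. a < x" using regular_universe by blast
  then have "f ` A \<subseteq> {..<x}" by auto
  then show ?thesis using card_of_inj_on_le[OF f] by blast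
qed

text \<open>The well-order \<open>|A|\<close> is shorter than \<open>|{..<x}|\<close>, which is at
  most as long as the order \<open>?r\<close> of the type itself below \<open>x\<close>. So
  \<open>|A|\<close> is isomorphic to a proper initial segment of \<open>?r\<close>, and such a
  segment has the form \<open>{..<a}\<close>.\<close>

lemma ex_ordinal_eq:
  assumes "|A| \<le>o |{..<x::'u::universe}|"
  shows "\<exists>y\<le>x. |A| =o |{..<y}|"
proof (cases "|A| =o |{..<x}|")
  case False
  then have less: "|A| <o |{..<x}|" using assms ordLeq_iff_ordLess_or_ordIso by blast
  let ?r = "{(a, b). a \<le> b \<and> b < x}"
  have F: "Field ?r = {..<x}" by (auto simp: Field_def)
  have "wf (?r - Id)"
    by (rule wf_subset[OF wf[where 'a='u]]) auto
  then have wo: "Well_order ?r"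
    unfolding well_order_on_def linear_order_on_def partial_order_on_def preorder_on_def F
    by (auto simp: refl_on_def trans_def antisym_def total_on_def F)
  have "|{..<x}| \<le>o ?r" using card_of_least wo F by metis
  then have "|A| <o ?r" using less ordLess_ordLeq_trans by blast
  then obtain a where a: "a \<in> Field ?r" "|A| =o Restr ?r (underS ?r a)"
    using ordLess_iff_ordIso_Restr[OF wo card_of_Well_order[of A]] by blast
  have "Field (Restr ?r (underS ?r a)) = {..<a}"
    using a(1) F by (auto simp: Field_def underS_def)
  then have "|A| =o |{..<a}|" using card_of_cong[OF a(2)] by (simp add: Field_card_of)
  moreover have "a \<le> x" using a(1) unfolding F by (simp add: less_imp_le)
  ultimately show ?thesis by blast
next
  case True
  then show ?thesis by blast
qed

lemma
  fixes k :: "'u::universe"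
  assumes "|A| <o |UNIV :: 'u set|" and k: "k = cardinality A"
  shows card_of_cardinality: "|{..<k}| =o |A|"
    and cardinal_cardinality: "cardinal k"
    and cardinality_le: "|A| \<le>o |{..<y}| \<Longrightarrow> k \<le> y"
proof -
  obtain x :: 'u where "|A| \<le>o |{..<x}|" using ex_ordinal_ge assms(1) by blast
  then have "|A| \<le>o |{..<k}|" unfolding k cardinality_def by (rule LeastI)
  have least: "k \<le> y" if "|A| \<le>o |{..<y}|" for y
    unfolding k cardinality_def using that by (rule Least_le)
  then show "|A| \<le>o |{..<y}| \<Longrightarrow> k \<le> y" .
  obtain y where "y \<le> k" "|A| =o |{..<y}|" using ex_ordinal_eq \<open>|A| \<le>o |{..<k}|\<close> by blast
  then have "k \<le> y" using least ordIso_imp_ordLeq by blast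
  then show eq: "|{..<k}| =o |A|" using \<open>y \<le> k\<close> \<open>|A| =o |{..<y}|\<close> ordIso_symmetric by auto
  show "cardinal k" unfolding cardinal_def
  proof (intro allI impI)
    fix z assume "z < k"
    then have "\<not> |A| \<le>o |{..<z}|" using least[of z] by (auto simp: not_le)
    then show "|{..<z}| <o |{..<k}|"
      using eq not_card_of_ordLeq_iff ordIso_symmetric ordLess_ordIso_trans by blast
  qed
qed

lemma cardinal_less_iff:
  assumes "cardinal k" "cardinal (l::'u::universe)"
  shows "|{..<k}| <o |{..<l}| \<longleftrightarrow> k < l"
proof
  assume *: "|{..<k}| <o |{..<l}|"
  show "k < l"
  proof (rule ccontr)
    assume "\<not> k < l"
    then have "|{..<l}| \<le>o |{..<k}|" by (intro card_of_mono1) auto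
    then show False using * not_ordLess_ordLeq by blast
  qed
next
  assume "k < l"
  then show "|{..<k}| <o |{..<l}|" using assms(2) unfolding cardinal_def by blast
qed

lemma cardinal_le_iff:
  assumes "cardinal k" "cardinal (l::'u::universe)"
  shows "|{..<k}| \<le>o |{..<l}| \<longleftrightarrow> k \<le> l"
  using cardinal_less_iff[OF assms(2,1)] not_card_of_ordLess_iff[of "{..<l}" "{..<k}"] by auto

lemma card_of_lessThan_mono: "x \<le> (y::'u::universe) \<Longrightarrow> |{..<x}| \<le>o |{..<y}|"
  by (intro card_of_mono1) auto

lemma cardinal_unique:
  "cardinal k \<Longrightarrow> cardinal l \<Longrightarrow> |{..<k}| =o |{..<l::'u::universe}| \<Longrightarrow> k = l"
  using cardinal_le_iff[of k l] cardinal_le_iff[of l k] by (auto simp: ordIso_iff_ordLeq)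

lemma ex_greater: "\<exists>y. (x::'u::universe) < y"
proof -
  have "|{x}| <o |UNIV :: 'u set|" using infinite_universe by (intro card_of_finite_less) auto
  then show ?thesis using regular_universe[of "{x}"] by blast
qed

text \<open>The \<open>LEAST\<close> is attained because the universe has no last ordinal.\<close>

definition osucc :: "'u::universe \<Rightarrow> 'u" where
  "osucc x = (LEAST y. x < y)"

lemma less_osucc_iff [simp]: "y < osucc x \<longleftrightarrow> y \<le> x"
proof -
  have "x < osucc x" unfolding osucc_def by (rule LeastI_ex) (rule ex_greater)
  then have "y < osucc x" if "y \<le> x" using that by order
  moreover have "y \<le> x" if "y < osucc x"
  proof (rule ccontr)
    assume "\<not> y \<le> x"
    then have "osucc x \<le> y" unfolding osucc_def by (intro Least_le) order
    then show False using that by order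
  qed
  ultimately show ?thesis by blast
qed

lemma less_osucc: "x < osucc x"
  by simp

lemma osucc_le_iff: "osucc x \<le> y \<longleftrightarrow> x < y"
  using less_osucc_iff[of y x] linorder_not_le[of "osucc x" y] linorder_not_le[of y x] by blast

lemma lessThan_osucc: "{..<osucc x} = insert x {..<x}"
  by (simp only: set_eq_iff lessThan_iff insert_iff less_osucc_iff le_less) blast

lemma succ_of_iff: "succ_of y x \<longleftrightarrow> x = osucc y"
  unfolding succ_of_def
proof
  assume a: "y < x \<and> (\<forall>z. \<not> (y < z \<and> z < x))"
  have "y < x" by (rule conjunct1[OF a])
  have *: "\<not> (y < osucc y \<and> osucc y < x)" by (rule spec[OF conjunct2[OF a]])
  from \<open>y < x\<close> have "osucc y \<le> x" by (simp add: osucc_le_iff)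
  moreover have "\<not> osucc y < x" using * less_osucc[of y] by simp
  ultimately show "x = osucc y" by order
next
  assume x: "x = osucc y"
  have False if "y < z" "z < x" for z
  proof -
    have "z \<le> y" using that(2) unfolding x less_osucc_iff .
    then show False using that(1) by order
  qed
  moreover have "y < x" unfolding x by (rule less_osucc)
  ultimately show "y < x \<and> (\<forall>z. \<not> (y < z \<and> z < x))" by blast
qed

lemma osucc_inject [simp]: "osucc x = osucc y \<longleftrightarrow> x = y"
proof
  assume "osucc x = osucc y"
  then have "x < osucc y" "y < osucc x" using less_osucc[of x] less_osucc[of y] by argo+
  then show "x = y" unfolding less_osucc_iff by order
qed simp

lemma ordinal_cases [case_names zero succ limit]:
  fixes x :: "'u::universe"
  obtains "is_zero x" | y where "x = osucc y" | "limit_ordinal x"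
proof (cases "is_zero x \<or> limit_ordinal x")
  case False
  then have "\<exists>y. x = osucc y" unfolding limit_ordinal_def succ_of_iff by auto
  then show ?thesis using that(2) by (elim exE)
next
  case True
  then show ?thesis using that(1,3) by (elim disjE)
qed

lemma limit_osucc: "limit_ordinal d \<Longrightarrow> i < d \<Longrightarrow> osucc i < d"
proof -
  assume d: "limit_ordinal d" "i < d"
  then have "d \<noteq> osucc i" unfolding limit_ordinal_def succ_of_iff by simp
  moreover have "osucc i \<le> d" using d(2) by (simp add: osucc_le_iff)
  ultimately show ?thesis by order
qed

lemma limit_nonempty: "limit_ordinal d \<Longrightarrow> \<exists>i. i < d"
  by (auto simp: limit_ordinal_def is_zero_def)

text \<open>Adding one point to an infinite segment \<open>{..<y}\<close> does not change its size,
  so \<open>osucc y\<close> is not a cardinal.\<close>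

lemma infinite_cardinal_limit:
  assumes "cardinal k" "infinite {..<k}"
  shows "limit_ordinal k"
  unfolding limit_ordinal_def succ_of_iff
proof (intro conjI notI)
  assume "is_zero k"
  then have "{..<k} = {}" by (auto simp: is_zero_def)
  then show False using assms(2) by simp
next
  assume "\<exists>y. k = osucc y"
  then obtain y where y: "k = osucc y" ..
  then have inf: "infinite {..<y}" using assms(2) by (simp add: lessThan_osucc)
  have "|{..<k}| \<le>o |{..<y}|" unfolding y lessThan_osucc
    using infinite_insert_lepoll[OF inf] unfolding lepoll_def card_of_ordLeq by blast
  moreover have "|{..<y}| <o |{..<k}|" using assms(1) y less_osucc unfolding cardinal_def by blast
  ultimately show False using not_ordLess_ordLeq by blast
qed

lemma finite_subset_limit:
  assumes "limit_ordinal d" "finite F" "F \<subseteq> {..<d}"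
  shows "\<exists>i<d. F \<subseteq> {..<i}"
  using assms(2,3)
proof (induction F rule: finite_induct)
  case empty then show ?case using limit_nonempty[OF assms(1)] by auto
next
  case (insert x F)
  then obtain i where i: "i < d" "F \<subseteq> {..<i}" by auto
  let ?m = "max i (osucc x)"
  have "?m < d" using i limit_osucc[OF assms(1)] insert.prems by auto
  moreover have "insert x F \<subseteq> {..<?m}" using i(2) by (auto simp: less_max_iff_disj)
  ultimately show ?case by blast
qed

lemma le_ordinal_less_universe: "|A| \<le>o |{..<x::'u::universe}| \<Longrightarrow> |A| <o |UNIV :: 'u set|"
  using initial_segment_small ordLeq_ordLess_trans by blast

lemma
  fixes k :: "'u::universe"
  shows card_of_two_power: "|{..<two_power k}| =o |Pow {..<k}|"
    and cardinal_two_power: "cardinal (two_power k)"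
  using card_of_cardinality[OF strong_limit_universe two_power_def]
    cardinal_cardinality[OF strong_limit_universe two_power_def] by auto

lemma
  fixes k :: "'u::universe"
  shows card_of_less_two_power: "|{..<k}| <o |{..<two_power k}|"
    and less_two_power: "k < two_power k"
proof -
  show *: "|{..<k}| <o |{..<two_power k}|"
    using card_of_Pow card_of_two_power ordIso_symmetric ordLess_ordIso_trans by blast
  show "k < two_power k"
  proof (rule ccontr)
    assume "\<not> k < two_power k"
    then have "|{..<two_power k}| \<le>o |{..<k}|" by (intro card_of_lessThan_mono) auto
    then show False using * not_ordLess_ordLeq by blast
  qed
qed

lemma
  fixes k :: "'u::universe"
  shows cardinal_card_succ: "cardinal (card_succ k)"
    and less_card_succ: "k < card_succ k"
    and card_succ_least: "cardinal l \<Longrightarrow> k < l \<Longrightarrow> card_succ k \<le> l"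
proof -
  have "\<exists>l. cardinal l \<and> k < l" using cardinal_two_power less_two_power by blast
  then have "cardinal (card_succ k) \<and> k < card_succ k" unfolding card_succ_def by (rule LeastI_ex)
  then show "cardinal (card_succ k)" "k < card_succ k" by auto
  show "cardinal l \<Longrightarrow> k < l \<Longrightarrow> card_succ k \<le> l"
    unfolding card_succ_def by (rule Least_le) simp
qed

lemma card_of_less_card_succ: "|{..<k}| <o |{..<card_succ (k::'u::universe)}|"
  using cardinal_card_succ less_card_succ unfolding cardinal_def by blast

lemma card_succ_less_le:
  assumes "|A| <o |{..<card_succ (k::'u::universe)}|" "cardinal k"
  shows "|A| \<le>o |{..<k}|"
proof -
  let ?c = "cardinality A :: 'u"
  have A: "|A| <o |UNIV :: 'u set|" using assms(1) le_ordinal_less_universe ordLess_imp_ordLeq by blast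
  note c = card_of_cardinality[OF A refl] cardinal_cardinality[OF A refl]
  have "|{..<?c}| <o |{..<card_succ k}|" using assms(1) c ordIso_ordLess_trans by blast
  then have "?c < card_succ k" using c cardinal_less_iff cardinal_card_succ by blast
  then have "?c \<le> k" using card_succ_least[OF c(2), of k] by (meson leD leI)
  then show ?thesis using c card_of_lessThan_mono ordIso_symmetric ordIso_ordLeq_trans by blast
qed

lemma card_of_below_card_succ:
  assumes "x < card_succ (k::'u::universe)" "cardinal k"
  shows "|{..<x}| \<le>o |{..<k}|"
  using assms cardinal_card_succ[of k] by (intro card_succ_less_le) (auto simp: cardinal_def)

lemma infinite_card_succ: "infinite {..<k::'u::universe} \<Longrightarrow> infinite {..<card_succ k}"
  by (rule infinite_card_of_le[OF _ card_of_lessThan_mono[OF less_imp_le[OF less_card_succ]]])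

lemma card_of_card_succ_le_Pow: "cardinal (k::'u::universe) \<Longrightarrow> |{..<card_succ k}| \<le>o |Pow {..<k}|"
  using card_succ_least[OF cardinal_two_power less_two_power] card_of_lessThan_mono card_of_two_power
    ordLeq_ordIso_trans by blast

text \<open>Regularity of a successor cardinal. The union of \<open>|B|\<close> many initial
  segments of size at most k has size at most k, so it misses some ordinal below k^+.\<close>

lemma card_succ_bounded:
  assumes k: "cardinal k" "infinite {..<k::'u::universe}"
    and "|B| \<le>o |{..<k}|" and f: "\<And>b. b \<in> B \<Longrightarrow> f b < card_succ k"
  obtains u where "u < card_succ k" "\<And>b. b \<in> B \<Longrightarrow> f b < u"
proof -
  \<comment> \<open>The segments include \<open>f b\<close> itself, so that an ordinal outside all
    of them is a strict bound.\<close>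
  have "|{..<osucc (f b)}| \<le>o |{..<k}|" if "b \<in> B" for b
    using that f limit_osucc infinite_cardinal_limit[OF cardinal_card_succ infinite_card_succ[OF k(2)]] k(1)
      card_of_below_card_succ by blast
  then have "|\<Union>b\<in>B. {..<osucc (f b)}| \<le>o |{..<k}|" by (intro card_of_UN_le assms) auto
  then have "|\<Union>b\<in>B. {..<osucc (f b)}| <o |{..<card_succ k}|"
    using card_of_less_card_succ ordLeq_ordLess_trans by blast
  then obtain u where "u < card_succ k" "u \<notin> (\<Union>b\<in>B. {..<osucc (f b)})"
    by (metis card_of_mono1 lessThan_iff not_ordLess_ordLeq subsetI)
  then show ?thesis using that by (auto simp: not_le)
qed

text \<open>Otherwise each value is avoided from some point on. By regularity these points have a
  common bound u below k^+, and then \<open>f u\<close> has no possible value.\<close>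

lemma pigeonhole_cofinal:
  assumes k: "cardinal k" "infinite {..<k::'u::universe}"
    and "|S| \<le>o |{..<k}|" and f: "\<And>j. j < card_succ k \<Longrightarrow> f j \<in> S"
  obtains s where "s \<in> S" "\<And>j. j < card_succ k \<Longrightarrow> \<exists>j'. j \<le> j' \<and> j' < card_succ k \<and> f j' = s"
proof -
  have "\<exists>s\<in>S. \<forall>j<card_succ k. \<exists>j'. j \<le> j' \<and> j' < card_succ k \<and> f j' = s"
  proof (rule ccontr)
    assume "\<not> ?thesis"
    then have "\<forall>s\<in>S. \<exists>j<card_succ k. \<forall>j'. j \<le> j' \<and> j' < card_succ k \<longrightarrow> f j' \<noteq> s" by blast
    then obtain g where g: "\<And>s. s \<in> S \<Longrightarrow> g s < card_succ k"
      "\<And>s j'. s \<in> S \<Longrightarrow> g s \<le> j' \<Longrightarrow> j' < card_succ k \<Longrightarrow> f j' \<noteq> s" by metis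
    obtain u where "u < card_succ k" "\<And>s. s \<in> S \<Longrightarrow> g s < u"
      using card_succ_bounded[OF k assms(3), of g] g(1) by blast
    then show False using f[of u] g(2)[of "f u" u] less_imp_le by blast
  qed
  then show ?thesis using that by blast
qed

section \<open>The least infinite cardinal and the beth hierarchy\<close>

lemma infinite_aleph0: "infinite {..<aleph0 :: 'u::universe}"
  unfolding aleph0_def using uncountable_universe by (rule LeastI_ex)

lemma aleph0_le: "infinite {..<x :: 'u::universe} \<Longrightarrow> aleph0 \<le> x"
  unfolding aleph0_def by (rule Least_le)

lemma cardinal_aleph0: "cardinal (aleph0 :: 'u::universe)"
  unfolding cardinal_def using aleph0_le infinite_aleph0 by (meson card_of_finite_less not_le)

lemma finite_cardinal_less_infinite:
  "finite {..<x::'u::universe} \<Longrightarrow> infinite {..<y} \<Longrightarrow> x < y"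
  by (metis finite_subset lessThan_subset_iff not_le)

lemma beth_zero: "is_zero x \<Longrightarrow> beth x = aleph0"
  by (simp add: beth.simps)

lemma beth_osucc: "beth (osucc x) = two_power (beth x)"
proof -
  have "\<not> is_zero (osucc x)" using less_osucc[of x] unfolding is_zero_def by blast
  moreover have "succ_of x (osucc x)" by (simp add: succ_of_iff)
  ultimately show ?thesis using the_succ_of[of x "osucc x"] by (subst beth.simps) auto
qed

lemma
  assumes "limit_ordinal (x::'u::universe)"
  shows beth_limit_ge: "y < x \<Longrightarrow> beth y \<le> beth x"
    and beth_limit_least: "(\<And>y. y < x \<Longrightarrow> beth y \<le> s) \<Longrightarrow> beth x \<le> s"
proof -
  have eq: "beth x = (LEAST s. \<forall>y\<in>{..<x}. beth y \<le> s)"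
    using assms by (subst beth.simps) (auto simp: limit_ordinal_def)
  have "|beth ` {..<x}| <o |UNIV :: 'u set|"
    using card_of_image initial_segment_small ordLeq_ordLess_trans by blast
  then obtain s where "\<forall>a\<in>beth ` {..<x}. a < s" using regular_universe by blast
  then have "\<forall>y\<in>{..<x}. beth y \<le> s" by (auto intro: less_imp_le)
  then have "\<forall>y\<in>{..<x}. beth y \<le> beth x" unfolding eq by (rule LeastI)
  then show "y < x \<Longrightarrow> beth y \<le> beth x" by auto
  show "beth x \<le> s" if "\<And>y. y < x \<Longrightarrow> beth y \<le> s" for s
    unfolding eq by (rule Least_le) (use that in auto)
qed

lemma beth_strict_mono: "x < y \<Longrightarrow> beth x < beth (y::'u::universe)"
proof (induction y rule: less_induct)
  case (less y)
  show ?case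
  proof (cases y rule: ordinal_cases)
    case zero then show ?thesis using less.prems by (auto simp: is_zero_def)
  next
    case (succ z)
    then have "x < z \<Longrightarrow> beth x < beth z" "x \<le> z" using less.IH[of z] less.prems by auto
    then have "beth x \<le> beth z" by (auto simp: le_less)
    also have "\<dots> < beth y" unfolding succ beth_osucc by (rule less_two_power)
    finally show ?thesis .
  next
    case limit
    have "beth x < beth (osucc x)" unfolding beth_osucc by (rule less_two_power)
    also have "\<dots> \<le> beth y" using limit limit_osucc less.prems by (intro beth_limit_ge) auto
    finally show ?thesis .
  qed
qed

lemma beth_mono: "x \<le> y \<Longrightarrow> beth x \<le> beth (y::'u::universe)"
  using beth_strict_mono[of x y] by (cases "x = y") (auto simp: less_le)

text \<open>A strictly increasing map of a well-order into itself nowhere falls below the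
  identity.\<close>

lemma le_beth: "x \<le> beth (x::'u::universe)"
proof (induction x rule: less_induct)
  case (less x)
  show ?case
  proof (rule ccontr)
    assume "\<not> x \<le> beth x"
    then have "beth x < x" by simp
    then show False using less[of "beth x"] beth_strict_mono[of "beth x" x] by (simp add: not_le[symmetric])
  qed
qed

lemma cardinal_beth: "cardinal (beth (x::'u::universe))"
proof (induction x rule: less_induct)
  case (less x)
  show ?case
  proof (cases x rule: ordinal_cases)
    case zero then show ?thesis by (simp add: beth_zero cardinal_aleph0)
  next
    case (succ z) then show ?thesis by (simp add: beth_osucc cardinal_two_power)
  next
    case limit
    show ?thesis unfolding cardinal_def
    proof (intro allI impI)
      fix z assume "z < beth x"
      then obtain y where y: "y < x" "z < beth y" using beth_limit_least[OF limit, of z] by (meson not_le)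
      then have "|{..<z}| <o |{..<beth y}|" using less.IH cardinal_def by blast
      then show "|{..<z}| <o |{..<beth x}|"
        using y beth_mono[of y x] card_of_lessThan_mono ordLess_ordLeq_trans by (meson less_imp_le)
    qed
  qed
qed

lemma infinite_beth: "infinite {..<beth (x::'u::universe)}"
proof -
  define z :: 'u where "z = (LEAST z. True)"
  have z: "is_zero z" unfolding is_zero_def z_def using not_less_Least by blast
  then have "z \<le> x" by (meson is_zero_def not_le)
  then show ?thesis using beth_mono[of z x] beth_zero[OF z] infinite_aleph0
    by (metis finite_subset lessThan_subset_iff)
qed

lemma card_of_beth_osucc: "|{..<beth (osucc x)}| =o |Pow {..<beth (x::'u::universe)}|"
  unfolding beth_osucc by (rule card_of_two_power)

section \<open>Sums and powers of cardinals, and the cardinal written with a superscript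
  minus\<close>

lemma
  fixes k l :: "'u::universe"
  shows card_of_card_add: "|{..<card_add k l}| =o |{..<k} <+> {..<l}|"
    and cardinal_card_add: "cardinal (card_add k l)"
proof -
  have *: "|{..<k} <+> {..<l}| <o |UNIV :: 'u set|"
    by (intro card_of_Plus_ordLess_infinite infinite_universe initial_segment_small)
  show "|{..<card_add k l}| =o |{..<k} <+> {..<l}|" "cardinal (card_add k l)"
    using card_of_cardinality[OF * card_add_def] cardinal_cardinality[OF * card_add_def] by auto
qed

lemma card_add_eq_max:
  fixes k l :: "'u::universe"
  assumes "cardinal k" "cardinal l" "infinite {..<k}"
  shows "card_add k l = max k l"
proof -
  have "cardinal (max k l)" using assms by (simp add: max_def)
  moreover have "|{..<k} <+> {..<l}| =o |{..<max k l}|"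
  proof -
    have inf: "infinite {..<max k l}" using assms(3) by (auto simp: max_def)  (metis finite_subset lessThan_subset_iff)
    have "|{..<k} <+> {..<l}| \<le>o |{..<max k l}|"
      by (intro card_of_Plus_le inf card_of_lessThan_mono) auto
    moreover have "|{..<max k l}| \<le>o |{..<k} <+> {..<l}|"
      by (simp add: max_def card_of_Plus1 card_of_Plus2)
    ultimately show ?thesis using ordIso_iff_ordLeq by blast
  qed
  ultimately show ?thesis
    using cardinal_unique cardinal_card_add card_of_card_add ordIso_transitive by blast
qed

lemma card_of_card_power:
  fixes k l :: "'u::universe"
  shows "|{..<card_power k l}| =o |{..<l} \<rightarrow>\<^sub>E {..<k}|" "cardinal (card_power k l)"
proof -
  obtain m :: 'u where m: "m \<ge> k" "m \<ge> l" "infinite {..<m}"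
    using infinite_aleph0 by (metis finite_subset lessThan_subset_iff linorder_linear)
  have "|{..<l} \<rightarrow>\<^sub>E {..<k}| \<le>o |Pow {..<m}|"
    using m by (intro card_of_PiE_le_Pow card_of_lessThan_mono ordLeq_transitive[OF _ card_of_le_Pow]) auto
  then have *: "|{..<l} \<rightarrow>\<^sub>E {..<k}| <o |UNIV :: 'u set|"
    using strong_limit_universe ordLeq_ordLess_trans by blast
  show "|{..<card_power k l}| =o |{..<l} \<rightarrow>\<^sub>E {..<k}|" "cardinal (card_power k l)"
    using card_of_cardinality[OF * card_power_def] cardinal_cardinality[OF * card_power_def] by auto
qed

text \<open>A \<open>LEAST\<close> says something only where a bound exists; here regularity of the
  universe bounds the small set of values \<open>card_power k t\<close> with t below m.\<close>

lemma card_power_le_card_power_less: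
  fixes k m :: "'u::universe"
  assumes "cardinal t" "t < m"
  shows "card_power k t \<le> card_power_less k m"
proof -
  have "|card_power k ` {..<m}| <o |UNIV :: 'u set|"
    using card_of_image initial_segment_small ordLeq_ordLess_trans by blast
  then obtain s where "\<forall>a\<in>card_power k ` {..<m}. a < s" using regular_universe by blast
  then have "\<forall>t. cardinal t \<and> t < m \<longrightarrow> card_power k t \<le> s" by (auto intro: less_imp_le)
  then have "\<forall>t. cardinal t \<and> t < m \<longrightarrow> card_power k t \<le> card_power_less k m"
    unfolding card_power_less_def by (rule LeastI)
  then show ?thesis using assms by blast
qed

text \<open>Collects what later arguments need from k^-. In the successor case the predecessor is
  infinite, because the cardinal successor of a finite ordinal l is \<open>osucc l\<close>, which
  would make k finite.\<close>

lemma card_minus_cases: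
  fixes k :: "'u::universe"
  assumes "infinite_cardinal k"
  shows "cardinal (card_minus k) \<and> infinite {..<card_minus k} \<and> card_minus k \<le> k \<and>
    (\<forall>x. x < k \<longrightarrow> |{..<x}| \<le>o |{..<card_minus k}| )"
proof (cases "\<exists>l. cardinal l \<and> card_succ l = k")
  case True
  then obtain l where l: "cardinal l" "card_succ l = k" by blast
  have "l' = l" if "cardinal l'" "card_succ l' = k" for l'
    using that l card_succ_least less_card_succ by (metis linorder_neqE not_le)
  then have "(THE l. cardinal l \<and> card_succ l = k) = l" using l by blast
  then have eq: "card_minus k = l" unfolding card_minus_def using True by simp
  have "infinite {..<l}"
  proof
    assume fin: "finite {..<l}"
    have "osucc l \<le> k" using l less_card_succ osucc_le_iff by blast
    moreover have "cardinal (osucc l)" unfolding cardinal_def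
    proof (intro allI impI)
      fix x assume "x < osucc l"
      then have "x \<le> l" by simp
      then have "{..<x} \<subseteq> {..<osucc l}" "l \<in> {..<osucc l} - {..<x}"
        by (auto dest: less_le_trans intro: less_imp_le)
      then have "{..<x} \<subset> {..<osucc l}" by blast
      then show "|{..<x}| <o |{..<osucc l}|"
        using fin by (intro card_of_psubset_less) (simp_all add: lessThan_osucc)
    qed
    ultimately have "k = osucc l" using l card_succ_least[of "osucc l" l] less_osucc by fastforce
    then show False using assms fin by (simp add: infinite_cardinal_def lessThan_osucc)
  qed
  then show ?thesis using eq l card_of_below_card_succ less_card_succ less_imp_le by metis
next
  case False
  then have "card_minus k = k" unfolding card_minus_def by auto
  then show ?thesis using assms by (simp add: infinite_cardinal_def card_of_lessThan_mono)
qed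

section \<open>Closing off, and the Erdos-Rado theorem\<close>

text \<open>Iterate \<Phi> through r^+ stages. Since r^+ is regular, a subset of the union of size
  at most r already lies in one stage, and the next stage absorbs its \<Phi>. A stage has at most
  |L|^r = |L| such subsets and r^+ \<le> 2^r \<le> |L|, so all sizes stay at most |L|.\<close>

lemma closed_set_exists:
  fixes r :: "'u::universe" and \<Phi> :: "'a set \<Rightarrow> 'a set"
  assumes r: "cardinal r" "infinite {..<r}"
    and L: "|Pow {..<r}| \<le>o |L|" "|{..<r} \<rightarrow>\<^sub>E L| \<le>o |L|"
    and A0: "A0 \<subseteq> X" "|A0| \<le>o |L|"
    and \<Phi>: "\<And>B. B \<subseteq> X \<Longrightarrow> |B| \<le>o |{..<r}| \<Longrightarrow> \<Phi> B \<subseteq> X \<and> |\<Phi> B| \<le>o |L|"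
  shows "\<exists>A. A0 \<subseteq> A \<and> A \<subseteq> X \<and> |A| \<le>o |L| \<and> (\<forall>B. B \<subseteq> A \<longrightarrow> |B| \<le>o |{..<r}| \<longrightarrow> \<Phi> B \<subseteq> A)"
proof -
  have infL: "infinite L" using infinite_card_of_le[OF _ L(1)] r(2) by simp
  have rL: "|{..<r}| \<le>o |L|" by (rule ordLeq_transitive[OF card_of_le_Pow L(1)])
  have srL: "|{..<card_succ r}| \<le>o |L|"
    by (rule ordLeq_transitive[OF card_of_card_succ_le_Pow[OF r(1)] L(1)])
  define S where "S = (\<lambda>D::'a set. {B. B \<subseteq> D \<and> |B| \<le>o |{..<r}| })"
  \<comment> \<open>The recursion runs through all ordinals of the universe; the size bound
    \<open>card\<close> concerns only the stages below r^+, whose union is kept.\<close>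
  have "\<exists>f. \<forall>i::'u. f i = A0 \<union> (\<Union>j\<in>{..<i}. \<Union>B\<in>S (f j). \<Phi> B)"
    by (rule dependent_wellorder_choice) auto
  then obtain f where f: "\<And>i::'u. f i = A0 \<union> (\<Union>j\<in>{..<i}. \<Union>B\<in>S (f j). \<Phi> B)" by blast
  have sub: "f i \<subseteq> X" for i :: 'u
  proof (induction i rule: less_induct)
    case (less i)
    show ?case
    proof
      fix z assume "z \<in> f i"
      then consider "z \<in> A0" | j B where "j < i" "B \<in> S (f j)" "z \<in> \<Phi> B" using f[of i] by blast
      then show "z \<in> X"
      proof cases
        case 2
        then have "B \<subseteq> X" "|B| \<le>o |{..<r}|" using less[of j] by (auto simp: S_def)
        then show ?thesis using \<Phi>[of B] 2(3) by blast
      qed (use A0 in blast)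
    qed
  qed
  have card: "|f i| \<le>o |L|" if "i < card_succ r" for i
    using that
  proof (induction i rule: less_induct)
    case (less i)
    have "|\<Union>j\<in>{..<i}. \<Union>B\<in>S (f j). \<Phi> B| \<le>o |L|"
    proof (intro card_of_UN_le infL)
      show "|{..<i}| \<le>o |L|"
        by (rule ordLeq_transitive[OF card_of_below_card_succ[OF less.prems r(1)] rL])
    next
      fix j assume "j \<in> {..<i}"
      then have j: "j < i" "j < card_succ r" using less.prems by auto
      show "|S (f j)| \<le>o |L|" unfolding S_def
        by (rule card_of_subsets_le[OF L(2) less.IH[OF j] infL])
      fix B assume "B \<in> S (f j)"
      then have "B \<subseteq> X" "|B| \<le>o |{..<r}|" using sub[of j] by (auto simp: S_def)
      then show "|\<Phi> B| \<le>o |L|" using \<Phi> by blast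
    qed
    then show ?case using f[of i] card_of_Un_le[OF infL A0(2)] by simp
  qed
  have mono: "f i \<subseteq> f j" if "i \<le> j" for i j :: 'u
  proof -
    have "{..<i} \<subseteq> {..<j}" using that by auto
    then show ?thesis by (subst f[of i], subst f[of j]) (intro Un_mono UN_mono subset_refl)
  qed
  define A where "A = (\<Union>i\<in>{..<card_succ r}. f i)"
  have "A \<subseteq> X" unfolding A_def using sub by blast
  moreover have "A0 \<subseteq> A"
  proof -
    have "r \<in> {..<card_succ r}" using less_card_succ by simp
    moreover have "A0 \<subseteq> f r" using f[of r] by blast
    ultimately show ?thesis unfolding A_def by blast
  qed
  moreover have "|A| \<le>o |L|" unfolding A_def using card by (intro card_of_UN_le infL srL) simp
  moreover have "\<Phi> B \<subseteq> A" if B: "B \<subseteq> A" "|B| \<le>o |{..<r}|" for B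
  proof -
    have "\<forall>b\<in>B. \<exists>i. i < card_succ r \<and> b \<in> f i" using B(1) unfolding A_def by blast
    then obtain g where g: "\<And>b. b \<in> B \<Longrightarrow> g b < card_succ r \<and> b \<in> f (g b)" by metis
    obtain u where u: "u < card_succ r" "\<And>b. b \<in> B \<Longrightarrow> g b < u"
      using card_succ_bounded[OF r B(2), of g] g by blast
    have "B \<subseteq> f u" using g u(2) mono[OF less_imp_le] by blast
    then have "B \<in> S (f u)" using B(2) by (simp add: S_def)
    then have "\<Phi> B \<subseteq> f (osucc u)" using f[of "osucc u"] by fastforce
    moreover have "osucc u < card_succ r"
      using u(1) limit_osucc infinite_cardinal_limit[OF cardinal_card_succ infinite_card_succ[OF r(2)]] by blast
    ultimately show ?thesis unfolding A_def by blast
  qed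
  ultimately show ?thesis by (intro exI[of _ A]) simp
qed

text \<open>The construction behind Erdos-Rado. A set \<open>A\<close> of size at most 2^r is closed
  under realizing types over its subsets of size r, and x is any point outside \<open>A\<close>. A
  sequence of length r^+ is then chosen inside \<open>A\<close> so that each member looks like x
  over its predecessors.\<close>

lemma end_homogeneous_sequence:
  fixes r :: "'u::universe" and c :: "'a set \<Rightarrow> 'c"
  assumes r: "cardinal r" "infinite {..<r}" and X: "|Pow {..<r}| <o |X|"
    and C: "|C| \<le>o |Pow {..<r}|" and c: "\<And>F. F \<subseteq> X \<Longrightarrow> finite F \<Longrightarrow> c F \<in> C"
  shows "\<exists>x a. x \<in> X \<and> inj_on a {..<card_succ r} \<and> a ` {..<card_succ r} \<subseteq> X \<and>
    (\<forall>i F. i < card_succ r \<longrightarrow> F \<subseteq> a ` {..<i} \<longrightarrow> finite F \<longrightarrow> c (insert (a i) F) = c (insert x F))"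
proof -
  let ?R = "{..<r}"
  \<comment> \<open>\<open>T B y\<close> acts as the type of y over B with respect to the colouring,
    and \<Phi> B holds one realization outside B of each type that has one.\<close>
  define T where "T = (\<lambda>B y. restrict (\<lambda>F. c (insert y F)) (Fpow B))"
  define \<Phi> where "\<Phi> = (\<lambda>B. (\<lambda>t. SOME y. y \<in> X - B \<and> T B y = t) ` (T B ` (X - B)))"
  have inf: "infinite (Pow ?R)" using r(2) by simp
  have pick: "(SOME z. z \<in> X - B \<and> T B z = T B y) \<in> X - B \<and>
      T B (SOME z. z \<in> X - B \<and> T B z = T B y) = T B y" if "y \<in> X - B" for B y
    by (rule someI[of _ y]) (use that in simp)
  have \<Phi>: "\<Phi> B \<subseteq> X \<and> |\<Phi> B| \<le>o |Pow ?R|" if B: "B \<subseteq> X" "|B| \<le>o |?R|" for B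
  proof
    show "\<Phi> B \<subseteq> X" unfolding \<Phi>_def using pick by auto
    have "T B ` (X - B) \<subseteq> Fpow B \<rightarrow>\<^sub>E C"
    proof
      fix t assume "t \<in> T B ` (X - B)"
      then obtain y where y: "y \<in> X" "t = T B y" by blast
      have "c (insert y F) \<in> C" if "F \<in> Fpow B" for F
        using that B(1) y(1) by (intro c) (auto simp: Fpow_def)
      then show "t \<in> Fpow B \<rightarrow>\<^sub>E C" unfolding y(2) T_def by auto
    qed
    moreover have "|Fpow B \<rightarrow>\<^sub>E C| \<le>o |Pow ?R|"
      by (intro card_of_PiE_le_Pow card_of_Fpow_le r B C)
    ultimately have "|T B ` (X - B)| \<le>o |Pow ?R|" by (rule card_of_subset_le)
    then show "|\<Phi> B| \<le>o |Pow ?R|" unfolding \<Phi>_def by (rule card_of_image_le)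
  qed
  have "|?R \<rightarrow>\<^sub>E Pow ?R| \<le>o |Pow ?R|"
    by (intro card_of_PiE_le_Pow r card_of_mono1) auto
  then have "\<exists>A. {} \<subseteq> A \<and> A \<subseteq> X \<and> |A| \<le>o |Pow ?R| \<and> (\<forall>B. B \<subseteq> A \<longrightarrow> |B| \<le>o |?R| \<longrightarrow> \<Phi> B \<subseteq> A)"
    by (intro closed_set_exists[OF r card_of_mono1[OF subset_refl]] empty_subsetI card_of_empty \<Phi>)
  then obtain A where A: "A \<subseteq> X" "|A| \<le>o |Pow ?R|" "\<And>B. B \<subseteq> A \<Longrightarrow> |B| \<le>o |?R| \<Longrightarrow> \<Phi> B \<subseteq> A"
    by (elim exE conjE) simp
  obtain x where x: "x \<in> X" "x \<notin> A"
  proof -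
    have "\<not> X \<subseteq> A"
      using ordLeq_transitive[OF card_of_mono1 A(2), of X] X not_ordLess_ordLeq by blast
    then show thesis using that by blast
  qed
  let ?P = "\<lambda>f (i::'u) y. i < card_succ r \<longrightarrow> y \<in> A - f ` {..<i} \<and> T (f ` {..<i}) y = T (f ` {..<i}) x"
  have "\<exists>f. \<forall>i. ?P f i (f i)"
  proof (rule dependent_wellorder_choice)
    fix y and f g :: "'u \<Rightarrow> 'a" and i :: 'u
    assume "\<And>j. j < i \<Longrightarrow> f j = g j"
    then have "f ` {..<i} = g ` {..<i}" by auto
    then show "?P f i y = ?P g i y" by simp
  next
    fix i and f :: "'u \<Rightarrow> 'a"
    assume IH: "\<And>j. j < i \<Longrightarrow> ?P f j (f j)"
    show "\<exists>y. ?P f i y"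
    proof (cases "i < card_succ r")
      case True
      let ?B = "f ` {..<i}"
      have B: "?B \<subseteq> A" using IH True by (auto dest: less_trans)
      have "|?B| \<le>o |?R|" using card_of_below_card_succ[OF True r(1)] by (rule card_of_image_le)
      then have "\<Phi> ?B \<subseteq> A" using A(3) B by blast
      \<comment> \<open>As x lies outside \<open>A\<close>, hence outside the earlier part of the
        sequence, its type over that part is among those that \<Phi> realizes inside
        \<open>A\<close>.\<close>
      moreover have xB: "x \<in> X - ?B" using x B by blast
      ultimately have "(SOME z. z \<in> X - ?B \<and> T ?B z = T ?B x) \<in> A" unfolding \<Phi>_def by blast
      then show ?thesis using pick[OF xB] by blast
    qed simp
  qed
  then obtain a where a: "\<And>i. ?P a i (a i)" by blast
  have "inj_on a {..<card_succ r}"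
  proof (rule linorder_inj_onI')
    fix i j assume ij: "i \<in> {..<card_succ r}" "j \<in> {..<card_succ r}" "i < j"
    then have "a j \<notin> a ` {..<j}" using a[of j] by simp
    then show "a i \<noteq> a j" using ij(3) by (metis imageI lessThan_iff)
  qed
  moreover have "a ` {..<card_succ r} \<subseteq> X" using a A(1) by auto
  moreover have "c (insert (a i) F) = c (insert x F)"
    if "i < card_succ r" "F \<subseteq> a ` {..<i}" "finite F" for i F
  proof -
    have "T (a ` {..<i}) (a i) F = T (a ` {..<i}) x F" using a[of i] that(1) by simp
    moreover have "F \<in> Fpow (a ` {..<i})" using that by (simp add: Fpow_def)
    ultimately show ?thesis by (simp add: T_def)
  qed
  ultimately show ?thesis using x(1) by (intro exI[of _ x] exI[of _ a]) simp
qed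

lemma le_funpow_osucc: "x \<le> (osucc ^^ n) x"
  by (induction n) (auto intro: order_trans less_imp_le)

text \<open>In arrow notation, successors of beth_(j+n) arrow successors of beth_j, for sets of size
  n+1 and beth_j colours. Along an end-homogeneous sequence the colour of a set does not depend on
  its last member, which may be replaced by one fixed x; this lowers the size by one and costs one
  exponential.\<close>

theorem Erdos_Rado:
  fixes j :: "'u::universe" and c :: "'a set \<Rightarrow> 'c"
  assumes "|{..<beth ((osucc ^^ n) j)}| <o |X|" and C: "|C| \<le>o |{..<beth j}|"
    and "\<And>F. F \<subseteq> X \<Longrightarrow> finite F \<Longrightarrow> c F \<in> C"
  shows "\<exists>H\<subseteq>X. |{..<beth j}| <o |H| \<and> (\<exists>s\<in>C. \<forall>F\<subseteq>H. finite F \<and> card F = Suc n \<longrightarrow> c F = s)"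
  using assms(1,3)
proof (induction n arbitrary: X c)
  case 0
  have "|{..<beth j}| <o |X|" using 0(1) by simp
  moreover have "(\<lambda>x. c {x}) ` X \<subseteq> C" using 0(2) by auto
  ultimately obtain s where s: "s \<in> C" "|{..<beth j}| <o |{x \<in> X. c {x} = s}|"
    using pigeonhole_card[OF infinite_beth C] by blast
  show ?case
  proof (intro exI[of _ "{x \<in> X. c {x} = s}"] conjI bexI[of _ s] s)
    show "\<forall>F\<subseteq>{x \<in> X. c {x} = s}. finite F \<and> card F = Suc 0 \<longrightarrow> c F = s"
      by (auto simp: card_Suc_eq)
  qed auto
next
  case (Suc n)
  define r where "r = beth ((osucc ^^ n) j)"
  have "{..<beth ((osucc ^^ Suc n) j)} = {..<beth (osucc ((osucc ^^ n) j))}" by simp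
  then have X: "|Pow {..<r}| <o |X|" unfolding r_def
    using ordIso_ordLess_trans[OF ordIso_symmetric[OF card_of_beth_osucc]] Suc.prems(1) by simp
  have "|{..<beth j}| \<le>o |{..<r}|" unfolding r_def
    by (intro card_of_lessThan_mono beth_mono le_funpow_osucc)
  then have C': "|C| \<le>o |Pow {..<r}|"
    by (rule ordLeq_transitive[OF ordLeq_transitive[OF C] card_of_le_Pow])
  have r: "cardinal r" "infinite {..<r}" unfolding r_def by (auto simp: cardinal_beth infinite_beth)
  have "\<exists>x a. x \<in> X \<and> inj_on a {..<card_succ r} \<and> a ` {..<card_succ r} \<subseteq> X \<and>
      (\<forall>i F. i < card_succ r \<longrightarrow> F \<subseteq> a ` {..<i} \<longrightarrow> finite F \<longrightarrow> c (insert (a i) F) = c (insert x F))"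
    by (rule end_homogeneous_sequence[OF r X C']) (rule Suc.prems(2))
  then obtain x a where xa: "x \<in> X" "inj_on a {..<card_succ r}" "a ` {..<card_succ r} \<subseteq> X"
    "\<And>i F. i < card_succ r \<Longrightarrow> F \<subseteq> a ` {..<i} \<Longrightarrow> finite F \<Longrightarrow> c (insert (a i) F) = c (insert x F)"
    by (elim exE conjE) simp
  let ?Y = "a ` {..<card_succ r}"
  have "|{..<card_succ r}| \<le>o |?Y|" by (rule card_of_inj_on_le[OF xa(2)]) simp
  then have "|{..<beth ((osucc ^^ n) j)}| <o |?Y|"
    using card_of_less_card_succ[of r] ordLess_ordLeq_trans unfolding r_def by blast
  moreover have "c (insert x F) \<in> C" if "F \<subseteq> ?Y" "finite F" for F
    using that xa(1,3) by (intro Suc.prems(2)) auto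
  ultimately obtain H s where H: "H \<subseteq> ?Y" "|{..<beth j}| <o |H|" "s \<in> C"
    "\<And>F. F \<subseteq> H \<Longrightarrow> finite F \<Longrightarrow> card F = Suc n \<Longrightarrow> c (insert x F) = s"
    using Suc.IH[of ?Y "\<lambda>F. c (insert x F)"] by metis
  have "c G = s" if G: "G \<subseteq> H" "finite G" "card G = Suc (Suc n)" for G
  proof -
    \<comment> \<open>The set is pulled back to its indices: the member with the largest index is
      the one that is traded for x.\<close>
    define I where "I = {i \<in> {..<card_succ r}. a i \<in> G}"
    have aI: "a ` I = G" unfolding I_def using G(1) H(1) by auto
    have "inj_on a I" using xa(2) by (rule inj_on_subset) (auto simp: I_def)
    then have "finite I" using aI G(2) finite_imageD by blast
    moreover have "I \<noteq> {}" using aI G(3) by auto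
    ultimately have M: "Max I \<in> I" "\<And>i. i \<in> I \<Longrightarrow> i \<le> Max I" by auto
    let ?m = "Max I"
    have sub: "G - {a ?m} \<subseteq> a ` {..<?m}"
    proof
      fix g assume g: "g \<in> G - {a ?m}"
      then obtain i where "i \<in> I" "g = a i" using aI by blast
      then show "g \<in> a ` {..<?m}" using M(2)[of i] g by (auto simp: less_le)
    qed
    have mG: "a ?m \<in> G" using M(1) by (simp add: I_def)
    have "c (insert (a ?m) (G - {a ?m})) = c (insert x (G - {a ?m}))"
      using M(1) sub G(2) by (intro xa(4)) (auto simp: I_def)
    moreover have "c (insert x (G - {a ?m})) = s"
      using G mG by (intro H(4)) auto
    ultimately show ?thesis using mG by (simp add: insert_absorb)
  qed
  then show ?case using H xa(3) by (intro exI[of _ H]) auto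
qed

section \<open>Transport of structure and embeddings\<close>

text \<open>The complement of a small image is as large as the universe, so the rest of
  \<open>A\<close> fits into it. This is what allows models to be renamed within the one type of
  points.\<close>

lemma inj_on_extend:
  fixes f :: "'u::universe \<Rightarrow> 'u"
  assumes "inj_on f A0" "A0 \<subseteq> A" and A: "|A| <o |UNIV :: 'u set|"
  shows "\<exists>g. inj_on g A \<and> (\<forall>x\<in>A0. g x = f x)"
proof -
  have "|f ` A0| <o |UNIV :: 'u set|"
    using ordLeq_ordLess_trans[OF ordLeq_transitive[OF card_of_image card_of_mono1[OF assms(2)]] A] .
  then have "\<not> |- (f ` A0)| <o |UNIV :: 'u set|"
    using card_of_Un_ordLess_infinite[OF infinite_universe, of "f ` A0" "- (f ` A0)"]
    by (auto simp: Compl_partition dest: ordLess_irreflexive[THEN notE])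
  then have "|UNIV :: 'u set| \<le>o |- (f ` A0)|" by (simp add: not_card_of_ordLess_iff)
  then have "|A - A0| \<le>o |- (f ` A0)|"
    by (rule ordLeq_transitive[OF card_of_mono1[OF subset_UNIV]])
  then obtain h where h: "inj_on h (A - A0)" "h ` (A - A0) \<subseteq> - (f ` A0)"
    unfolding card_of_ordLeq[symmetric] by blast
  let ?g = "\<lambda>x. if x \<in> A0 then f x else h x"
  have "inj_on ?g A"
  proof (rule inj_onI)
    fix x y assume xy: "x \<in> A" "y \<in> A" "?g x = ?g y"
    have hn: "h z \<notin> f ` A0" if "z \<in> A" "z \<notin> A0" for z using h(2) that by blast
    consider "x \<in> A0" "y \<in> A0" | "x \<in> A0" "y \<notin> A0" | "x \<notin> A0" "y \<in> A0" | "x \<notin> A0" "y \<notin> A0" by blast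
    then show "x = y"
    proof cases
      case 1 then show ?thesis using xy(3) assms(1) by (simp add: inj_on_eq_iff)
    next
      case 2 then show ?thesis using xy hn[of y] by (metis imageI)
    next
      case 3 then show ?thesis using xy hn[of x] by (metis imageI)
    next
      case 4 then show ?thesis using xy inj_on_eq_iff[OF h(1)] by simp
    qed
  qed
  then show ?thesis by (intro exI[of _ ?g]) auto
qed

section \<open>Isomorphic copies of structures along injections\<close>

lemma substructure_eqI:
  assumes "substructure V M N" "points M = points N"
  shows "M = N"
proof -
  have sM: "is_structure V M" and sN: "is_structure V N" using assms by (auto simp: substructure_def)
  have "fun_int M s xs = fun_int N s xs" for s xs
    using assms sM sN unfolding substructure_def is_structure_def by metis
  moreover have "xs \<in> rel_int M s \<longleftrightarrow> xs \<in> rel_int N s" for s xs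
    using assms sM sN unfolding substructure_def is_structure_def by metis
  ultimately show ?thesis using assms(2) by (intro struct.equality) auto
qed

lemma substructure_common:
  assumes "substructure V M0 N" "substructure V M1 N" "points M0 \<subseteq> points M1"
  shows "substructure V M0 M1"
proof -
  have "fun_int M0 s xs = fun_int M1 s xs" if "fun_arity V s = Some (length xs)" "set xs \<subseteq> points M0" for s xs
  proof -
    have "set xs \<subseteq> points M1" using that(2) assms(3) by blast
    then show ?thesis using assms(1,2) that by (simp add: substructure_def)
  qed
  moreover have "xs \<in> rel_int M0 s \<longleftrightarrow> xs \<in> rel_int M1 s"
    if "rel_arity V s = Some (length xs)" "set xs \<subseteq> points M0" for s xs
  proof -
    have "set xs \<subseteq> points M1" using that(2) assms(3) by blast
    then show ?thesis using assms(1,2) that by (simp add: substructure_def)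
  qed
  ultimately show ?thesis using assms by (simp add: substructure_def)
qed

text \<open>The isomorphic copy of M along f when f is injective on the points; the value
  \<open>undefined\<close> elsewhere is the one that \<open>is_structure\<close> demands.\<close>

definition img :: "'u::universe vocabulary \<Rightarrow> ('u \<Rightarrow> 'u) \<Rightarrow> 'u struct \<Rightarrow> 'u struct" where
  "img V f M = \<lparr> points = f ` points M,
     fun_int = (\<lambda>s ys. if fun_arity V s = Some (length ys) \<and> set ys \<subseteq> f ` points M
       then f (fun_int M s (map (inv_into (points M) f) ys)) else undefined),
     rel_int = (\<lambda>s. map f ` rel_int M s) \<rparr>"

lemma points_img [simp]: "points (img V f M) = f ` points M"
  by (simp add: img_def)

lemma map_inv_into:
  assumes "inj_on f A" "set xs \<subseteq> A"
  shows "map (inv_into A f) (map f xs) = xs"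
  using assms by (induction xs) auto

lemma map_f_inv_into:
  assumes "set ys \<subseteq> f ` A"
  shows "map f (map (inv_into A f) ys) = ys" "set (map (inv_into A f) ys) \<subseteq> A"
  using assms by (induction ys) (auto simp: f_inv_into_f inv_into_into)

lemma isomorphism_img:
  assumes M: "is_structure V M" and f: "inj_on f (points M)"
  shows "isomorphism V f M (img V f M)"
proof -
  have rel: "rel_arity V s = Some (length xs) \<and> set xs \<subseteq> points M" if "xs \<in> rel_int M s" for s xs
    using M that by (auto simp: is_structure_def)
  have fn: "fun_int M s xs \<in> points M" if "fun_arity V s = Some (length xs)" "set xs \<subseteq> points M" for s xs
    using M that unfolding is_structure_def by metis
  have "is_structure V (img V f M)"
    unfolding is_structure_def
  proof (intro conjI allI)
    show "points (img V f M) \<noteq> {}" using M by (simp add: is_structure_def)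
    show "small (points (img V f M))" using M unfolding small_def is_structure_def points_img
      using ordLeq_ordLess_trans[OF card_of_image] by blast
    show "if fun_arity V s = Some (length ys) \<and> set ys \<subseteq> points (img V f M)
       then fun_int (img V f M) s ys \<in> points (img V f M) else fun_int (img V f M) s ys = undefined" for s ys
      using fn[of s "map (inv_into (points M) f) ys"] map_f_inv_into(2)[of ys f "points M"]
      by (auto simp: img_def)
    show "\<forall>xs\<in>rel_int (img V f M) s. rel_arity V s = Some (length xs) \<and> set xs \<subseteq> points (img V f M)" for s
      using rel by (fastforce simp: img_def)
  qed
  moreover have "f (fun_int M s xs) = fun_int (img V f M) s (map f xs)"
    if "fun_arity V s = Some (length xs)" "set xs \<subseteq> points M" for s xs
  proof -
    have "set (map f xs) \<subseteq> f ` points M" using that(2) by auto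
    then show ?thesis using that map_inv_into[OF f that(2)] by (simp add: img_def del: map_map)
  qed
  moreover have "xs \<in> rel_int M s \<longleftrightarrow> map f xs \<in> rel_int (img V f M) s"
    if "set xs \<subseteq> points M" for s xs
  proof
    assume "map f xs \<in> rel_int (img V f M) s"
    then obtain ys where ys: "ys \<in> rel_int M s" "map f ys = map f xs" by (auto simp: img_def)
    then have "map (inv_into (points M) f) (map f ys) = map (inv_into (points M) f) (map f xs)" by simp
    then have "ys = xs" using map_inv_into[OF f] rel[OF ys(1)] that by metis
    then show "xs \<in> rel_int M s" using ys by simp
  qed (auto simp: img_def)
  ultimately show ?thesis using M f unfolding isomorphism_def by (auto simp: bij_betw_def)
qed

lemma isomorphism_inv:
  assumes "isomorphism V f M N"
  shows "isomorphism V (inv_into (points M) f) N M"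
proof -
  let ?g = "inv_into (points M) f"
  have b: "bij_betw f (points M) (points N)" and sM: "is_structure V M" and sN: "is_structure V N"
    and fn: "\<And>s xs. fun_arity V s = Some (length xs) \<Longrightarrow> set xs \<subseteq> points M \<Longrightarrow>
      f (fun_int M s xs) = fun_int N s (map f xs)"
    and rl: "\<And>s xs. rel_arity V s = Some (length xs) \<Longrightarrow> set xs \<subseteq> points M \<Longrightarrow>
      xs \<in> rel_int M s \<longleftrightarrow> map f xs \<in> rel_int N s"
    using assms by (auto simp: isomorphism_def)
  have fM: "f ` points M = points N" and inj: "inj_on f (points M)" using b by (auto simp: bij_betw_def)
  have "?g (fun_int N s ys) = fun_int M s (map ?g ys)"
    if "fun_arity V s = Some (length ys)" "set ys \<subseteq> points N" for s ys
  proof -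
    have *: "map f (map ?g ys) = ys" "set (map ?g ys) \<subseteq> points M"
      using map_f_inv_into[of ys f "points M"] that(2) fM by auto
    then have "f (fun_int M s (map ?g ys)) = fun_int N s ys" using fn[of s "map ?g ys"] that(1) by simp
    moreover have "fun_int M s (map ?g ys) \<in> points M"
      using sM that(1) *(2) unfolding is_structure_def by (metis length_map)
    ultimately show ?thesis using inv_into_f_f[OF inj] by metis
  qed
  moreover have "ys \<in> rel_int N s \<longleftrightarrow> map ?g ys \<in> rel_int M s"
    if "rel_arity V s = Some (length ys)" "set ys \<subseteq> points N" for s ys
    using rl[of s "map ?g ys"] map_f_inv_into[of ys f "points M"] that fM by (simp del: map_map)
  ultimately show ?thesis
    using sM sN bij_betw_inv_into[OF b] unfolding isomorphism_def by blast
qed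

lemma isomorphism_comp:
  assumes f: "isomorphism V f M N" and g: "isomorphism V g N P"
  shows "isomorphism V (g \<circ> f) M P"
proof -
  have fM: "f ` points M = points N" using f by (auto simp: isomorphism_def bij_betw_def)
  have "(g \<circ> f) (fun_int M s xs) = fun_int P s (map (g \<circ> f) xs)"
    if "fun_arity V s = Some (length xs)" "set xs \<subseteq> points M" for s xs
  proof -
    have "f (fun_int M s xs) = fun_int N s (map f xs)" using f that by (auto simp: isomorphism_def)
    moreover have "set (map f xs) \<subseteq> points N" using that(2) fM by auto
    then have "g (fun_int N s (map f xs)) = fun_int P s (map g (map f xs))"
      using g that(1) unfolding isomorphism_def by (metis length_map)
    ultimately show ?thesis by simp
  qed
  moreover have "xs \<in> rel_int M s \<longleftrightarrow> map (g \<circ> f) xs \<in> rel_int P s"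
    if "rel_arity V s = Some (length xs)" "set xs \<subseteq> points M" for s xs
  proof -
    have "xs \<in> rel_int M s \<longleftrightarrow> map f xs \<in> rel_int N s" using f that by (auto simp: isomorphism_def)
    moreover have "set (map f xs) \<subseteq> points N" using that(2) fM by auto
    then have "map f xs \<in> rel_int N s \<longleftrightarrow> map g (map f xs) \<in> rel_int P s"
      using g that(1) unfolding isomorphism_def by (metis length_map)
    ultimately show ?thesis by simp
  qed
  ultimately show ?thesis using f g bij_betw_trans unfolding isomorphism_def by blast
qed

lemma isomorphism_cong:
  assumes f: "isomorphism V f M N" and eq: "\<And>x. x \<in> points M \<Longrightarrow> g x = f x"
  shows "isomorphism V g M N"
proof -
  have sM: "is_structure V M" using f by (auto simp: isomorphism_def)
  have m: "map g xs = map f xs" if "set xs \<subseteq> points M" for xs using that eq by auto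
  have "g (fun_int M s xs) = fun_int N s (map g xs)"
    if "fun_arity V s = Some (length xs)" "set xs \<subseteq> points M" for s xs
  proof -
    have "fun_int M s xs \<in> points M" using sM that unfolding is_structure_def by metis
    then show ?thesis using f that m eq unfolding isomorphism_def by metis
  qed
  moreover have "bij_betw g (points M) (points N)"
    using f eq bij_betw_cong[of "points M" g f] by (auto simp: isomorphism_def)
  ultimately show ?thesis using f m unfolding isomorphism_def by metis
qed

lemma isomorphism_unique:
  assumes f: "isomorphism V f M N" and g: "isomorphism V f M N'"
  shows "N = N'"
proof (rule substructure_eqI[of V])
  have fM: "f ` points M = points N" "f ` points M = points N'"
    using f g by (auto simp: isomorphism_def bij_betw_def)
  then show p: "points N = points N'" by simp
  have ex: "\<exists>xs. set xs \<subseteq> points M \<and> map f xs = ys" if "set ys \<subseteq> points N" for ys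
    using map_f_inv_into[of ys f "points M"] that fM by metis
  have "fun_int N s ys = fun_int N' s ys" if ys: "fun_arity V s = Some (length ys)" "set ys \<subseteq> points N" for s ys
  proof -
    obtain xs where "set xs \<subseteq> points M" "map f xs = ys" using ex[OF ys(2)] by blast
    moreover from this have "length xs = length ys" by auto
    ultimately show ?thesis using f g ys(1) unfolding isomorphism_def by metis
  qed
  moreover have "ys \<in> rel_int N s \<longleftrightarrow> ys \<in> rel_int N' s"
    if ys: "rel_arity V s = Some (length ys)" "set ys \<subseteq> points N" for s ys
  proof -
    obtain xs where "set xs \<subseteq> points M" "map f xs = ys" using ex[OF ys(2)] by blast
    moreover from this have "length xs = length ys" by auto
    ultimately show ?thesis using f g ys(1) unfolding isomorphism_def by metis
  qed
  ultimately show "substructure V N N'"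
    using f g p unfolding substructure_def isomorphism_def by auto
qed

lemma isomorphism_points: "isomorphism V f M N \<Longrightarrow> f ` points M = points N \<and> inj_on f (points M)"
  by (auto simp: isomorphism_def bij_betw_def)

text \<open>The source and the map determine the target, so that claims about embeddings turn into
  equations between images.\<close>

lemma isomorphism_eq_img: "isomorphism V f M N \<Longrightarrow> N = img V f M"
  using isomorphism_unique isomorphism_img isomorphism_points isomorphism_def by metis

section \<open>Embeddings between models\<close>

context aec
begin

abbreviation V where "V \<equiv> vocab K"

lemma strong_points: "strong K M N \<Longrightarrow> points M \<subseteq> points N"
  using strong_substructure by (auto simp: substructure_def)

lemma model_points_less: "M \<in> models K \<Longrightarrow> |points M| <o |UNIV :: 'u set|"
  using model_structure by (auto simp: is_structure_def small_def)

lemma model_nonempty: "M \<in> models K \<Longrightarrow> points M \<noteq> {}"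
  using model_structure by (auto simp: is_structure_def)

lemma strong_if_subset:
  assumes "strong K M0 N" "strong K M1 N" "points M0 \<subseteq> points M1"
  shows "strong K M0 M1"
  using coherence[OF assms(1,2)] substructure_common strong_substructure assms by blast

lemma img_model:
  assumes "M \<in> models K" "inj_on f (points M)"
  shows "isomorphism V f M (img V f M)" "img V f M \<in> models K"
  using isomorphism_img[OF model_structure[OF assms(1)] assms(2)] models_iso[OF assms(1)] by auto

lemma img_strong:
  assumes "strong K M N" "inj_on f (points N)"
  shows "strong K (img V f M) (img V f N)"
proof -
  have "inj_on f (points M)" using assms inj_on_subset strong_points by blast
  then show ?thesis using strong_iso[OF assms(1)] img_model strong_models[OF assms(1)] assms(2) by blast
qed

lemma img_id:
  assumes "M \<in> models K" "\<And>x. x \<in> points M \<Longrightarrow> f x = x"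
  shows "img V f M = M"
proof -
  have "isomorphism V f M M"
    by (rule isomorphism_cong[of V "\<lambda>x. x"]) (use assms model_structure in \<open>auto simp: isomorphism_def bij_betw_def\<close>)
  then show ?thesis using isomorphism_eq_img by metis
qed

lemma img_cong:
  assumes "M \<in> models K" "inj_on f (points M)" "\<And>x. x \<in> points M \<Longrightarrow> f x = g x"
  shows "img V f M = img V g M"
  using isomorphism_cong[OF img_model(1)[OF assms(1,2)], of g] assms(3) isomorphism_eq_img by simp

lemma img_comp:
  assumes "M \<in> models K" "inj_on f (points M)" "inj_on g (f ` points M)"
  shows "img V g (img V f M) = img V (g \<circ> f) M"
proof -
  have "isomorphism V g (img V f M) (img V g (img V f M))"
    using img_model[OF img_model(2)[OF assms(1,2)]] assms(3) by simp
  then show ?thesis using isomorphism_comp[OF img_model(1)[OF assms(1,2)]] isomorphism_eq_img by metis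
qed

lemma embedding_iff:
  "embedding K f M N \<longleftrightarrow> M \<in> models K \<and> inj_on f (points M) \<and> strong K (img V f M) N"
proof
  assume "embedding K f M N"
  then obtain M' where M': "isomorphism V f M M'" "strong K M' N" by (auto simp: embedding_def)
  then have "M \<in> models K" using models_iso[OF _ isomorphism_inv] strong_models by blast
  then show "M \<in> models K \<and> inj_on f (points M) \<and> strong K (img V f M) N"
    using M' isomorphism_points isomorphism_eq_img by metis
next
  assume "M \<in> models K \<and> inj_on f (points M) \<and> strong K (img V f M) N"
  then show "embedding K f M N" unfolding embedding_def using img_model by blast
qed

lemma embedding_points: "embedding K f M N \<Longrightarrow> f ` points M \<subseteq> points N"
  unfolding embedding_iff using strong_points by fastforce

lemma embedding_models: "embedding K f M N \<Longrightarrow> M \<in> models K \<and> N \<in> models K"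
  unfolding embedding_iff using strong_models by blast

lemma strong_embedding: "strong K M N \<Longrightarrow> embedding K (\<lambda>x. x) M N"
  unfolding embedding_iff using strong_models img_id by simp

lemma iso_embedding: "M \<in> models K \<Longrightarrow> isomorphism V f M N \<Longrightarrow> embedding K f M N"
  using models_iso strong_refl unfolding embedding_def by blast

lemma embedding_cong:
  "embedding K f M N \<Longrightarrow> (\<And>x. x \<in> points M \<Longrightarrow> g x = f x) \<Longrightarrow> embedding K g M N"
  unfolding embedding_def using isomorphism_cong by blast

lemma embedding_comp:
  assumes "embedding K f M N" "embedding K g N P"
  shows "embedding K (g \<circ> f) M P"
proof -
  have f: "M \<in> models K" "inj_on f (points M)" "strong K (img V f M) N"
    and g: "inj_on g (points N)" "strong K (img V g N) P" using assms by (auto simp: embedding_iff)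
  have "inj_on g (f ` points M)" using g(1) embedding_points[OF assms(1)] inj_on_subset by blast
  moreover from this have "img V g (img V f M) = img V (g \<circ> f) M" by (rule img_comp[OF f(1,2)])
  ultimately show ?thesis
    unfolding embedding_iff using f comp_inj_on strong_trans[OF img_strong[OF f(3) g(1)] g(2)] by auto
qed

lemma embedding_strong_right: "embedding K f M N \<Longrightarrow> strong K N N' \<Longrightarrow> embedding K f M N'"
  unfolding embedding_iff using strong_trans by blast

text \<open>Invert f on its image and extend the inverse injectively to all of N: the copy of N
  obtained in this way contains M itself. Thus one leg of any amalgam may be taken to be an
  inclusion.\<close>

lemma embedding_rename:
  assumes "embedding K f M N"
  shows "\<exists>N' g. strong K M N' \<and> embedding K g N N' \<and> (\<forall>x\<in>points M. g (f x) = x)"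
proof -
  have f: "M \<in> models K" "inj_on f (points M)" "strong K (img V f M) N" "f ` points M \<subseteq> points N" "N \<in> models K"
    using assms embedding_points[OF assms] embedding_models[OF assms] by (simp_all add: embedding_iff)
  have "inj_on (inv_into (points M) f) (f ` points M)" by (rule inj_on_inv_into) simp
  then obtain g where g: "inj_on g (points N)" "\<forall>y\<in>f ` points M. g y = inv_into (points M) f y"
    using inj_on_extend[OF _ f(4) model_points_less[OF f(5)], of "inv_into (points M) f"] by auto
  have gf: "g (f x) = x" if "x \<in> points M" for x using that g(2) f(2) by simp
  have "inj_on g (f ` points M)" using g(1) f(4) inj_on_subset by blast
  then have "img V g (img V f M) = M" using img_comp[OF f(1,2)] img_id[OF f(1), of "g \<circ> f"] gf by simp
  then have "strong K M (img V g N)" using img_strong[OF f(3) g(1)] by simp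
  moreover have "embedding K g N (img V g N)" using iso_embedding img_model f(5) g(1) by blast
  ultimately show ?thesis using gf by blast
qed

lemma LS_bound_LS: "LS_bound K (LS K)"
  unfolding LS_def using Lowenheim_Skolem by (rule LeastI_ex)

lemma cardinal_LS: "cardinal (LS K)" and infinite_LS: "infinite {..<LS K}"
  using LS_bound_LS by (auto simp: LS_bound_def infinite_cardinal_def)

lemma symbols_le_LS: "|symbols V| \<le>o |{..<LS K}|"
  using LS_bound_LS by (auto simp: LS_bound_def)

lemma LS_submodel:
  assumes "M \<in> models K" "A \<subseteq> points M" "|A| \<le>o |X|" "|{..<LS K}| \<le>o |X|"
  shows "\<exists>M0. strong K M0 M \<and> A \<subseteq> points M0 \<and> |points M0| \<le>o |X|"
proof -
  have inf: "infinite X" using infinite_card_of_le[OF infinite_LS assms(4)] .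
  obtain M0 where "strong K M0 M" "A \<subseteq> points M0" "|points M0| \<le>o |A| +c |{..<LS K}|"
    using LS_bound_LS assms(1,2) unfolding LS_bound_def by blast
  moreover have "|A| +c |{..<LS K}| \<le>o |X|" by (rule card_of_csum_le[OF inf assms(3,4)])
  ultimately show ?thesis using ordLeq_transitive by blast
qed

section \<open>Galois types\<close>

lemma tripleI: "N \<in> models K \<Longrightarrow> A \<subseteq> points N \<Longrightarrow> b \<in> I \<rightarrow>\<^sub>E points N \<Longrightarrow> (b, A, N) \<in> triples K I"
  by (simp add: triples_def)

lemma gtp_eqI_embedding:
  assumes "(b1, A, N1) \<in> triples K I" "(b2, A, N2) \<in> triples K I"
    and "embedding K f1 N1 N" "embedding K f2 N2 N"
    and "\<And>x. x \<in> A \<Longrightarrow> f1 x = x" "\<And>x. x \<in> A \<Longrightarrow> f2 x = x" "\<And>i. i \<in> I \<Longrightarrow> f1 (b1 i) = f2 (b2 i)"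
  shows "gtp K I b1 A N1 = gtp K I b2 A N2"
proof -
  have "N \<in> models K" using embedding_models assms(3) by blast
  then have "((b1, A, N1), (b2, A, N2)) \<in> E_at K I" unfolding E_at_iff using assms by blast
  then show ?thesis by (intro gtp_eqI r_into_trancl)
qed

lemma gtp_strong:
  assumes "strong K M N" "A \<subseteq> points M" "b \<in> I \<rightarrow>\<^sub>E points M"
  shows "gtp K I b A M = gtp K I b A N"
proof (rule gtp_eqI_embedding[of _ _ _ _ _ _ "\<lambda>x. x" N "\<lambda>x. x"])
  have "I \<rightarrow>\<^sub>E points M \<subseteq> I \<rightarrow>\<^sub>E points N" using strong_points[OF assms(1)] by (intro PiE_mono) auto
  then show "(b, A, M) \<in> triples K I" "(b, A, N) \<in> triples K I"
    using assms strong_points[OF assms(1)] strong_models[OF assms(1)] by (auto intro!: tripleI)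
  show "embedding K (\<lambda>x. x) M N" by (rule strong_embedding[OF assms(1)])
  show "embedding K (\<lambda>x. x) N N" using embedding_refl strong_models[OF assms(1)] by blast
qed auto

lemma gtp_embedding:
  assumes "embedding K f M N" "A \<subseteq> points M" "b \<in> I \<rightarrow>\<^sub>E points M"
    "\<And>x. x \<in> A \<Longrightarrow> f x = x" "b' \<in> I \<rightarrow>\<^sub>E points N" "\<And>i. i \<in> I \<Longrightarrow> b' i = f (b i)"
  shows "gtp K I b A M = gtp K I b' A N"
proof (rule gtp_eqI_embedding[of _ _ _ _ _ _ f N "\<lambda>x. x"])
  have "A \<subseteq> points N"
  proof
    fix x assume "x \<in> A"
    then show "x \<in> points N" using assms(2,4) embedding_points[OF assms(1)] by force
  qed
  then show "(b, A, M) \<in> triples K I" "(b', A, N) \<in> triples K I"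
    using assms embedding_models[OF assms(1)] by (auto intro!: tripleI)
  show "embedding K (\<lambda>x. x) N N" using embedding_refl embedding_models[OF assms(1)] by blast
qed (use assms in auto)

end

section \<open>Galois types under amalgamation\<close>

locale aec_ap = aec K for K :: "'u::universe abstract_class" +
  assumes ap: "amalgamation K"
begin

text \<open>First M1 is renamed so as to extend the image of M0 under f, which makes both legs of
  the span inclusions. The amalgam is then renamed so that M2 is included in it.\<close>

lemma amalgamation_extend:
  assumes M: "strong K M0 M1" and f: "embedding K f M0 M2"
  shows "\<exists>N h. strong K M2 N \<and> embedding K h M1 N \<and> (\<forall>x\<in>points M0. h x = f x)"
proof -
  have m: "M0 \<in> models K" "M1 \<in> models K" using strong_models[OF M] by auto
  have fi: "inj_on f (points M0)" "strong K (img V f M0) M2" using f by (auto simp: embedding_iff)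
  obtain g where g: "inj_on g (points M1)" "\<forall>x\<in>points M0. g x = f x"
    using inj_on_extend[OF fi(1) strong_points[OF M] model_points_less[OF m(2)]] by blast
  have "img V g M0 = img V f M0" using img_cong[OF m(1) fi(1), of g] g(2) by simp
  then have "strong K (img V f M0) (img V g M1)" using img_strong[OF M g(1)] by simp
  then obtain N0 f1 f2 where N0: "embedding K f1 (img V g M1) N0" "embedding K f2 M2 N0"
    "\<forall>x\<in>points (img V f M0). f1 x = x \<and> f2 x = x"
    using ap fi(2) unfolding amalgamation_def by blast
  obtain N k where k: "strong K M2 N" "embedding K k N0 N" "\<forall>x\<in>points M2. k (f2 x) = x"
    using embedding_rename[OF N0(2)] by blast
  have "embedding K g M1 (img V g M1)" using iso_embedding img_model m(2) g(1) by blast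
  then have "embedding K (k \<circ> (f1 \<circ> g)) M1 N" using embedding_comp N0(1) k(2) by blast
  moreover have "(k \<circ> (f1 \<circ> g)) x = f x" if "x \<in> points M0" for x
  proof -
    have "f x \<in> points (img V f M0)" "f x \<in> points M2" using that embedding_points[OF f] by auto
    then show ?thesis using N0(3) k(3) g(2) that by (metis comp_apply)
  qed
  ultimately show ?thesis using k(1) by blast
qed

text \<open>Two consecutive witnesses share the model N2, so amalgamating over N2 composes them: a
  chain of atomic steps collapses to a single amalgam. Keeping the first model included in the
  amalgam makes the induction compose.\<close>

lemma E_at_trancl_amalgam:
  assumes "(t1, t2) \<in> (E_at K I)\<^sup>+"
  shows "\<exists>N f. strong K (snd (snd t1)) N \<and> embedding K f (snd (snd t2)) N \<and> fst (snd t1) = fst (snd t2) \<and>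
    (\<forall>x\<in>fst (snd t1). f x = x) \<and> (\<forall>i\<in>I. f (fst t2 i) = fst t1 i)"
proof -
  have E: "\<exists>N f. strong K N1 N \<and> embedding K f N2 N \<and> A1 = A2 \<and>
      (\<forall>x\<in>A1. f x = x) \<and> (\<forall>i\<in>I. f (b2 i) = b1 i)"
    if e: "((b1, A1, N1), (b2, A2, N2)) \<in> E_at K I" for b1 A1 N1 b2 A2 N2
  proof -
    obtain N f1 f2 where N: "embedding K f1 N1 N" "embedding K f2 N2 N" "A1 = A2"
      "\<forall>x\<in>A1. f1 x = x \<and> f2 x = x" "\<forall>i\<in>I. f1 (b1 i) = f2 (b2 i)"
      and tr: "A1 \<subseteq> points N1" "b1 \<in> I \<rightarrow>\<^sub>E points N1" using e unfolding E_at_iff triples_def by blast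
    obtain N' k where k: "strong K N1 N'" "embedding K k N N'" "\<forall>x\<in>points N1. k (f1 x) = x"
      using embedding_rename[OF N(1)] by blast
    have "(k \<circ> f2) x = x" if "x \<in> A1" for x using that N(4) k(3) tr(1) by (metis comp_apply subsetD)
    moreover have "(k \<circ> f2) (b2 i) = b1 i" if "i \<in> I" for i
    proof -
      have "b1 i \<in> points N1" using tr(2) that by auto
      then show ?thesis using N(5) k(3) that by (metis comp_apply)
    qed
    ultimately show ?thesis using k(1) embedding_comp[OF N(2) k(2)] N(3) by blast
  qed
  show ?thesis using assms
  proof (induction rule: trancl_induct)
    case (base y)
    obtain b1 A1 N1 b2 A2 N2 where e: "t1 = (b1, A1, N1)" "y = (b2, A2, N2)"
      by (cases t1; cases y)
    show ?case using E[OF base[unfolded e]] unfolding e by simp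
  next
    case (step y z)
    obtain b1 A1 N1 b2 A2 N2 b3 A3 N3 where e: "t1 = (b1, A1, N1)" "y = (b2, A2, N2)" "z = (b3, A3, N3)"
      by (cases t1; cases y; cases z)
    obtain N f where N: "strong K N1 N" "embedding K f N2 N" "A1 = A2" "\<forall>x\<in>A1. f x = x" "\<forall>i\<in>I. f (b2 i) = b1 i"
      using step.IH unfolding e by auto
    obtain N' g where N': "strong K N2 N'" "embedding K g N3 N'" "A2 = A3" "\<forall>x\<in>A2. g x = x" "\<forall>i\<in>I. g (b3 i) = b2 i"
      using E[OF step.hyps(2)[unfolded e]] by blast
    have tr: "A2 \<subseteq> points N2" "b2 \<in> I \<rightarrow>\<^sub>E points N2"
      using step.hyps(2) unfolding e E_at_iff triples_def by auto
    obtain N'' h where h: "strong K N N''" "embedding K h N' N''" "\<forall>x\<in>points N2. h x = f x"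
      using amalgamation_extend[OF N'(1) N(2)] by blast
    have "(h \<circ> g) x = x" if "x \<in> A1" for x using that N N' h tr by (metis comp_apply subsetD)
    moreover have "(h \<circ> g) (b3 i) = b1 i" if "i \<in> I" for i
    proof -
      have "b2 i \<in> points N2" using tr(2) that by auto
      then show ?thesis using N(5) N'(5) h(3) that by (metis comp_apply)
    qed
    ultimately show ?case unfolding e
      using strong_trans[OF N(1) h(1)] embedding_comp[OF N'(2) h(2)] N(3) N'(3)
      by (intro exI[of _ N''] exI[of _ "h \<circ> g"]) (simp add: comp_def)
  qed
qed

lemma gtp_eqD:
  assumes "gtp K I b1 A N1 = gtp K I b2 A N2" "(b1, A, N1) \<in> triples K I" "(b2, A, N2) \<in> triples K I"
  shows "\<exists>N f. strong K N1 N \<and> embedding K f N2 N \<and> (\<forall>x\<in>A. f x = x) \<and> (\<forall>i\<in>I. f (b2 i) = b1 i)"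
proof -
  have "(b2, A, N2) \<in> gtp K I b2 A N2" unfolding gtp_def using triples_E_at_refl[OF assms(3)] by auto
  then have "((b1, A, N1), (b2, A, N2)) \<in> (E_at K I)\<^sup>+" using assms(1) unfolding gtp_def by auto
  from E_at_trancl_amalgam[OF this] show ?thesis by simp
qed

text \<open>An embedding that matches two tuples also matches all tuples formed from corresponding
  entries. In this way every pattern is read off the one type of a finite set of indices.\<close>

lemma gtp_reindex:
  assumes "gtp K I b1 A N1 = gtp K I b2 A N2" "(b1, A, N1) \<in> triples K I" "(b2, A, N2) \<in> triples K I"
    and c: "c1 \<in> J \<rightarrow>\<^sub>E points N1" "c2 \<in> J \<rightarrow>\<^sub>E points N2" "A' \<subseteq> A"
    and "\<And>j. j \<in> J \<Longrightarrow> \<exists>i\<in>I. c1 j = b1 i \<and> c2 j = b2 i"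
  shows "gtp K J c1 A' N1 = gtp K J c2 A' N2"
proof -
  obtain N f where N: "strong K N1 N" "embedding K f N2 N" "\<forall>x\<in>A. f x = x" "\<forall>i\<in>I. f (b2 i) = b1 i"
    using gtp_eqD[OF assms(1-3)] by blast
  show ?thesis
  proof (rule gtp_eqI_embedding[OF _ _ strong_embedding[OF N(1)] N(2)])
    show "(c1, A', N1) \<in> triples K J" "(c2, A', N2) \<in> triples K J" using assms by (auto simp: triples_def)
    show "c1 i = f (c2 i)" if "i \<in> J" for i using assms(7)[OF that] N(4) by auto
  qed (use N(3) c(3) in auto)
qed

end

section \<open>Directed unions and families of submodels\<close>

context aec
begin

text \<open>The axioms speak of chains only. Enumerate X in the order type of its cardinality k; the
  unions over the finite subsets of the initial segments exist by induction, since those segments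
  are smaller than X, and they form a chain of length k. That the union lies below every common
  upper bound belongs to the induction, because it is what makes this chain increasing.\<close>

lemma directed_union:
  fixes M :: "'x set \<Rightarrow> 'u struct"
  assumes "|X| <o |UNIV :: 'u set|"
    and "\<And>F. F \<in> Fpow X \<Longrightarrow> M F \<in> models K"
    and "\<And>F G. F \<subseteq> G \<Longrightarrow> G \<in> Fpow X \<Longrightarrow> strong K (M F) (M G)"
  shows "\<exists>N. N \<in> models K \<and> (\<forall>F\<in>Fpow X. strong K (M F) N) \<and>
    (\<forall>N'. N' \<in> models K \<longrightarrow> (\<forall>F\<in>Fpow X. strong K (M F) N') \<longrightarrow> strong K N N') \<and>
    points N = (\<Union>F\<in>Fpow X. points (M F))"
  using assms
proof (induction "cardinality X :: 'u" arbitrary: X rule: less_induct)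
  case less
  define D where "D = (\<lambda>X N. N \<in> models K \<and> (\<forall>F\<in>Fpow X. strong K (M F) N) \<and>
    (\<forall>N'. N' \<in> models K \<longrightarrow> (\<forall>F\<in>Fpow X. strong K (M F) N') \<longrightarrow> strong K N N') \<and>
    points N = (\<Union>F\<in>Fpow X. points (M F)))"
  show ?case
  proof (cases "finite X")
    case True
    then have X: "X \<in> Fpow X" by (simp add: Fpow_def)
    have "strong K (M F) (M X)" if "F \<in> Fpow X" for F
      using less.prems(3)[of F X] X that by (simp add: Fpow_def)
    moreover from this have "points (M X) = (\<Union>F\<in>Fpow X. points (M F))" using X strong_points by blast
    ultimately show ?thesis using X less.prems(2) by (intro exI[of _ "M X"]) simp
  next
    case False
    define k where "k = (cardinality X :: 'u)"
    have k: "|{..<k}| =o |X|" "cardinal k"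
      using card_of_cardinality[OF less.prems(1) k_def] cardinal_cardinality[OF less.prems(1) k_def] by auto
    have inf: "infinite {..<k}" using False k(1) card_of_ordIso_finite by blast
    have lim: "limit_ordinal k" by (rule infinite_cardinal_limit[OF k(2) inf])
    obtain b where b: "bij_betw b {..<k} X" using k(1) card_of_ordIso by blast
    have bX: "b ` {..<k} = X" using b by (simp add: bij_betw_def)
    have sub: "b ` {..<i} \<subseteq> X" if "i < k" for i using bX that by auto
    have "\<exists>N. D (b ` {..<i}) N" if i: "i < k" for i
      unfolding D_def
    proof (rule less.hyps)
      have "|b ` {..<i}| <o |UNIV :: 'u set|"
        by (rule le_ordinal_less_universe[OF card_of_image])
      then show "|b ` {..<i}| <o |UNIV :: 'u set|" .
      from cardinality_le[OF this refl card_of_image] have "(cardinality (b ` {..<i}) :: 'u) \<le> i" .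
      then show "(cardinality (b ` {..<i}) :: 'u) < cardinality X" using i unfolding k_def by order
      show "M F \<in> models K" if "F \<in> Fpow (b ` {..<i})" for F
        using less.prems(2)[of F] that sub[OF i] by (auto simp: Fpow_def)
      show "strong K (M F) (M G)" if "F \<subseteq> G" "G \<in> Fpow (b ` {..<i})" for F G
        using less.prems(3)[of F G] that sub[OF i] by (auto simp: Fpow_def)
    qed
    then obtain C where C: "\<And>i. i < k \<Longrightarrow> D (b ` {..<i}) (C i)" by metis
    have Cm: "C i \<in> models K" if "i < k" for i using C[OF that] by (simp add: D_def)
    have chain: "strong K (C i) (C j)" if "i \<le> j" "j < k" for i j
    proof -
      have "i < k" using that by order
      moreover have "b ` {..<i} \<subseteq> b ` {..<j}" using that(1) by (intro image_mono) auto
      then have "\<forall>F\<in>Fpow (b ` {..<i}). strong K (M F) (C j)"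
        using C[OF that(2)] unfolding D_def Fpow_def by blast
      ultimately show ?thesis using C[of i] Cm[OF that(2)] unfolding D_def by blast
    qed
    \<comment> \<open>Every finite subset of X appears at some stage because k is a limit
      ordinal.\<close>
    have covers: "\<exists>i<k. F \<in> Fpow (b ` {..<i})" if "F \<in> Fpow X" for F
    proof -
      have "finite F" "F \<subseteq> b ` {..<k}" using that bX by (auto simp: Fpow_def)
      then obtain F0 where "F0 \<subseteq> {..<k}" "finite F0" "F = b ` F0" by (meson finite_subset_image)
      moreover from this obtain i where "i < k" "F0 \<subseteq> {..<i}" using finite_subset_limit[OF lim] by blast
      ultimately show ?thesis by (auto simp: Fpow_def)
    qed
    let ?N = "chain_union k C"
    have N: "?N \<in> models K" by (rule chain_union_model[OF lim Cm chain])
    have up: "strong K (C i) ?N" if "i < k" for i by (rule chain_union_upper[OF lim Cm chain that])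
    have "strong K (M F) ?N" if F: "F \<in> Fpow X" for F
    proof -
      obtain i where i: "i < k" "F \<in> Fpow (b ` {..<i})" using covers[OF F] by blast
      then have "strong K (M F) (C i)" using C[OF i(1)] by (simp add: D_def)
      then show ?thesis using up[OF i(1)] strong_trans by blast
    qed
    moreover have "strong K ?N N'" if N': "N' \<in> models K" "\<forall>F\<in>Fpow X. strong K (M F) N'" for N'
    proof (rule smoothness[OF lim Cm chain N'(1)])
      fix i assume i: "i < k"
      have "\<forall>F\<in>Fpow (b ` {..<i}). strong K (M F) N'" using N'(2) sub[OF i] unfolding Fpow_def by blast
      then show "strong K (C i) N'" using C[OF i] N'(1) by (simp add: D_def)
    qed
    moreover have "points ?N = (\<Union>F\<in>Fpow X. points (M F))"
    proof -
      have "points ?N = (\<Union>i\<in>{..<k}. \<Union>F\<in>Fpow (b ` {..<i}). points (M F))"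
        using C by (simp add: chain_union_def D_def)
      moreover have "Fpow X = (\<Union>i\<in>{..<k}. Fpow (b ` {..<i}))"
      proof
        show "Fpow X \<subseteq> (\<Union>i\<in>{..<k}. Fpow (b ` {..<i}))" using covers by (auto simp only: UN_iff lessThan_iff)
        show "(\<Union>i\<in>{..<k}. Fpow (b ` {..<i})) \<subseteq> Fpow X"
        proof (rule UN_least)
          fix i assume "i \<in> {..<k}"
          then show "Fpow (b ` {..<i}) \<subseteq> Fpow X" using sub[of i] by (auto simp: Fpow_def)
        qed
      qed
      ultimately show ?thesis by (simp only: UN_UN_flatten)
    qed
    ultimately show ?thesis using N by (intro exI[of _ ?N]) simp
  qed
qed

text \<open>A substitute for Skolem hulls, by recursion on proper inclusion: the submodel for F is
  taken around the data of the members of F and the submodels already chosen for the proper subsets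
  of F. These are finitely many, so the size does not grow.\<close>

lemma submodel_family:
  fixes D :: "'x \<Rightarrow> 'u set"
  assumes N: "N \<in> models K" and D: "\<And>x. x \<in> W \<Longrightarrow> D x \<subseteq> points N \<and> |D x| \<le>o |X|"
    and X: "|{..<LS K}| \<le>o |X|"
  shows "\<exists>S. \<forall>F\<in>Fpow W. strong K (S F) N \<and> (\<forall>x\<in>F. D x \<subseteq> points (S F)) \<and>
    (\<forall>G\<subseteq>F. points (S G) \<subseteq> points (S F)) \<and> |points (S F)| \<le>o |X|"
proof -
  have inf: "infinite X" using infinite_card_of_le[OF infinite_LS X] .
  let ?P = "\<lambda>f F r. F \<in> Fpow W \<longrightarrow> strong K r N \<and> (\<forall>x\<in>F. D x \<subseteq> points r) \<and>
    (\<forall>G\<subset>F. points (f G) \<subseteq> points r) \<and> |points r| \<le>o |X|"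
  have "\<exists>S. \<forall>F. ?P S F (S F)"
  proof (rule dependent_wf_choice[OF wf_finite_psubset])
    fix f g :: "'x set \<Rightarrow> 'u struct" and F r
    assume "\<And>G. (G, F) \<in> finite_psubset \<Longrightarrow> f G = g G"
    then show "?P f F r = ?P g F r" by (auto simp: finite_psubset_def Fpow_def)
  next
    fix F and f :: "'x set \<Rightarrow> 'u struct"
    assume IH: "\<And>G. (G, F) \<in> finite_psubset \<Longrightarrow> ?P f G (f G)"
    show "\<exists>r. ?P f F r"
    proof (cases "F \<in> Fpow W")
      case True
      then have F: "finite F" "F \<subseteq> W" by (auto simp: Fpow_def)
      have G: "strong K (f G) N \<and> |points (f G)| \<le>o |X|" if "G \<subset> F" for G
      proof -
        have "G \<in> Fpow W" "(G, F) \<in> finite_psubset"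
          using that F finite_subset by (auto simp: Fpow_def finite_psubset_def)
        then show ?thesis using IH[of G] by blast
      qed
      let ?A = "(\<Union>x\<in>F. D x) \<union> (\<Union>G\<in>{G. G \<subset> F}. points (f G))"
      have fin: "finite {G. G \<subset> F}" by (rule finite_subset[of _ "Pow F"]) (use F in auto)
      have "|D x| \<le>o |X|" if "x \<in> F" for x using D F(2) that by blast
      moreover have "|points (f G)| \<le>o |X|" if "G \<in> {G. G \<subset> F}" for G using G that by blast
      ultimately have "|?A| \<le>o |X|"
        by (intro card_of_Un_le card_of_UN_le inf card_of_finite_le[OF inf fin] card_of_finite_le[OF inf F(1)])
      moreover have "?A \<subseteq> points N" using D F(2) G strong_points by blast
      ultimately obtain r where "strong K r N" "?A \<subseteq> points r" "|points r| \<le>o |X|"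
        using LS_submodel[OF N _ _ X, of ?A] by blast
      then show ?thesis by (intro exI[of _ r]) blast
    qed simp
  qed
  then obtain S where S: "\<And>F. ?P S F (S F)" by blast
  show ?thesis
  proof (rule exI[of _ S], rule ballI)
    fix F assume F: "F \<in> Fpow W"
    have "\<forall>G\<subseteq>F. points (S G) \<subseteq> points (S F)"
    proof (intro allI impI)
      fix G assume "G \<subseteq> F"
      then show "points (S G) \<subseteq> points (S F)" using S[of F] F by (cases "G = F") auto
    qed
    then show "strong K (S F) N \<and> (\<forall>x\<in>F. D x \<subseteq> points (S F)) \<and>
      (\<forall>G\<subseteq>F. points (S G) \<subseteq> points (S F)) \<and> |points (S F)| \<le>o |X|" using S[of F] F by simp
  qed
qed

end

section \<open>Codes of enumerated structures\<close>

text \<open>Atomic sentences in names \<open>'q\<close>: equality of two names, a relation symbol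
  applied to names, and the graph of a function symbol. The set \<open>code\<close> defined below is
  the atomic diagram in these names.\<close>

type_synonym ('q, 'u) atom = "'q \<times> 'q + ('u \<times> 'q list + 'u \<times> ('q list \<times> 'q))"

definition code_space :: "'u::universe vocabulary \<Rightarrow> 'q set \<Rightarrow> ('q, 'u) atom set" where
  "code_space V Q =
    (Q \<times> Q) <+> ((dom (rel_arity V) \<times> lists Q) <+> (dom (fun_arity V) \<times> (lists Q \<times> Q)))"

definition code :: "'u::universe vocabulary \<Rightarrow> 'q set \<Rightarrow> ('q \<Rightarrow> 'u) \<Rightarrow> 'u struct \<Rightarrow>
    ('q, 'u) atom set" where
  "code V Q e M = {c \<in> code_space V Q. case c of
      Inl (p, q) \<Rightarrow> e p = e q
    | Inr (Inl (s, ps)) \<Rightarrow> map e ps \<in> rel_int M s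
    | Inr (Inr (s, ps, q)) \<Rightarrow> fun_arity V s = Some (length ps) \<and> fun_int M s (map e ps) = e q}"

lemma code_subset: "code V Q e M \<in> Pow (code_space V Q)"
  by (auto simp: code_def)

lemma card_of_code_space:
  assumes "infinite X" "|symbols V| \<le>o |X|" "|Q| \<le>o |X|"
  shows "|code_space V Q| \<le>o |X|"
proof -
  have "|dom (rel_arity V)| \<le>o |X|" "|dom (fun_arity V)| \<le>o |X|"
    using ordLeq_transitive[OF card_of_Plus1 assms(2)[unfolded symbols_def]]
      ordLeq_transitive[OF card_of_Plus2 assms(2)[unfolded symbols_def]] by auto
  then show ?thesis unfolding code_space_def
    by (intro card_of_Plus_le card_of_Times_le card_of_lists_le assms)
qed

text \<open>The equalities in the diagram make the map from \<open>e q\<close> to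
  \<open>e' q\<close> well defined and injective; the other atoms make it preserve relations and
  functions.\<close>

lemma code_eq_isomorphism:
  assumes M: "is_structure V M" "is_structure V M'" and e: "e ` Q = points M" "e' ` Q = points M'"
    and eq: "code V Q e M = code V Q e' M'"
  obtains g where "isomorphism V g M M'" "\<And>q. q \<in> Q \<Longrightarrow> g (e q) = e' q"
proof -
  have eq1: "e p = e q \<longleftrightarrow> e' p = e' q" if "p \<in> Q" "q \<in> Q" for p q
  proof -
    have "Inl (p, q) \<in> code V Q e M \<longleftrightarrow> Inl (p, q) \<in> code V Q e' M'" using eq by simp
    moreover have "Inl (p, q) \<in> code_space V Q" using that by (auto simp: code_space_def)
    ultimately show ?thesis by (simp add: code_def)
  qed
  have eq2: "map e ps \<in> rel_int M s \<longleftrightarrow> map e' ps \<in> rel_int M' s"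
    if "rel_arity V s = Some (length ps)" "ps \<in> lists Q" for s ps
  proof -
    have "Inr (Inl (s, ps)) \<in> code V Q e M \<longleftrightarrow> Inr (Inl (s, ps)) \<in> code V Q e' M'" using eq by simp
    moreover have "Inr (Inl (s, ps)) \<in> code_space V Q" using that by (auto simp: code_space_def)
    ultimately show ?thesis by (simp add: code_def)
  qed
  have eq3: "fun_int M s (map e ps) = e q \<longleftrightarrow> fun_int M' s (map e' ps) = e' q"
    if "fun_arity V s = Some (length ps)" "ps \<in> lists Q" "q \<in> Q" for s ps q
  proof -
    have "Inr (Inr (s, ps, q)) \<in> code V Q e M \<longleftrightarrow> Inr (Inr (s, ps, q)) \<in> code V Q e' M'" using eq by simp
    moreover have "Inr (Inr (s, ps, q)) \<in> code_space V Q" using that by (auto simp: code_space_def)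
    ultimately show ?thesis using that(1) by (simp add: code_def)
  qed
  define g where "g = (\<lambda>x. e' (inv_into Q e x))"
  have g: "g (e q) = e' q" if "q \<in> Q" for q
  proof -
    have "inv_into Q e (e q) \<in> Q" "e (inv_into Q e (e q)) = e q"
      using that by (auto simp: inv_into_into f_inv_into_f)
    then show ?thesis unfolding g_def using eq1 that by blast
  qed
  have pts: "\<exists>ps\<in>lists Q. map e ps = xs" if "set xs \<subseteq> points M" for xs
  proof (intro bexI)
    show "map e (map (inv_into Q e) xs) = xs" "map (inv_into Q e) xs \<in> lists Q"
      using map_f_inv_into[of xs e Q] that e(1) by auto
  qed
  have mg: "map g (map e ps) = map e' ps" if "ps \<in> lists Q" for ps
    using that g by auto
  have "isomorphism V g M M'"
    unfolding isomorphism_def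
  proof (intro conjI M allI impI)
    show "bij_betw g (points M) (points M')" unfolding bij_betw_def
    proof
      show "inj_on g (points M)" unfolding e(1)[symmetric]
        by (rule inj_onI) (use g eq1 in auto)
      show "g ` points M = points M'" unfolding e[symmetric] image_image using g by auto
    qed
  next
    fix s xs assume a: "fun_arity V s = Some (length xs) \<and> set xs \<subseteq> points M"
    then obtain ps where ps: "ps \<in> lists Q" "map e ps = xs" using pts by blast
    then have len: "fun_arity V s = Some (length ps)" using a by auto
    have "fun_int M s xs \<in> points M" using a M(1) unfolding is_structure_def by metis
    then obtain q where q: "q \<in> Q" "fun_int M s xs = e q" using e(1) by blast
    then have "fun_int M' s (map e' ps) = e' q" using eq3[OF len ps(1) q(1)] ps(2) by simp
    then show "g (fun_int M s xs) = fun_int M' s (map g xs)" using q g mg[OF ps(1)] ps(2) by simp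
  next
    fix s xs assume a: "rel_arity V s = Some (length xs) \<and> set xs \<subseteq> points M"
    then obtain ps where ps: "ps \<in> lists Q" "map e ps = xs" using pts by blast
    then have "rel_arity V s = Some (length ps)" using a by auto
    then show "xs \<in> rel_int M s \<longleftrightarrow> map g xs \<in> rel_int M' s"
      using eq2[OF _ ps(1)] ps(2) mg[OF ps(1)] by auto
  qed
  then show ?thesis using that g by blast
qed

text \<open>Each type is realized in a model of size at most |X|. The diagram of such a model, in
  names for the tuple, for the parameters and for all its points, determines the type, and there are
  at most 2^|X| diagrams.\<close>

lemma (in aec) card_of_types_le:
  assumes I: "|I| \<le>o |X|" and A: "|A| \<le>o |X|" and X: "|{..<LS K}| \<le>o |X|"
  shows "|{gtp K I b A N | b N. (b, A, N) \<in> triples K I}| \<le>o |Pow X|"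
proof -
  have inf: "infinite X" using infinite_card_of_le[OF infinite_LS X] .
  \<comment> \<open>The summands name the tuple, the parameters in \<open>A\<close>, and by way of
    \<open>X\<close> every point of the chosen submodel.\<close>
  define Q where "Q = (I <+> A) <+> X"
  define Y where "Y = {(b, N). (b, A, N) \<in> triples K I}"
  define ok where "ok = (\<lambda>(b, N) (N0, e). strong K N0 N \<and> e ` Q = points N0 \<and>
    (\<forall>i\<in>I. e (Inl (Inl i)) = b i) \<and> (\<forall>a\<in>A. e (Inl (Inr a)) = a))"
  have ex: "\<exists>w. ok y w" if yY: "y \<in> Y" for y
  proof -
    obtain b N where y: "y = (b, N)" by fastforce
    have N: "N \<in> models K" "A \<subseteq> points N" "b \<in> I \<rightarrow>\<^sub>E points N" using yY by (auto simp: y Y_def triples_def)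
    have "|A \<union> b ` I| \<le>o |X|" by (intro card_of_Un_le inf A card_of_image_le I)
    moreover have "A \<union> b ` I \<subseteq> points N" using N by auto
    ultimately obtain N0 where N0: "strong K N0 N" "A \<union> b ` I \<subseteq> points N0" "|points N0| \<le>o |X|"
      using LS_submodel[OF N(1) _ _ X] by blast
    obtain h where h: "h ` X = points N0"
      using card_of_le_surj[OF N0(3)] model_nonempty strong_models[OF N0(1)] by metis
    define e where "e = case_sum (case_sum b (\<lambda>a. a)) h"
    have "e ` Q = b ` I \<union> A \<union> h ` X" unfolding Q_def e_def Plus_def by (simp add: image_Un image_image)
    then have "ok y (N0, e)" using N0 h by (auto simp: ok_def y e_def)
    then show ?thesis ..
  qed
  define w where "w = (\<lambda>y. SOME w. ok y w)"
  have w: "ok y (w y)" if "y \<in> Y" for y unfolding w_def using ex[OF that] by (rule someI_ex)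
  define f where "f = (\<lambda>(b, N). gtp K I b A N)"
  define c where "c = (\<lambda>y. code (vocab K) Q (snd (w y)) (fst (w y)))"
  have "|f ` Y| \<le>o |Pow X|"
  proof (rule card_of_le_if_factors)
    have "|code_space (vocab K) Q| \<le>o |X|"
      unfolding Q_def using ordLeq_transitive[OF symbols_le_LS X]
      by (intro card_of_code_space inf card_of_Plus_le I A card_of_mono1 subset_refl)
    then have "|Pow (code_space (vocab K) Q)| \<le>o |Pow X|" by (rule card_of_Pow_mono)
    moreover have "c ` Y \<subseteq> Pow (code_space (vocab K) Q)" unfolding c_def using code_subset by blast
    ultimately show "|c ` Y| \<le>o |Pow X|" by (rule card_of_subset_le[rotated])
  next
    fix y y' assume y: "y \<in> Y" "y' \<in> Y" and eq: "c y = c y'"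
    obtain b N b' N' where yy: "y = (b, N)" "y' = (b', N')" by (cases y; cases y')
    obtain N0 e N0' e' where ww: "w y = (N0, e)" "w y' = (N0', e')" by (cases "w y"; cases "w y'")
    have oy: "ok y (N0, e)" "ok y' (N0', e')" using w[OF y(1)] w[OF y(2)] ww by simp_all
    have o: "strong K N0 N" "e ` Q = points N0" "\<forall>i\<in>I. e (Inl (Inl i)) = b i" "\<forall>a\<in>A. e (Inl (Inr a)) = a"
      using oy(1) unfolding ok_def yy by simp_all
    have o': "strong K N0' N'" "e' ` Q = points N0'" "\<forall>i\<in>I. e' (Inl (Inl i)) = b' i" "\<forall>a\<in>A. e' (Inl (Inr a)) = a"
      using oy(2) unfolding ok_def yy by simp_all
    have bN: "b \<in> I \<rightarrow>\<^sub>E points N" "b' \<in> I \<rightarrow>\<^sub>E points N'" using y by (auto simp: yy Y_def triples_def)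
    have m: "N0 \<in> models K" "N0' \<in> models K" using strong_models o(1) o'(1) by auto
    have "code (vocab K) Q e N0 = code (vocab K) Q e' N0'" using eq by (simp add: c_def ww)
    then obtain g where g: "isomorphism (vocab K) g N0 N0'" "\<And>q. q \<in> Q \<Longrightarrow> g (e q) = e' q"
      using code_eq_isomorphism[OF model_structure[OF m(1)] model_structure[OF m(2)] o(2) o'(2)] by metis
    have IQ: "Inl (Inl i) \<in> Q" if "i \<in> I" for i using that by (auto simp: Q_def)
    have AQ: "Inl (Inr a) \<in> Q" if "a \<in> A" for a using that by (auto simp: Q_def)
    have b0: "b i \<in> points N0" "b' i \<in> points N0'" if "i \<in> I" for i
      using o(2,3) o'(2,3) IQ[OF that] that by (metis imageI)+
    have bb: "b \<in> I \<rightarrow>\<^sub>E points N0" "b' \<in> I \<rightarrow>\<^sub>E points N0'" using b0 bN by (auto simp: PiE_iff)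
    have A0: "A \<subseteq> points N0" "A \<subseteq> points N0'" using o(2,4) o'(2,4) AQ by (metis imageI subsetI)+
    have "gtp K I b A N0 = gtp K I b' A N0'"
    proof (rule gtp_embedding[OF iso_embedding[OF m(1) g(1)] A0(1) bb(1) _ bb(2)])
      show "g x = x" if "x \<in> A" for x using g(2)[OF AQ[OF that]] o(4) o'(4) that by simp
      show "b' i = g (b i)" if "i \<in> I" for i using g(2)[OF IQ[OF that]] o(3) o'(3) that by simp
    qed
    then show "f y = f y'" unfolding f_def yy
      using gtp_strong[OF o(1) A0(1) bb(1)] gtp_strong[OF o'(1) A0(2) bb(2)] by simp
  qed
  moreover have "{gtp K I b A N | b N. (b, A, N) \<in> triples K I} = f ` Y" by (auto simp: f_def Y_def)
  ultimately show ?thesis by simp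
qed

section \<open>Ehrenfeucht-Mostowski models\<close>

text \<open>Subsets of F are named by the positions of their members in the increasing enumeration
  of F, so that subsets of different finite sets correspond to each other. Positions beyond
  \<open>card F\<close> are ignored.\<close>

definition pos :: "'u::universe set \<Rightarrow> nat set \<Rightarrow> 'u set" where
  "pos F P = (\<lambda>k. sorted_list_of_set F ! k) ` (P \<inter> {..<card F})"

lemma pos_subset: "finite F \<Longrightarrow> pos F P \<subseteq> F"
proof
  fix x assume F: "finite F" and "x \<in> pos F P"
  then obtain k where "k < card F" "x = sorted_list_of_set F ! k" by (auto simp: pos_def)
  then have "x \<in> set (sorted_list_of_set F)" by simp
  then show "x \<in> F" using F by simp
qed

lemma pos_surj:
  assumes "finite F" "A \<subseteq> F"
  shows "pos F {k. k < card F \<and> sorted_list_of_set F ! k \<in> A} = A"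
proof
  show "A \<subseteq> pos F {k. k < card F \<and> sorted_list_of_set F ! k \<in> A}"
  proof
    fix x assume "x \<in> A"
    then have "x \<in> set (sorted_list_of_set F)" using assms by auto
    then obtain k where "k < card F" "sorted_list_of_set F ! k = x" by (auto simp: in_set_conv_nth)
    then show "x \<in> pos F {k. k < card F \<and> sorted_list_of_set F ! k \<in> A}"
      unfolding pos_def using \<open>x \<in> A\<close> by (intro image_eqI[of _ _ k]) auto
  qed
qed (auto simp: pos_def)

lemma pos_strict_mono:
  assumes "finite F" "\<And>x y. x \<in> F \<Longrightarrow> y \<in> F \<Longrightarrow> x < y \<Longrightarrow> h x < (h y :: 'u::universe)"
  shows "pos (h ` F) P = h ` pos F P"
proof -
  let ?l = "sorted_list_of_set F"
  have "sorted_wrt (<) ?l" by simp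
  then have "sorted_wrt (<) (map h ?l)" unfolding sorted_wrt_map
    by (rule sorted_wrt_mono_rel[rotated]) (use assms in auto)
  moreover have "set (map h ?l) = set (sorted_list_of_set (h ` F))" using assms(1) by simp
  ultimately have eq: "sorted_list_of_set (h ` F) = map h ?l"
    using strict_sorted_equal by (metis strict_sorted_list_of_set)
  then have len: "card (h ` F) = card F" by (metis length_map length_sorted_list_of_set)
  have "sorted_list_of_set (h ` F) ! k = h (?l ! k)" if "k < card F" for k
    using that eq by simp
  then show ?thesis unfolding pos_def len image_image by (intro image_cong) auto
qed

text \<open>Send the greatest member to the greatest and remove both. The order is a predicate
  because it is later used for orders that are not the one of the type, such as \<open>lex\<close>
  on sets.\<close>

lemma finite_linear_order_embeds:
  assumes "finite G" "finite H" "card G \<le> card (H :: 'u::universe set)"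
    and irr: "\<And>x. x \<in> G \<Longrightarrow> \<not> lt x x"
    and tr: "\<And>x y z. x \<in> G \<Longrightarrow> y \<in> G \<Longrightarrow> z \<in> G \<Longrightarrow> lt x y \<Longrightarrow> lt y z \<Longrightarrow> lt x z"
    and tot: "\<And>x y. x \<in> G \<Longrightarrow> y \<in> G \<Longrightarrow> x \<noteq> y \<Longrightarrow> lt x y \<or> lt y x"
  shows "\<exists>e. e ` G \<subseteq> H \<and> (\<forall>x\<in>G. \<forall>y\<in>G. lt x y \<longrightarrow> e x < e y)"
  using assms
proof (induction "card G" arbitrary: G H)
  case 0
  then show ?case by auto
next
  case (Suc n)
  have ne: "G \<noteq> {}" using Suc.hyps(2) by auto
  have "\<exists>m\<in>G. \<forall>x\<in>G. x \<noteq> m \<longrightarrow> lt x m"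
    using Suc.prems(1) ne Suc.prems(4-6)
  proof (induction G rule: finite_ne_induct)
    case (singleton x)
    show ?case by simp
  next
    case (insert a G)
    have "\<exists>m\<in>G. \<forall>x\<in>G. x \<noteq> m \<longrightarrow> lt x m"
    proof (rule insert.IH)
      show "\<not> lt x x" if "x \<in> G" for x using insert.prems(1)[of x] that by simp
      show "lt x z" if "x \<in> G" "y \<in> G" "z \<in> G" "lt x y" "lt y z" for x y z
        using insert.prems(2)[of x y z] that by simp
      show "lt x y \<or> lt y x" if "x \<in> G" "y \<in> G" "x \<noteq> y" for x y
        using insert.prems(3)[of x y] that by simp
    qed
    then obtain m where m: "m \<in> G" "\<forall>x\<in>G. x \<noteq> m \<longrightarrow> lt x m" by blast
    show ?case
    proof (cases "lt m a")
      case True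
      have "lt x a" if "x \<in> G" for x
        using m True insert.prems(2)[of x m a] that by (cases "x = m") auto
      then show ?thesis by blast
    next
      case False
      then have "lt a m" using insert.prems(3)[of a m] m(1) insert.hyps by auto
      then show ?thesis using m by blast
    qed
  qed
  then obtain m where m: "m \<in> G" "\<And>x. x \<in> G \<Longrightarrow> x \<noteq> m \<Longrightarrow> lt x m" by blast
  have H: "H \<noteq> {}" using Suc.hyps(2) Suc.prems(3) by auto
  have "\<exists>e. e ` (G - {m}) \<subseteq> H - {Max H} \<and> (\<forall>x\<in>G - {m}. \<forall>y\<in>G - {m}. lt x y \<longrightarrow> e x < e y)"
  proof (rule Suc.hyps(1))
    show "n = card (G - {m})" using Suc.hyps(2) m(1) Suc.prems(1) by simp
    show "card (G - {m}) \<le> card (H - {Max H})"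
      using Suc.prems(1-3) m(1) H by simp
    show "finite (G - {m})" "finite (H - {Max H})" using Suc.prems by auto
    show "\<not> lt x x" if "x \<in> G - {m}" for x using Suc.prems(4) that by blast
    show "lt x z" if "x \<in> G - {m}" "y \<in> G - {m}" "z \<in> G - {m}" "lt x y" "lt y z" for x y z
      using Suc.prems(5)[of x y z] that by blast
    show "lt x y \<or> lt y x" if "x \<in> G - {m}" "y \<in> G - {m}" "x \<noteq> y" for x y
      using Suc.prems(6)[of x y] that by blast
  qed
  then obtain e where e: "e ` (G - {m}) \<subseteq> H - {Max H}" "\<forall>x\<in>G - {m}. \<forall>y\<in>G - {m}. lt x y \<longrightarrow> e x < e y"
    by blast
  let ?e = "e(m := Max H)"
  have MH: "Max H \<in> H" using Suc.prems(2) H by simp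
  have "?e ` G \<subseteq> H" using e(1) MH by auto
  moreover have "?e x < ?e y" if xy: "x \<in> G" "y \<in> G" "lt x y" for x y
  proof -
    have xm: "x \<noteq> m"
    proof
      assume "x = m"
      then have "y \<noteq> m" using xy Suc.prems(4) by blast
      then have "lt y m" using m xy by blast
      then show False using Suc.prems(4)[of m] Suc.prems(5)[of m y m] xy \<open>x = m\<close> by blast
    qed
    show ?thesis
    proof (cases "y = m")
      case True
      have "e x \<in> H - {Max H}" using e(1) xm xy(1) by blast
      then have "e x \<le> Max H" "e x \<noteq> Max H" using Suc.prems(2) by auto
      then show ?thesis using True xm by simp
    next
      case False
      then show ?thesis using e(2) xm xy by simp
    qed
  qed
  ultimately show ?case by blast
qed

section \<open>Enumerated families of submodels and their colours\<close>

context aec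
begin

text \<open>A family of submodels of N that behaves like the hulls of finite subsets of W, all
  enumerated by the same set Q of names.\<close>

definition frame :: "'q set \<Rightarrow> 'u struct \<Rightarrow> 'u set \<Rightarrow> ('u set \<Rightarrow> 'u struct) \<Rightarrow> ('u set \<Rightarrow> 'q \<Rightarrow> 'u) \<Rightarrow> bool" where
  "frame Q N W S s \<longleftrightarrow> N \<in> models K \<and>
    (\<forall>F\<in>Fpow W. strong K (S F) N \<and> s F ` Q = points (S F) \<and> (\<forall>G\<subseteq>F. points (S G) \<subseteq> points (S F)))"

text \<open>The name \<open>(P, q)\<close> denotes the point called q in the submodel of that subset
  of F which occupies the positions P. As all these subsets enter one diagram, equal colours give an
  isomorphism that respects all the smaller submodels at once.\<close>

definition colour :: "'q set \<Rightarrow> ('u set \<Rightarrow> 'u struct) \<Rightarrow> ('u set \<Rightarrow> 'q \<Rightarrow> 'u) \<Rightarrow> 'u set \<Rightarrow>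
    (nat set \<times> 'q, 'u) atom set" where
  "colour Q S s F = code V (Fpow UNIV \<times> Q) (\<lambda>(P, q). s (pos F P) q) (S F)"

lemma frame_strong:
  assumes "frame Q N W S s" "F \<subseteq> G" "G \<in> Fpow W"
  shows "strong K (S F) (S G)"
proof (rule strong_if_subset)
  have "F \<in> Fpow W" using assms(2,3) finite_subset by (auto simp: Fpow_def)
  then show "strong K (S F) N" "strong K (S G) N" "points (S F) \<subseteq> points (S G)"
    using assms unfolding frame_def by auto
qed

lemma frame_in_points:
  assumes "frame Q N W S s" "F \<subseteq> G" "G \<in> Fpow W" "q \<in> Q"
  shows "s F q \<in> points (S G)"
proof -
  have "F \<in> Fpow W" using assms(2,3) finite_subset by (auto simp: Fpow_def)
  then have "s F q \<in> points (S F)" using assms(1,4) unfolding frame_def by blast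
  then show ?thesis using frame_strong[OF assms(1-3)] strong_points by blast
qed

lemma colour_enumerates:
  assumes "frame Q N W S s" "F \<in> Fpow W"
  shows "(\<lambda>(P, q). s (pos F P) q) ` (Fpow UNIV \<times> Q) = points (S F)"
proof
  have F: "finite F" using assms(2) by (simp add: Fpow_def)
  show "(\<lambda>(P, q). s (pos F P) q) ` (Fpow UNIV \<times> Q) \<subseteq> points (S F)"
    using frame_in_points[OF assms(1) pos_subset[OF F] assms(2)] by auto
  show "points (S F) \<subseteq> (\<lambda>(P, q). s (pos F P) q) ` (Fpow UNIV \<times> Q)"
  proof
    fix x assume "x \<in> points (S F)"
    then obtain q where q: "q \<in> Q" "x = s F q" using assms unfolding frame_def by blast
    let ?P = "{k. k < card F \<and> sorted_list_of_set F ! k \<in> F}"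
    have "pos F ?P = F" by (rule pos_surj[OF F]) simp
    moreover have "?P \<in> Fpow UNIV" by (simp add: Fpow_def)
    ultimately show "x \<in> (\<lambda>(P, q). s (pos F P) q) ` (Fpow UNIV \<times> Q)"
      using q by (intro image_eqI[of _ _ "(?P, q)"]) auto
  qed
qed

lemma colour_eq_isomorphism:
  assumes fr: "frame Q N W S s" "frame Q N' W' S' s'" and F: "F \<in> Fpow W" "h ` F \<in> Fpow W'"
    and h: "\<And>x y. x \<in> F \<Longrightarrow> y \<in> F \<Longrightarrow> x < y \<Longrightarrow> h x < h y"
    and eq: "colour Q S s F = colour Q S' s' (h ` F)"
  shows "\<exists>g. isomorphism V g (S F) (S' (h ` F)) \<and> (\<forall>A\<subseteq>F. \<forall>q\<in>Q. g (s A q) = s' (h ` A) q)"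
proof -
  have fin: "finite F" using F by (simp add: Fpow_def)
  have "strong K (S F) N" "strong K (S' (h ` F)) N'" using fr F by (simp_all add: frame_def)
  then have m: "S F \<in> models K" "S' (h ` F) \<in> models K" using strong_models by blast+
  obtain g where g: "isomorphism V g (S F) (S' (h ` F))"
    "\<And>z. z \<in> Fpow UNIV \<times> Q \<Longrightarrow> g ((\<lambda>(P, q). s (pos F P) q) z) = (\<lambda>(P, q). s' (pos (h ` F) P) q) z"
    using code_eq_isomorphism[OF model_structure[OF m(1)] model_structure[OF m(2)]
        colour_enumerates[OF fr(1) F(1)] colour_enumerates[OF fr(2) F(2)] eq[unfolded colour_def]] by metis
  have "g (s A q) = s' (h ` A) q" if "A \<subseteq> F" "q \<in> Q" for A q
  proof -
    let ?P = "{k. k < card F \<and> sorted_list_of_set F ! k \<in> A}"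
    have "g (s (pos F ?P) q) = s' (pos (h ` F) ?P) q" using g(2)[of "(?P, q)"] that(2) by (simp add: Fpow_def)
    moreover have "pos (h ` F) ?P = h ` pos F ?P" by (rule pos_strict_mono[OF fin h])
    ultimately show ?thesis using pos_surj[OF fin that(1)] by simp
  qed
  then show ?thesis using g(1) by blast
qed

lemma frame_exists:
  fixes d :: "'u \<Rightarrow> 'p \<Rightarrow> 'u"
  assumes N: "N \<in> models K" and d: "\<And>w p. w \<in> W \<Longrightarrow> p \<in> Ind \<Longrightarrow> d w p \<in> points N"
    and X: "|Ind| \<le>o |X|" "|{..<LS K}| \<le>o |X|"
  shows "\<exists>S s. frame (Ind <+> X) N W S s \<and> (\<forall>w\<in>W. \<forall>p\<in>Ind. s {w} (Inl p) = d w p)"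
proof -
  have "\<exists>S. \<forall>F\<in>Fpow W. strong K (S F) N \<and> (\<forall>x\<in>F. d x ` Ind \<subseteq> points (S F)) \<and>
    (\<forall>G\<subseteq>F. points (S G) \<subseteq> points (S F)) \<and> |points (S F)| \<le>o |X|"
  proof (rule submodel_family[OF N _ X(2)])
    fix w assume "w \<in> W"
    then show "d w ` Ind \<subseteq> points N \<and> |d w ` Ind| \<le>o |X|" using d card_of_image_le[OF X(1)] by auto
  qed
  then obtain S where S': "\<forall>F\<in>Fpow W. strong K (S F) N \<and> (\<forall>x\<in>F. d x ` Ind \<subseteq> points (S F)) \<and>
    (\<forall>G\<subseteq>F. points (S G) \<subseteq> points (S F)) \<and> |points (S F)| \<le>o |X|" by (elim exE)
  then have S: "strong K (S F) N \<and> (\<forall>x\<in>F. d x ` Ind \<subseteq> points (S F)) \<and>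
    (\<forall>G\<subseteq>F. points (S G) \<subseteq> points (S F)) \<and> |points (S F)| \<le>o |X|" if "F \<in> Fpow W" for F
    using that by simp
  have "\<exists>t. t ` (Ind <+> X) = points (S F) \<and> (\<forall>w\<in>W. F = {w} \<longrightarrow> (\<forall>p\<in>Ind. t (Inl p) = d w p))"
    if F: "F \<in> Fpow W" for F
  proof -
    have "S F \<in> models K" using S[OF F] strong_models[of "S F" N] by simp
    then have "points (S F) \<noteq> {}" by (rule model_nonempty)
    moreover have "|points (S F)| \<le>o |X|" using S[OF F] by simp
    ultimately obtain g where g: "g ` X = points (S F)" using card_of_le_surj by metis
    obtain a where a: "a \<in> points (S F)" using \<open>points (S F) \<noteq> {}\<close> by blast
    \<comment> \<open>On a singleton \<open>{w}\<close> the names in \<open>Ind\<close> denote the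
      prescribed tuple of w; elsewhere they fall on an arbitrary point \<open>a\<close>. The names
      in \<open>X\<close> ensure surjectivity.\<close>
    let ?t = "case_sum (\<lambda>p. if \<exists>w\<in>W. F = {w} then d (the_elem F) p else a) g"
    have "?t (Inl p) \<in> points (S F)" if "p \<in> Ind" for p
    proof (cases "\<exists>w\<in>W. F = {w}")
      case True
      then obtain w where "F = {w}" by blast
      moreover have "\<forall>x\<in>F. d x ` Ind \<subseteq> points (S F)" using S[OF F] by simp
      ultimately show ?thesis using True that by auto
    next
      case False
      then show ?thesis using a by simp
    qed
    then have "?t ` (Ind <+> X) = points (S F)" using g by (auto simp: Plus_def image_Un image_image)
    then show ?thesis by (intro exI[of _ ?t]) auto
  qed
  then obtain s where s: "\<And>F. F \<in> Fpow W \<Longrightarrow> s F ` (Ind <+> X) = points (S F) \<and>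
    (\<forall>w\<in>W. F = {w} \<longrightarrow> (\<forall>p\<in>Ind. s F (Inl p) = d w p))" by metis
  have "frame (Ind <+> X) N W S s" unfolding frame_def using S s N by simp
  moreover have "s {w} (Inl p) = d w p" if "w \<in> W" "p \<in> Ind" for w p
    using s[of "{w}"] that by (simp add: Fpow_def)
  ultimately show ?thesis by blast
qed

text \<open>One colour C n is fixed for each finite size n. No single set is homogeneous for all
  sizes: as n grows, the sets and even the frames change, and only the colours persist.\<close>

lemma homogeneous_colours_exist:
  fixes \<chi> :: 'u and Q :: "'q set"
  assumes \<chi>: "cardinal \<chi>" "|{..<LS K}| \<le>o |{..<\<chi>}|" and Q: "|Q| \<le>o |{..<\<chi>}|"
    and W: "\<And>j. j < card_succ (two_power \<chi>) \<Longrightarrow> |{..<beth j}| \<le>o |W j|"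
  shows "\<exists>C. \<forall>n. \<exists>i<card_succ (two_power \<chi>). \<exists>H\<subseteq>W i. infinite H \<and>
    (\<forall>F\<subseteq>H. finite F \<longrightarrow> card F \<le> n \<longrightarrow> colour Q (S i) (s i) F = C (card F))"
proof -
  define \<theta> where "\<theta> = card_succ (two_power \<chi>)"
  define col where "col = (\<lambda>i. colour Q (S i) (s i))"
  define Col where "Col = Pow (code_space V (Fpow (UNIV :: nat set) \<times> Q))"
  have inf: "infinite {..<\<chi>}" using infinite_card_of_le[OF infinite_LS \<chi>(2)] .
  have tp: "cardinal (two_power \<chi>)" by (rule cardinal_two_power)
  have inf2: "infinite {..<two_power \<chi>}"
    using infinite_card_of_le[OF inf ordLess_imp_ordLeq[OF card_of_less_two_power]] .
  have lim: "limit_ordinal \<theta>" unfolding \<theta>_def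
    by (rule infinite_cardinal_limit[OF cardinal_card_succ infinite_card_succ[OF inf2]])
  have colC: "col i F \<in> Col" for i F unfolding col_def Col_def colour_def by (rule code_subset)
  have "|Fpow (UNIV :: nat set)| \<le>o |{..<\<chi>}|"
    using inf infinite_iff_card_of_nat by (intro card_of_Fpow_le) blast+
  then have "|Col| \<le>o |Pow {..<\<chi>}|" unfolding Col_def
    by (intro card_of_Pow_mono card_of_code_space inf card_of_Times_le Q ordLeq_transitive[OF symbols_le_LS \<chi>(2)])
  then have Col: "|Col| \<le>o |{..<two_power \<chi>}|"
    using ordLeq_ordIso_trans ordIso_symmetric[OF card_of_two_power] by blast
  \<comment> \<open>Homogeneity for sizes below n is demanded of arbitrarily large beth sizes below
    \<theta>, so that there is always enough room for the next use of Erdos-Rado.\<close>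
  define good where "good = (\<lambda>(n::nat) C. \<forall>j<\<theta>. \<exists>i<\<theta>. \<exists>H\<subseteq>W i. |{..<beth j}| <o |H| \<and>
    (\<forall>F\<subseteq>H. finite F \<longrightarrow> card F < n \<longrightarrow> col i F = C (card F)))"
  have good0: "good 0 C" for C unfolding good_def
  proof (intro allI impI)
    fix j assume "j < \<theta>"
    \<comment> \<open>The hypothesis gives only \<open>\<le>\<close>; passing to
      \<open>osucc j\<close> makes the inequality strict.\<close>
    then have o: "osucc j < \<theta>" using lim limit_osucc by blast
    have "|{..<beth j}| <o |{..<beth (osucc j)}|" unfolding beth_osucc by (rule card_of_less_two_power)
    then have "|{..<beth j}| <o |W (osucc j)|" using W[of "osucc j"] o ordLess_ordLeq_trans unfolding \<theta>_def by blast
    then show "\<exists>i<\<theta>. \<exists>H\<subseteq>W i. |{..<beth j}| <o |H| \<and> (\<forall>F\<subseteq>H. finite F \<longrightarrow> card F < 0 \<longrightarrow> col i F = C (card F))"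
      using o by (intro exI[of _ "osucc j"] conjI exI[of _ "W (osucc j)"]) auto
  qed
  have step: "\<exists>c. good (Suc n) (C(n := c))" if g: "good n C" for n C
  proof -
    define ok where "ok = (\<lambda>(j::'u) c. \<exists>i<\<theta>. \<exists>H\<subseteq>W i. |{..<beth j}| <o |H| \<and>
      (\<forall>F\<subseteq>H. finite F \<longrightarrow> card F < n \<longrightarrow> col i F = C (card F)) \<and>
      (\<forall>F\<subseteq>H. finite F \<longrightarrow> card F = n \<longrightarrow> col i F = c))"
    have "\<exists>c\<in>Col. ok j c" if j: "j < \<theta>" for j
    proof -
      \<comment> \<open>Raising j to at least 2^\<chi> makes beth_j1 bound the number of colours, as
        Erdos-Rado requires.\<close>
      define j1 where "j1 = max j (two_power \<chi>)"
      have j1: "j1 < \<theta>" using j less_card_succ unfolding j1_def \<theta>_def by simp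
      have beth1: "|{..<beth j}| \<le>o |{..<beth j1}|" unfolding j1_def
        by (intro card_of_lessThan_mono beth_mono) simp
      have "two_power \<chi> \<le> beth j1" unfolding j1_def by (meson le_beth max.cobounded2 order_trans)
      then have Col1: "|Col| \<le>o |{..<beth j1}|"
        using ordLeq_transitive[OF Col card_of_lessThan_mono] by blast
      \<comment> \<open>Room for sets of size n: the partition theorem at size m+1 consumes m beth
        steps, and n of them are reserved.\<close>
      define j2 where "j2 = (osucc ^^ n) j1"
      have "(osucc ^^ m) j1 < \<theta>" for m by (induction m) (use j1 limit_osucc[OF lim] in auto)
      then have "j2 < \<theta>" by (simp add: j2_def)
      obtain i H where H: "i < \<theta>" "H \<subseteq> W i" "|{..<beth j2}| <o |H|"
        "\<forall>F\<subseteq>H. finite F \<longrightarrow> card F < n \<longrightarrow> col i F = C (card F)"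
        using g[unfolded good_def, THEN spec, THEN mp, OF \<open>j2 < \<theta>\<close>] by (elim exE conjE) (rule that, assumption+)
      show ?thesis
      proof (cases n)
        case 0
        have "|{..<beth j}| <o |H|" using H(3) beth1 ordLeq_ordLess_trans by (simp add: j2_def 0)
        then have "ok j (col i {})" unfolding ok_def using H 0
          by (intro exI[of _ i] conjI exI[of _ H]) auto
        then show ?thesis using colC by blast
      next
        case (Suc m)
        have "|{..<beth ((osucc ^^ m) j1)}| \<le>o |{..<beth j2}|" unfolding j2_def Suc
          by (intro card_of_lessThan_mono beth_mono) (simp add: less_imp_le)
        then have "|{..<beth ((osucc ^^ m) j1)}| <o |H|" using H(3) ordLeq_ordLess_trans by blast
        then have "\<exists>H'\<subseteq>H. |{..<beth j1}| <o |H'| \<and> (\<exists>c\<in>Col. \<forall>F\<subseteq>H'. finite F \<and> card F = Suc m \<longrightarrow> col i F = c)"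
          by (rule Erdos_Rado[OF _ Col1]) (rule colC)
        then obtain H' c where H': "H' \<subseteq> H" "|{..<beth j1}| <o |H'|" "c \<in> Col"
          "\<forall>F\<subseteq>H'. finite F \<and> card F = Suc m \<longrightarrow> col i F = c"
          by (elim exE conjE bexE) (rule that, assumption+)
        have "ok j c" unfolding ok_def
        proof (intro exI[of _ i] exI[of _ H'] conjI)
          show "|{..<beth j}| <o |H'|" using ordLeq_ordLess_trans[OF beth1 H'(2)] .
          show "H' \<subseteq> W i" using H' H by blast
          show "\<forall>F\<subseteq>H'. finite F \<longrightarrow> card F < n \<longrightarrow> col i F = C (card F)"
            using H(4) subset_trans[OF _ H'(1)] by simp
          show "\<forall>F\<subseteq>H'. finite F \<longrightarrow> card F = n \<longrightarrow> col i F = c" using H'(4) Suc by simp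
        qed (rule H(1))
        then show ?thesis using H'(3) by blast
      qed
    qed
    then obtain c where c: "\<And>j. j < \<theta> \<Longrightarrow> c j \<in> Col" "\<And>j. j < \<theta> \<Longrightarrow> ok j (c j)" by metis
    \<comment> \<open>The colour found depends on j, but there are at most 2^\<chi> colours and
      \<theta> = (2^\<chi>)^+, so one of them serves cofinally many j.\<close>
    obtain c0 where c0: "\<And>j. j < \<theta> \<Longrightarrow> \<exists>j'. j \<le> j' \<and> j' < \<theta> \<and> c j' = c0"
      using pigeonhole_cofinal[OF tp inf2 Col, of c] c(1) unfolding \<theta>_def by metis
    have "good (Suc n) (C(n := c0))" unfolding good_def
    proof (intro allI impI)
      fix j assume "j < \<theta>"
      then obtain j' where j': "j \<le> j'" "j' < \<theta>" "c j' = c0" using c0 by blast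
      then have "ok j' c0" using c(2) by blast
      then obtain i H where H: "i < \<theta>" "H \<subseteq> W i" "|{..<beth j'}| <o |H|"
        "\<forall>F\<subseteq>H. finite F \<longrightarrow> card F < n \<longrightarrow> col i F = C (card F)"
        "\<forall>F\<subseteq>H. finite F \<longrightarrow> card F = n \<longrightarrow> col i F = c0"
        unfolding ok_def by (elim exE conjE) (rule that, assumption+)
      have "|{..<beth j}| \<le>o |{..<beth j'}|" by (intro card_of_lessThan_mono beth_mono j')
      then have "|{..<beth j}| <o |H|" using H(3) ordLeq_ordLess_trans by blast
      then show "\<exists>i<\<theta>. \<exists>H\<subseteq>W i. |{..<beth j}| <o |H| \<and>
          (\<forall>F\<subseteq>H. finite F \<longrightarrow> card F < Suc n \<longrightarrow> col i F = (C(n := c0)) (card F))"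
        using H by (intro exI[of _ i] conjI exI[of _ H]) (auto simp: less_Suc_eq)
    qed
    then show ?thesis by blast
  qed
  have good_cong: "good n C = good n C'" if "\<And>m. m < n \<Longrightarrow> C m = C' m" for n C C'
    unfolding good_def using that by simp
  \<comment> \<open>The update at n changes nothing; it separates the new value from the earlier
    ones in the form that the choice principle expects.\<close>
  have "\<exists>C. \<forall>n. good (Suc n) (C(n := C n))"
  proof (rule dependent_wellorder_choice)
    fix r n and f g :: "nat \<Rightarrow> (nat set \<times> 'q, 'u) atom set"
    assume "\<And>m. m < n \<Longrightarrow> f m = g m"
    then show "good (Suc n) (f(n := r)) = good (Suc n) (g(n := r))" by (intro good_cong) auto
  next
    fix n and f :: "nat \<Rightarrow> (nat set \<times> 'q, 'u) atom set"
    assume IH: "\<And>m. m < n \<Longrightarrow> good (Suc m) (f(m := f m))"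
    have "good n f" using IH[of "n - 1"] good0 by (cases n) auto
    then show "\<exists>r. good (Suc n) (f(n := r))" by (rule step)
  qed
  then obtain C where C: "\<And>n. good (Suc n) C" by auto
  show ?thesis
  proof (intro exI[of _ C] allI)
    fix n
    obtain j where j: "j < \<theta>" using lim limit_nonempty by blast
    obtain i H where H: "i < \<theta>" "H \<subseteq> W i" "|{..<beth j}| <o |H|"
      "\<forall>F\<subseteq>H. finite F \<longrightarrow> card F < Suc n \<longrightarrow> col i F = C (card F)"
      using C[of n, unfolded good_def, THEN spec, THEN mp, OF j]
      by (elim exE conjE) (rule that, assumption+)
    have "infinite H" using infinite_card_of_le[OF infinite_beth ordLess_imp_ordLeq[OF H(3)]] .
    then show "\<exists>i<card_succ (two_power \<chi>). \<exists>H\<subseteq>W i. infinite H \<and>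
        (\<forall>F\<subseteq>H. finite F \<longrightarrow> card F \<le> n \<longrightarrow> colour Q (S i) (s i) F = C (card F))"
      using H unfolding \<theta>_def col_def less_Suc_eq_le by blast
  qed
qed

text \<open>The predicate R stands for any property of the given long sequences, such as a splitting
  pattern or the order property; each finite part of the new sequence has the type of an increasing
  part of some sequence with R. The finite sets of X are placed in homogeneous sets of different
  models, so the new model is not found inside one of these but assembled as a direct limit.\<close>

theorem Ehrenfeucht_Mostowski:
  fixes \<chi> :: 'u and Ind :: "'p set" and R :: "'u struct \<Rightarrow> 'u set \<Rightarrow> ('u \<Rightarrow> 'p \<Rightarrow> 'u) \<Rightarrow> bool"
    and X :: "'x set"
  assumes \<chi>: "cardinal \<chi>" "|{..<LS K}| \<le>o |{..<\<chi>}|" and Ind: "|Ind| \<le>o |{..<\<chi>}|"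
    and long: "\<And>j. j < card_succ (two_power \<chi>) \<Longrightarrow> \<exists>N W d. R N W d \<and> N \<in> models K \<and>
      |{..<beth j}| \<le>o |W| \<and> (\<forall>w\<in>W. \<forall>p\<in>Ind. d w p \<in> points N)"
    and X: "|X| <o |UNIV :: 'u set|"
    and irr: "\<And>x. x \<in> X \<Longrightarrow> \<not> lt x x"
    and tr: "\<And>x y z. x \<in> X \<Longrightarrow> y \<in> X \<Longrightarrow> z \<in> X \<Longrightarrow> lt x y \<Longrightarrow> lt y z \<Longrightarrow> lt x z"
    and tot: "\<And>x y. x \<in> X \<Longrightarrow> y \<in> X \<Longrightarrow> x \<noteq> y \<Longrightarrow> lt x y \<or> lt y x"
  shows "\<exists>N d. N \<in> models K \<and> (\<forall>x\<in>X. \<forall>p\<in>Ind. d x p \<in> points N) \<and>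
    (\<forall>F\<in>Fpow X. \<exists>N' W d' e. R N' W d' \<and> N' \<in> models K \<and> (\<forall>w\<in>W. \<forall>p\<in>Ind. d' w p \<in> points N') \<and>
      e ` F \<subseteq> W \<and> (\<forall>x\<in>F. \<forall>y\<in>F. lt x y \<longrightarrow> e x < e y) \<and>
      gtp K (F \<times> Ind) (restrict (\<lambda>(x, p). d x p) (F \<times> Ind)) {} N =
      gtp K (F \<times> Ind) (restrict (\<lambda>(x, p). d' (e x) p) (F \<times> Ind)) {} N')"
proof -
  define \<theta> where "\<theta> = card_succ (two_power \<chi>)"
  define Q where "Q = Ind <+> {..<\<chi>}"
  have inf: "infinite {..<\<chi>}" using infinite_card_of_le[OF infinite_LS \<chi>(2)] .
  have Q\<chi>: "|Q| \<le>o |{..<\<chi>}|" unfolding Q_def by (intro card_of_Plus_le inf Ind card_of_mono1 subset_refl)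
  define ok where "ok = (\<lambda>(j::'u) (N, W, d, S, s). R N W d \<and> |{..<beth j}| \<le>o |W| \<and> frame Q N W S s \<and>
    (\<forall>w\<in>W. \<forall>p\<in>Ind. s {w} (Inl p) = d w p) \<and> (\<forall>w\<in>W. \<forall>p\<in>Ind. d w p \<in> points N))"
  have "\<exists>z. ok j z" if j: "j < \<theta>" for j
  proof -
    obtain N W d where NWd: "R N W d" "N \<in> models K" "|{..<beth j}| \<le>o |W|" "\<forall>w\<in>W. \<forall>p\<in>Ind. d w p \<in> points N"
      using long[OF j[unfolded \<theta>_def]] by (elim exE conjE) (rule that)
    have "\<exists>S s. frame Q N W S s \<and> (\<forall>w\<in>W. \<forall>p\<in>Ind. s {w} (Inl p) = d w p)"
      unfolding Q_def by (rule frame_exists[OF NWd(2) _ Ind \<chi>(2)]) (use NWd(4) in simp)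
    then obtain S s where "frame Q N W S s" "\<forall>w\<in>W. \<forall>p\<in>Ind. s {w} (Inl p) = d w p" by (elim exE conjE)
    then have "ok j (N, W, d, S, s)" unfolding ok_def using NWd by simp
    then show ?thesis ..
  qed
  then have "\<forall>j\<in>{..<\<theta>}. \<exists>z. ok j z" by simp
  then obtain f where f: "\<forall>j\<in>{..<\<theta>}. ok j (f j)" using bchoice by metis
  \<comment> \<open>The nested projections select W, S and s from the five components (N, W, d, S,
    s) of \<open>f i\<close>.\<close>
  have "\<exists>C. \<forall>n. \<exists>i<card_succ (two_power \<chi>). \<exists>H\<subseteq>fst (snd (f i)). infinite H \<and>
    (\<forall>F\<subseteq>H. finite F \<longrightarrow> card F \<le> n \<longrightarrow>
      colour Q (fst (snd (snd (snd (f i))))) (snd (snd (snd (snd (f i))))) F = C (card F))"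
  proof (rule homogeneous_colours_exist[OF \<chi> Q\<chi>])
    fix j assume "j < card_succ (two_power \<chi>)"
    then have "ok j (f j)" using f by (simp add: \<theta>_def)
    then show "|{..<beth j}| \<le>o |fst (snd (f j))|" unfolding ok_def by (simp add: case_prod_beta)
  qed
  then obtain C where C0: "\<forall>n. \<exists>i<\<theta>. \<exists>H\<subseteq>fst (snd (f i)). infinite H \<and>
    (\<forall>F\<subseteq>H. finite F \<longrightarrow> card F \<le> n \<longrightarrow>
      colour Q (fst (snd (snd (snd (f i))))) (snd (snd (snd (snd (f i))))) F = C (card F))"
    unfolding \<theta>_def[symmetric] by (elim exE)
  have C: "\<forall>n. \<exists>i H. i < \<theta> \<and> H \<subseteq> fst (snd (f i)) \<and> infinite H \<and>
    (\<forall>F\<subseteq>H. finite F \<longrightarrow> card F \<le> n \<longrightarrow>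
      colour Q (fst (snd (snd (snd (f i))))) (snd (snd (snd (snd (f i))))) F = C (card F))"
  proof
    fix n
    show "\<exists>i H. i < \<theta> \<and> H \<subseteq> fst (snd (f i)) \<and> infinite H \<and>
      (\<forall>F\<subseteq>H. finite F \<longrightarrow> card F \<le> n \<longrightarrow>
        colour Q (fst (snd (snd (snd (f i))))) (snd (snd (snd (snd (f i))))) F = C (card F))"
      using C0[THEN spec, of n] by (elim exE conjE) (intro exI conjI)
  qed
  obtain ii where "\<forall>n. \<exists>H. ii n < \<theta> \<and> H \<subseteq> fst (snd (f (ii n))) \<and> infinite H \<and>
    (\<forall>F\<subseteq>H. finite F \<longrightarrow> card F \<le> n \<longrightarrow>
      colour Q (fst (snd (snd (snd (f (ii n)))))) (snd (snd (snd (snd (f (ii n)))))) F = C (card F))"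
    using choice[OF C] by (elim exE)
  from choice[OF this] obtain H where H0: "\<forall>n. ii n < \<theta> \<and> H n \<subseteq> fst (snd (f (ii n))) \<and> infinite (H n) \<and>
    (\<forall>F\<subseteq>H n. finite F \<longrightarrow> card F \<le> n \<longrightarrow>
      colour Q (fst (snd (snd (snd (f (ii n)))))) (snd (snd (snd (snd (f (ii n)))))) F = C (card F))"
    by (elim exE)
  define Nn where "Nn = (\<lambda>n. fst (f (ii n)))"
  define W where "W = (\<lambda>n. fst (snd (f (ii n))))"
  define d0 where "d0 = (\<lambda>n. fst (snd (snd (f (ii n)))))"
  define S where "S = (\<lambda>n. fst (snd (snd (snd (f (ii n))))))"
  define s where "s = (\<lambda>n. snd (snd (snd (snd (f (ii n))))))"
  have "ok (ii n) (Nn n, W n, d0 n, S n, s n)" for n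
    using f H0 unfolding Nn_def W_def d0_def S_def s_def by simp
  then have R: "R (Nn n) (W n) (d0 n)" and fr: "frame Q (Nn n) (W n) (S n) (s n)"
    and sd: "\<forall>w\<in>W n. \<forall>p\<in>Ind. s n {w} (Inl p) = d0 n w p"
    and dN: "\<forall>w\<in>W n. \<forall>p\<in>Ind. d0 n w p \<in> points (Nn n)" for n
    unfolding ok_def by auto
  have H: "H n \<subseteq> W n" "infinite (H n)" for n using H0 unfolding W_def by simp_all
  have col: "colour Q (S n) (s n) F = C (card F)" if "F \<subseteq> H n" "finite F" "card F \<le> n" for n F
    using H0 that unfolding S_def s_def by simp
  \<comment> \<open>A finite G is placed in the set that is homogeneous for all sizes up to
    \<open>card G\<close>. The placements of different G are unrelated and may lie in different
    models.\<close>
  have "\<exists>e. e ` G \<subseteq> H (card G) \<and> (\<forall>x\<in>G. \<forall>y\<in>G. lt x y \<longrightarrow> e x < e y)" if G: "G \<in> Fpow X" for G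
  proof -
    have GX: "finite G" "G \<subseteq> X" using G by (auto simp: Fpow_def)
    obtain H' where H': "H' \<subseteq> H (card G)" "finite H'" "card H' = card G"
      using infinite_arbitrarily_large[OF H(2)] by metis
    have "\<exists>e. e ` G \<subseteq> H' \<and> (\<forall>x\<in>G. \<forall>y\<in>G. lt x y \<longrightarrow> e x < e y)"
    proof (rule finite_linear_order_embeds[OF GX(1) H'(2)])
      show "card G \<le> card H'" using H'(3) by simp
      show "\<not> lt x x" if "x \<in> G" for x using irr that GX(2) by blast
      show "lt x z" if "x \<in> G" "y \<in> G" "z \<in> G" "lt x y" "lt y z" for x y z
        using tr[of x y z] that GX(2) by blast
      show "lt x y \<or> lt y x" if "x \<in> G" "y \<in> G" "x \<noteq> y" for x y using tot[of x y] that GX(2) by blast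
    qed
    then show ?thesis using H'(1) by (meson subset_trans)
  qed
  then have "\<forall>G\<in>Fpow X. \<exists>e. e ` G \<subseteq> H (card G) \<and> (\<forall>x\<in>G. \<forall>y\<in>G. lt x y \<longrightarrow> e x < e y)" by (rule ballI)
  from bchoice[OF this] obtain E where E0: "\<forall>G\<in>Fpow X. E G ` G \<subseteq> H (card G) \<and> (\<forall>x\<in>G. \<forall>y\<in>G. lt x y \<longrightarrow> E G x < E G y)"
    by (elim exE)
  then have E: "E G ` G \<subseteq> H (card G)" "\<And>x y. x \<in> G \<Longrightarrow> y \<in> G \<Longrightarrow> lt x y \<Longrightarrow> E G x < E G y"
    if "G \<in> Fpow X" for G using that by simp_all
  have sub: "F \<in> Fpow X" if "F \<subseteq> G" "G \<in> Fpow X" for F G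
    using that finite_subset by (auto simp: Fpow_def)
  have un: "F \<union> G \<in> Fpow X" if "F \<in> Fpow X" "G \<in> Fpow X" for F G
    using that by (auto simp: Fpow_def)
  have Einj: "inj_on (E G) G" if G: "G \<in> Fpow X" for G
  proof (rule inj_onI)
    fix x y assume xy: "x \<in> G" "y \<in> G" "E G x = E G y"
    have "x \<in> X" "y \<in> X" using xy G by (auto simp: Fpow_def)
    then show "x = y" using tot[of x y] E(2)[OF G xy(1,2)] E(2)[OF G xy(2,1)] xy(3) by (metis less_irrefl)
  qed
  have EW: "E G ` F \<in> Fpow (W (card G))" if "F \<subseteq> G" "G \<in> Fpow X" for F G
  proof -
    have "E G ` F \<subseteq> W (card G)" using E(1)[OF that(2)] H(1) that(1) by blast
    moreover have "finite F" using that sub by (auto simp: Fpow_def)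
    ultimately show ?thesis by (simp add: Fpow_def)
  qed
  \<comment> \<open>\<open>B G\<close> is the submodel belonging to the placed copy of G, and
    \<open>val G (A, q)\<close> is the point that q names in the submodel of the subset A of
    G.\<close>
  define B where "B = (\<lambda>G. S (card G) (E G ` G))"
  define val where "val = (\<lambda>G z. s (card G) (E G ` fst z) (snd z))"
  have coh: "\<exists>g. isomorphism V g (B F) (S (card G) (E G ` F)) \<and>
      (\<forall>A\<subseteq>F. \<forall>q\<in>Q. g (val F (A, q)) = val G (A, q))" if FG: "F \<subseteq> G" "G \<in> Fpow X" for F G
  proof -
    have F: "F \<in> Fpow X" using sub FG by blast
    have finF: "finite F" and finG: "finite G" using F FG by (auto simp: Fpow_def)
    define h where "h = (\<lambda>x. E G (inv_into F (E F) x))"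
    have hE: "h (E F x) = E G x" if "x \<in> F" for x unfolding h_def using Einj[OF F] that by simp
    have hA: "h ` (E F ` A) = E G ` A" if "A \<subseteq> F" for A
      unfolding image_image using that hE by (intro image_cong) auto
    have c: "card (E F ` F) = card F" "card (E G ` F) = card F"
      using card_image[OF Einj[OF F]] card_image[OF inj_on_subset[OF Einj[OF FG(2)] FG(1)]] by auto
    have "colour Q (S (card F)) (s (card F)) (E F ` F) = C (card F)"
      using col[OF E(1)[OF F]] finF c(1) by simp
    \<comment> \<open>F has at most \<open>card G\<close> members, so the level chosen for G is
      homogeneous for the size of F too; hence the two placements of F have the same colour.\<close>
    moreover have "colour Q (S (card G)) (s (card G)) (E G ` F) = C (card F)"
      using col[of "E G ` F" "card G"] E(1)[OF FG(2)] FG(1) finF c(2) card_mono[OF finG FG(1)]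
      by (metis finite_imageI image_mono subset_trans)
    ultimately have eq: "colour Q (S (card F)) (s (card F)) (E F ` F) = colour Q (S (card G)) (s (card G)) (h ` (E F ` F))"
      using hA[of F] by simp
    have "\<exists>g. isomorphism V g (S (card F) (E F ` F)) (S (card G) (h ` (E F ` F))) \<and>
      (\<forall>A\<subseteq>E F ` F. \<forall>q\<in>Q. g (s (card F) A q) = s (card G) (h ` A) q)"
    proof (rule colour_eq_isomorphism[OF fr fr _ _ _ eq])
      show "E F ` F \<in> Fpow (W (card F))" by (rule EW[OF subset_refl F])
      show "h ` E F ` F \<in> Fpow (W (card G))" using EW[OF FG] hA[of F] by simp
      fix x y assume xy: "x \<in> E F ` F" "y \<in> E F ` F" "x < y"
      then obtain a b where ab: "a \<in> F" "b \<in> F" "x = E F a" "y = E F b" by blast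
      have "a \<noteq> b" using xy(3) ab by auto
      moreover have "\<not> lt b a"
      proof
        assume "lt b a"
        then have "y < x" using E(2)[OF F ab(2,1)] ab by simp
        then show False using xy(3) by simp
      qed
      ultimately have "lt a b" using tot[of a b] ab F by (auto simp: Fpow_def)
      then have "E G a < E G b" using E(2)[OF FG(2)] ab FG(1) by blast
      then show "h x < h y" using hE ab by simp
    qed
    then obtain g where g: "isomorphism V g (S (card F) (E F ` F)) (S (card G) (E G ` F))"
      "\<forall>A\<subseteq>E F ` F. \<forall>q\<in>Q. g (s (card F) A q) = s (card G) (h ` A) q" using hA[of F] by auto
    have "g (val F (A, q)) = val G (A, q)" if "A \<subseteq> F" "q \<in> Q" for A q
      using g(2) that hA[OF that(1)] image_mono[OF that(1), of "E F"] unfolding val_def by simp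
    then show ?thesis using g(1) unfolding B_def by blast
  qed
  have Bm: "strong K (B G) (Nn (card G))" "B G \<in> models K" if "G \<in> Fpow X" for G
  proof -
    show "strong K (B G) (Nn (card G))" using fr[of "card G"] EW[OF subset_refl that] unfolding frame_def B_def by simp
    then show "B G \<in> models K" using strong_models by blast
  qed
  have val_in: "val G (A, q) \<in> points (B G)" if "A \<subseteq> G" "G \<in> Fpow X" "q \<in> Q" for A G q
    unfolding val_def B_def using frame_in_points[OF fr image_mono[OF that(1)] EW[OF subset_refl that(2)] that(3)] by simp
  have val_surj: "\<exists>q\<in>Q. y = val G (G, q)" if "y \<in> points (B G)" "G \<in> Fpow X" for y G
  proof -
    have "s (card G) (E G ` G) ` Q = points (B G)"
      using fr[of "card G"] EW[OF subset_refl that(2)] unfolding frame_def B_def by simp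
    then show ?thesis using that(1) unfolding val_def by auto
  qed
  define Z where "Z = Fpow X \<times> Q"
  have val_iff: "val F z = val F z' \<longleftrightarrow> val G z = val G z'"
    if FG: "F \<subseteq> G" "G \<in> Fpow X" and z: "z \<in> Z" "z' \<in> Z" "fst z \<subseteq> F" "fst z' \<subseteq> F" for F G z z'
  proof -
    obtain g where g: "isomorphism V g (B F) (S (card G) (E G ` F))" "\<forall>A\<subseteq>F. \<forall>q\<in>Q. g (val F (A, q)) = val G (A, q)"
      using coh[OF FG] by (elim exE conjE)
    obtain A q A' q' where zz: "z = (A, q)" "z' = (A', q')" by (cases z; cases z')
    have a: "A \<subseteq> F" "A' \<subseteq> F" "q \<in> Q" "q' \<in> Q" using z by (auto simp: zz Z_def)
    have "inj_on g (points (B F))" using isomorphism_points[OF g(1)] by simp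
    then have "val F z = val F z' \<longleftrightarrow> g (val F z) = g (val F z')"
      using inj_on_eq_iff[of g "points (B F)"] val_in[OF _ sub[OF FG]] a unfolding zz by simp
    then show ?thesis using g(2) a unfolding zz by simp
  qed
  \<comment> \<open>The points of the limit: names are identified if they denote the same point of
    some \<open>B G\<close>. By \<open>val_iff\<close> every G large enough to contain both index
    sets then gives the same answer.\<close>
  define cls where "cls = (\<lambda>z. {z' \<in> Z. \<exists>G\<in>Fpow X. fst z \<subseteq> G \<and> fst z' \<subseteq> G \<and> val G z = val G z'})"
  have val_any: "val G z = val G z'" if z: "z \<in> Z" "z' \<in> Z" "z' \<in> cls z" and G: "G \<in> Fpow X" "fst z \<subseteq> G" "fst z' \<subseteq> G" for G z z'
  proof -
    obtain G' where G': "G' \<in> Fpow X" "fst z \<subseteq> G'" "fst z' \<subseteq> G'" "val G' z = val G' z'" using z(3) unfolding cls_def by blast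
    have U: "G \<union> G' \<in> Fpow X" using un G(1) G'(1) by blast
    have "val (G \<union> G') z = val (G \<union> G') z'" using val_iff[OF _ U z(1,2) G'(2,3)] G'(4) by simp
    then show ?thesis using val_iff[OF _ U z(1,2) G(2,3)] by simp
  qed
  have cls_sub: "cls z \<subseteq> cls z'"
    if z: "z \<in> Z" "z' \<in> Z" and G: "G \<in> Fpow X" "fst z \<subseteq> G" "fst z' \<subseteq> G" "val G z = val G z'" for z z' G
  proof
    fix y assume y: "y \<in> cls z"
    then have yZ: "y \<in> Z" by (simp add: cls_def)
    define U where "U = G \<union> fst y"
    have U: "U \<in> Fpow X" unfolding U_def using un G(1) yZ by (auto simp: Z_def)
    have sU: "fst z \<subseteq> U" "fst z' \<subseteq> U" "fst y \<subseteq> U" "G \<subseteq> U" using G by (auto simp: U_def)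
    have "val U z = val U y" by (rule val_any[OF z(1) yZ y U sU(1,3)])
    moreover have "val U z = val U z'" using val_iff[OF sU(4) U z G(2,3)] G(4) by simp
    ultimately have "val U z' = val U y" by simp
    then show "y \<in> cls z'" unfolding cls_def using yZ U sU by blast
  qed
  have cls_eq: "cls z = cls z' \<longleftrightarrow> val G z = val G z'"
    if z: "z \<in> Z" "z' \<in> Z" and G: "G \<in> Fpow X" "fst z \<subseteq> G" "fst z' \<subseteq> G" for z z' G
  proof
    assume "cls z = cls z'"
    moreover have "z' \<in> cls z'" unfolding cls_def using z(2) G by blast
    ultimately have "z' \<in> cls z" by simp
    then show "val G z = val G z'" by (rule val_any[OF z _ G])
  next
    assume v: "val G z = val G z'"
    show "cls z = cls z'" using cls_sub[OF z G v] cls_sub[OF z(2,1) G(1,3,2) v[symmetric]] by simp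
  qed
  \<comment> \<open>The limit has few enough points to be copied into the type from which the points
    of structures are drawn.\<close>
  have "|cls ` Z| \<le>o |UNIV :: 'u set|"
  proof -
    obtain y :: 'u where y: "|X| \<le>o |{..<y}|" using ex_ordinal_ge[OF X] by blast
    define m where "m = max y \<chi>"
    have m: "|X| \<le>o |{..<m}|" "|{..<\<chi>}| \<le>o |{..<m}|"
      using ordLeq_transitive[OF y card_of_lessThan_mono, of m] card_of_lessThan_mono[of \<chi> m] by (auto simp: m_def)
    have infm: "infinite {..<m}" using infinite_card_of_le[OF inf m(2)] .
    have "|Z| \<le>o |{..<m}|" unfolding Z_def
      by (intro card_of_Times_le infm card_of_Fpow_le m(1) ordLeq_transitive[OF Q\<chi> m(2)])
    then have "|cls ` Z| \<le>o |{..<m}|" by (rule card_of_image_le)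
    then show ?thesis using ordLeq_transitive[OF _ card_of_mono1[OF subset_UNIV]] by blast
  qed
  then obtain \<iota> :: "_ \<Rightarrow> 'u" where \<iota>: "inj_on \<iota> (cls ` Z)" unfolding card_of_ordLeq[symmetric] by blast
  define \<kappa> where "\<kappa> = (\<lambda>z. \<iota> (cls z))"
  have \<kappa>_iff: "\<kappa> z = \<kappa> z' \<longleftrightarrow> val G z = val G z'"
    if z: "z \<in> Z" "z' \<in> Z" and G: "G \<in> Fpow X" "fst z \<subseteq> G" "fst z' \<subseteq> G" for z z' G
    unfolding \<kappa>_def using inj_on_eq_iff[OF \<iota>, of "cls z" "cls z'"] z cls_eq[OF z G] by simp
  \<comment> \<open>The canonical map of \<open>B G\<close> into the limit; it is injective because
    \<open>\<kappa>_iff\<close> can be evaluated at G.\<close>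
  define \<phi> where "\<phi> = (\<lambda>G y. \<kappa> (SOME z. z \<in> Z \<and> fst z \<subseteq> G \<and> val G z = y))"
  have \<phi>: "\<phi> G (val G z) = \<kappa> z" if z: "z \<in> Z" "fst z \<subseteq> G" "G \<in> Fpow X" for G z
  proof -
    define z' where "z' = (SOME z'. z' \<in> Z \<and> fst z' \<subseteq> G \<and> val G z' = val G z)"
    have "z' \<in> Z \<and> fst z' \<subseteq> G \<and> val G z' = val G z" unfolding z'_def by (rule someI[of _ z]) (use z in simp)
    then show ?thesis unfolding \<phi>_def z'_def[symmetric] using \<kappa>_iff[of z' z G] z by simp
  qed
  have inZ: "(A, q) \<in> Z" if "A \<subseteq> G" "G \<in> Fpow X" "q \<in> Q" for A q G
    using sub[OF that(1,2)] that(3) by (simp add: Z_def)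
  have \<phi>_inj: "inj_on (\<phi> G) (points (B G))" if G: "G \<in> Fpow X" for G
  proof (rule inj_onI)
    fix x y assume xy: "x \<in> points (B G)" "y \<in> points (B G)" "\<phi> G x = \<phi> G y"
    obtain p q where pq: "p \<in> Q" "q \<in> Q" "x = val G (G, p)" "y = val G (G, q)"
      using val_surj[OF xy(1) G] val_surj[OF xy(2) G] by blast
    note Zp = inZ[OF subset_refl G pq(1)] and Zq = inZ[OF subset_refl G pq(2)]
    have "\<kappa> (G, p) = \<kappa> (G, q)" using xy(3) \<phi>[OF Zp _ G] \<phi>[OF Zq _ G] pq by simp
    then show "x = y" using \<kappa>_iff[OF Zp Zq G] pq by simp
  qed
  \<comment> \<open>The copies of the \<open>B G\<close> in the limit do increase with G: the
    isomorphism from \<open>coh\<close> becomes an inclusion there. A directed union then gives the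
    model.\<close>
  define M where "M = (\<lambda>G. img V (\<phi> G) (B G))"
  have Mm: "M G \<in> models K" if "G \<in> Fpow X" for G
    unfolding M_def by (rule img_model(2)[OF Bm(2)[OF that] \<phi>_inj[OF that]])
  have Ms: "strong K (M F) (M G)" if FG: "F \<subseteq> G" "G \<in> Fpow X" for F G
  proof -
    have F: "F \<in> Fpow X" using sub FG by blast
    obtain g where g: "isomorphism V g (B F) (S (card G) (E G ` F))" "\<forall>A\<subseteq>F. \<forall>q\<in>Q. g (val F (A, q)) = val G (A, q)"
      using coh[OF FG] by (elim exE conjE)
    have st: "strong K (S (card G) (E G ` F)) (B G)" unfolding B_def
      by (rule frame_strong[OF fr image_mono[OF FG(1)] EW[OF subset_refl FG(2)]])
    have gp: "g ` points (B F) = points (S (card G) (E G ` F))" "inj_on g (points (B F))"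
      using isomorphism_points[OF g(1)] by auto
    have inj: "inj_on (\<phi> G) (g ` points (B F))"
      using inj_on_subset[OF \<phi>_inj[OF FG(2)] strong_points[OF st]] gp(1) by simp
    have "img V (\<phi> G) (img V g (B F)) = img V (\<phi> G \<circ> g) (B F)"
      by (rule img_comp[OF Bm(2)[OF F] gp(2) inj])
    also have "\<dots> = M F" unfolding M_def
    proof (rule img_cong[OF Bm(2)[OF F] comp_inj_on[OF gp(2) inj]])
      fix x assume "x \<in> points (B F)"
      then obtain q where q: "q \<in> Q" "x = val F (F, q)" using val_surj[OF _ F] by blast
      then have "g x = val G (F, q)" using g(2) by simp
      then show "(\<phi> G \<circ> g) x = \<phi> F x"
        using \<phi>[OF inZ[OF FG q(1)], of G] \<phi>[OF inZ[OF subset_refl F q(1)], of F] FG F q by simp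
    qed
    finally have "img V (\<phi> G) (S (card G) (E G ` F)) = M F" using isomorphism_eq_img[OF g(1)] by simp
    then show ?thesis using img_strong[OF st \<phi>_inj[OF FG(2)]] unfolding M_def by simp
  qed
  have "\<exists>N. N \<in> models K \<and> (\<forall>F\<in>Fpow X. strong K (M F) N) \<and>
    (\<forall>N'. N' \<in> models K \<longrightarrow> (\<forall>F\<in>Fpow X. strong K (M F) N') \<longrightarrow> strong K N N') \<and>
    points N = (\<Union>F\<in>Fpow X. points (M F))"
    by (rule directed_union[OF X]) (rule Mm Ms, assumption+)+
  then obtain N where N: "N \<in> models K" "\<forall>F\<in>Fpow X. strong K (M F) N" by (elim exE conjE)
  \<comment> \<open>The name \<open>Inl p\<close> at the singleton {x} was reserved in the frames
    for entry p of the tuple at x.\<close>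
  define d where "d = (\<lambda>x p. \<kappa> ({x}, Inl p))"
  have InlQ: "Inl p \<in> Q" if "p \<in> Ind" for p using that by (auto simp: Q_def)
  have d\<phi>: "d x p = \<phi> F (val F ({x}, Inl p))" "val F ({x}, Inl p) \<in> points (B F)" "d x p \<in> points (M F)"
    "val F ({x}, Inl p) = d0 (card F) (E F x) p" "E F x \<in> W (card F)"
    if x: "x \<in> F" "F \<in> Fpow X" "p \<in> Ind" for x F p
  proof -
    have s1: "{x} \<subseteq> F" using x(1) by simp
    show e: "d x p = \<phi> F (val F ({x}, Inl p))"
      unfolding d_def using \<phi>[OF inZ[OF s1 x(2) InlQ[OF x(3)]], of F] s1 x(2) by simp
    show v: "val F ({x}, Inl p) \<in> points (B F)" by (rule val_in[OF s1 x(2) InlQ[OF x(3)]])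
    show "d x p \<in> points (M F)" unfolding M_def e using v by simp
    show w: "E F x \<in> W (card F)" using E(1)[OF x(2)] H(1) x(1) by blast
    show "val F ({x}, Inl p) = d0 (card F) (E F x) p" unfolding val_def using sd w x(3) by simp
  qed
  have dpN: "d x p \<in> points N" if "x \<in> X" "p \<in> Ind" for x p
  proof -
    have x: "{x} \<in> Fpow X" using that(1) by (simp add: Fpow_def)
    then have "strong K (M {x}) N" using N(2) by simp
    then show ?thesis using d\<phi>(3)[of x "{x}" p] x that(2) strong_points by blast
  qed
  have main: "\<exists>N' W d' e. R N' W d' \<and> N' \<in> models K \<and> (\<forall>w\<in>W. \<forall>p\<in>Ind. d' w p \<in> points N') \<and>
      e ` F \<subseteq> W \<and> (\<forall>x\<in>F. \<forall>y\<in>F. lt x y \<longrightarrow> e x < e y) \<and>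
      gtp K (F \<times> Ind) (restrict (\<lambda>(x, p). d x p) (F \<times> Ind)) {} N =
      gtp K (F \<times> Ind) (restrict (\<lambda>(x, p). d' (e x) p) (F \<times> Ind)) {} N'" if F: "F \<in> Fpow X" for F
  proof (intro exI[of _ "Nn (card F)"] exI[of _ "W (card F)"] exI[of _ "d0 (card F)"] exI[of _ "E F"] conjI)
    let ?b = "restrict (\<lambda>(x, p). d0 (card F) (E F x) p) (F \<times> Ind)"
    let ?b' = "restrict (\<lambda>(x, p). d x p) (F \<times> Ind)"
    have b: "?b \<in> F \<times> Ind \<rightarrow>\<^sub>E points (B F)"
    proof (rule restrict_PiE_iff[THEN iffD2], rule ballI)
      fix i assume "i \<in> F \<times> Ind"
      then show "(\<lambda>(x, p). d0 (card F) (E F x) p) i \<in> points (B F)"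
        using d\<phi>(2,4)[OF _ F] by (auto simp: mem_Times_iff split: prod.splits)
    qed
    have b': "?b' \<in> F \<times> Ind \<rightarrow>\<^sub>E points (M F)"
    proof (rule restrict_PiE_iff[THEN iffD2], rule ballI)
      fix i assume "i \<in> F \<times> Ind"
      then show "(\<lambda>(x, p). d x p) i \<in> points (M F)"
        using d\<phi>(3)[OF _ F] by (auto simp: mem_Times_iff split: prod.splits)
    qed
    have MN: "strong K (M F) N" using N(2) F by simp
    have emb: "embedding K (\<phi> F) (B F) (M F)" unfolding M_def
      by (rule iso_embedding[OF Bm(2)[OF F] img_model(1)[OF Bm(2)[OF F] \<phi>_inj[OF F]]])
    have "gtp K (F \<times> Ind) ?b {} (B F) = gtp K (F \<times> Ind) ?b' {} (M F)"
    proof (rule gtp_embedding[OF emb _ b _ b'])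
      fix i assume "i \<in> F \<times> Ind"
      then obtain x p where "i = (x, p)" "x \<in> F" "p \<in> Ind" by blast
      then show "?b' i = \<phi> F (?b i)" using d\<phi>(1,4)[OF _ F] by simp
    qed simp_all
    then show "gtp K (F \<times> Ind) ?b' {} N = gtp K (F \<times> Ind) ?b {} (Nn (card F))"
      using gtp_strong[OF MN _ b'] gtp_strong[OF Bm(1)[OF F] _ b] by simp
    show "R (Nn (card F)) (W (card F)) (d0 (card F))" by (rule R)
    show "Nn (card F) \<in> models K" using fr unfolding frame_def by simp
    show "\<forall>w\<in>W (card F). \<forall>p\<in>Ind. d0 (card F) w p \<in> points (Nn (card F))" by (rule dN)
    show "E F ` F \<subseteq> W (card F)" using E(1)[OF F] H(1) by blast
    show "\<forall>x\<in>F. \<forall>y\<in>F. lt x y \<longrightarrow> E F x < E F y" using E(2)[OF F] by simp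
  qed
  show ?thesis
  proof (intro exI[of _ N] exI[of _ d] conjI)
    show "N \<in> models K" by (rule N(1))
    show "\<forall>x\<in>X. \<forall>p\<in>Ind. d x p \<in> points N" using dpN by simp
  qed (rule ballI, rule main)
qed

end

section \<open>Splitting sequences from instability\<close>

context aec
begin

definition tuples :: "'u \<Rightarrow> 'u set \<Rightarrow> ('u \<times> ('u \<Rightarrow> 'u)) set" where
  "tuples k B = {(\<alpha>, a). \<alpha> < k \<and> cardinal \<alpha> \<and> a \<in> {..<\<alpha>} \<rightarrow>\<^sub>E B}"

text \<open>The type of b over a, expressed as a type of the concatenation over the empty set, so
  that different tuples a can be compared.\<close>

definition ptype :: "'u struct \<Rightarrow> 'u \<Rightarrow> 'u \<Rightarrow> ('u \<Rightarrow> 'u) \<Rightarrow> (unit + 'u, 'u) triple set" where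
  "ptype N \<alpha> b a = gtp K ({()} <+> {..<\<alpha>}) (case_sum (\<lambda>_. b) a) {} N"

text \<open>Agreement of a and a' over B is tested against one element c of B at a time. This is
  coarser than equality of types over B, but it is exactly what the pattern of the c, a, a' asks for
  and what the counting of types records.\<close>

definition nonsplits :: "'u \<Rightarrow> 'u \<Rightarrow> 'u struct \<Rightarrow> 'u set \<Rightarrow> 'u \<Rightarrow> bool" where
  "nonsplits k r N A b \<longleftrightarrow> (\<exists>B\<subseteq>A. |B| \<le>o |{..<r}| \<and>
    (\<forall>\<alpha> a a'. (\<alpha>, a) \<in> tuples k A \<longrightarrow> (\<alpha>, a') \<in> tuples k A \<longrightarrow>
      (\<forall>c\<in>B. ptype N \<alpha> c a = ptype N \<alpha> c a') \<longrightarrow> ptype N \<alpha> b a = ptype N \<alpha> b a'))"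

lemma tuples_mono: "B \<subseteq> B' \<Longrightarrow> tuples k B \<subseteq> tuples k B'"
  unfolding tuples_def using PiE_mono[of _ "\<lambda>_. B" "\<lambda>_. B'"] by blast

lemma case_sum_PiE:
  "b \<in> Y \<Longrightarrow> a \<in> {..<\<alpha>} \<rightarrow>\<^sub>E Y \<Longrightarrow> case_sum (\<lambda>_. b) a \<in> {()} <+> {..<\<alpha>} \<rightarrow>\<^sub>E Y"
  by (auto simp: PiE_iff extensional_def split: sum.splits)

lemma ptype_triple:
  assumes "N \<in> models K" "b \<in> points N" "a \<in> {..<\<alpha>} \<rightarrow>\<^sub>E points N"
  shows "(case_sum (\<lambda>_. b) a, {}, N) \<in> triples K ({()} <+> {..<\<alpha>})"
  using case_sum_PiE[OF assms(2,3)] assms(1) by (intro tripleI) auto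

lemma gtp1_triple:
  "N \<in> models K \<Longrightarrow> b \<in> points N \<Longrightarrow> A \<subseteq> points N \<Longrightarrow> ((\<lambda>_. b), A, N) \<in> triples K {()}"
  by (intro tripleI) (auto simp: PiE_iff extensional_def)

lemma gtp1_restrict:
  assumes "N \<in> models K" "b \<in> points N" "b' \<in> points N" "A0 \<subseteq> A" "A \<subseteq> points N"
    "gtp1 K b A N = gtp1 K b' A N"
  shows "gtp1 K b A0 N = gtp1 K b' A0 N"
  using gtp_restrict_gtp[OF gtp1_triple[OF assms(1,2,5)] assms(4)]
    gtp_restrict_gtp[OF gtp1_triple[OF assms(1,3,5)] assms(4)] assms(6) unfolding gtp1_def by simp

text \<open>At stage i the type of b splits over the earlier c, which gives a and a' that b
  separates and no earlier c does. Then c is chosen in \<open>A\<close> to imitate b over all tuples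
  so far, the new ones included. So c at v separates the tuples at w exactly when w \<le> v.\<close>

lemma splitting_sequence:
  fixes k r :: 'u
  assumes r: "cardinal r" "infinite {..<r}" and kr: "|{..<k}| \<le>o |{..<r}|"
    and A: "A \<subseteq> points N" and split: "\<not> nonsplits k r N A b"
    and sat: "\<And>B. B \<subseteq> A \<Longrightarrow> |B| \<le>o |{..<r}| \<Longrightarrow>
      \<exists>c\<in>A. \<forall>(\<alpha>, a)\<in>tuples k B. ptype N \<alpha> c a = ptype N \<alpha> b a"
  shows "\<exists>\<alpha> W c a a'. \<alpha> < k \<and> cardinal \<alpha> \<and> |{..<r}| <o |W| \<and>
    (\<forall>w\<in>W. c w \<in> points N \<and> a w \<in> {..<\<alpha>} \<rightarrow>\<^sub>E points N \<and> a' w \<in> {..<\<alpha>} \<rightarrow>\<^sub>E points N) \<and>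
    (\<forall>v\<in>W. \<forall>w\<in>W. (ptype N \<alpha> (c v) (a w) = ptype N \<alpha> (c v) (a' w)) = ((v::'u) < w))"
proof -
  let ?R = "{..<r}"
  define al where "al = (\<lambda>z :: 'u \<times> ('u \<Rightarrow> 'u) \<times> ('u \<Rightarrow> 'u) \<times> 'u. fst z)"
  define aa where "aa = (\<lambda>z :: 'u \<times> ('u \<Rightarrow> 'u) \<times> ('u \<Rightarrow> 'u) \<times> 'u. fst (snd z))"
  define bb where "bb = (\<lambda>z :: 'u \<times> ('u \<Rightarrow> 'u) \<times> ('u \<Rightarrow> 'u) \<times> 'u. fst (snd (snd z)))"
  define cc where "cc = (\<lambda>z :: 'u \<times> ('u \<Rightarrow> 'u) \<times> ('u \<Rightarrow> 'u) \<times> 'u. snd (snd (snd z)))"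
  define P where "P = (\<lambda>f (i::'u) z. i < card_succ r \<longrightarrow>
    (al z, aa z) \<in> tuples k A \<and> (al z, bb z) \<in> tuples k A \<and> cc z \<in> A \<and>
    (\<forall>j<i. ptype N (al z) (cc (f j)) (aa z) = ptype N (al z) (cc (f j)) (bb z)) \<and>
    ptype N (al z) b (aa z) \<noteq> ptype N (al z) b (bb z) \<and>
    (\<forall>j<i. ptype N (al (f j)) (cc z) (aa (f j)) = ptype N (al (f j)) b (aa (f j)) \<and>
      ptype N (al (f j)) (cc z) (bb (f j)) = ptype N (al (f j)) b (bb (f j))) \<and>
    ptype N (al z) (cc z) (aa z) = ptype N (al z) b (aa z) \<and>
    ptype N (al z) (cc z) (bb z) = ptype N (al z) b (bb z))"
  have card_ran: "|a ` {..<\<alpha>}| \<le>o |?R|" if "(\<alpha>, a) \<in> tuples k A" for \<alpha> a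
  proof -
    have "\<alpha> < k" using that by (simp add: tuples_def)
    then have "|{..<\<alpha>}| \<le>o |{..<k}|" by (intro card_of_lessThan_mono less_imp_le)
    then show ?thesis using card_of_image_le ordLeq_transitive[OF _ kr] by blast
  qed
  have ran: "a ` {..<\<alpha>} \<subseteq> A" "(\<alpha>, a) \<in> tuples k (a ` {..<\<alpha>})" if "(\<alpha>, a) \<in> tuples k A" for \<alpha> a
    using that by (auto simp: tuples_def PiE_iff)
  have spl: "\<exists>\<alpha> a a'. (\<alpha>, a) \<in> tuples k A \<and> (\<alpha>, a') \<in> tuples k A \<and>
      (\<forall>c\<in>B. ptype N \<alpha> c a = ptype N \<alpha> c a') \<and> ptype N \<alpha> b a \<noteq> ptype N \<alpha> b a'"
    if "B \<subseteq> A" "|B| \<le>o |?R|" for B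
  proof (rule ccontr)
    assume *: "\<not> ?thesis"
    have "nonsplits k r N A b" unfolding nonsplits_def
    proof (intro exI[of _ B] conjI that allI impI)
      fix \<alpha> a a' assume "(\<alpha>, a) \<in> tuples k A" "(\<alpha>, a') \<in> tuples k A" "\<forall>c\<in>B. ptype N \<alpha> c a = ptype N \<alpha> c a'"
      then show "ptype N \<alpha> b a = ptype N \<alpha> b a'" using * by metis
    qed
    then show False using split by simp
  qed
  have "\<exists>f. \<forall>i. P f i (f i)"
  proof (rule dependent_wellorder_choice)
    fix z i and f g :: "'u \<Rightarrow> 'u \<times> ('u \<Rightarrow> 'u) \<times> ('u \<Rightarrow> 'u) \<times> 'u"
    assume "\<And>j. j < i \<Longrightarrow> f j = g j"
    then show "P f i z = P g i z" unfolding P_def by simp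
  next
    fix i and f :: "'u \<Rightarrow> 'u \<times> ('u \<Rightarrow> 'u) \<times> ('u \<Rightarrow> 'u) \<times> 'u"
    assume IH: "\<And>j. j < i \<Longrightarrow> P f j (f j)"
    show "\<exists>z. P f i z"
    proof (cases "i < card_succ r")
      case False
      then show ?thesis by (simp add: P_def)
    next
      case True
      have fj: "(al (f j), aa (f j)) \<in> tuples k A" "(al (f j), bb (f j)) \<in> tuples k A" "cc (f j) \<in> A"
        if "j < i" for j using IH[OF that] that True unfolding P_def by (meson less_trans)+
      have iR: "|{..<i}| \<le>o |?R|" by (rule card_of_below_card_succ[OF True r(1)])
      let ?B = "(\<lambda>j. cc (f j)) ` {..<i}"
      have "?B \<subseteq> A" using fj(3) by auto
      then obtain \<alpha> a a' where a: "(\<alpha>, a) \<in> tuples k A" "(\<alpha>, a') \<in> tuples k A"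
        "\<forall>c\<in>?B. ptype N \<alpha> c a = ptype N \<alpha> c a'" "ptype N \<alpha> b a \<noteq> ptype N \<alpha> b a'"
        using spl[OF _ card_of_image_le[OF iR]] by meson
      \<comment> \<open>The ranges of all tuples chosen up to and including stage i; these are few
        enough for the saturation hypothesis.\<close>
      define B0 where "B0 = (\<Union>j\<in>{..<i}. aa (f j) ` {..<al (f j)} \<union> bb (f j) ` {..<al (f j)}) \<union>
        (a ` {..<\<alpha>} \<union> a' ` {..<\<alpha>})"
      have "|B0| \<le>o |?R|" unfolding B0_def
      proof (rule card_of_Un_le[OF r(2)])
        show "|\<Union>j\<in>{..<i}. aa (f j) ` {..<al (f j)} \<union> bb (f j) ` {..<al (f j)}| \<le>o |?R|"
        proof (rule card_of_UN_le[OF r(2) iR])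
          fix j assume "j \<in> {..<i}"
          then have j: "j < i" by simp
          show "|aa (f j) ` {..<al (f j)} \<union> bb (f j) ` {..<al (f j)}| \<le>o |?R|"
            by (rule card_of_Un_le[OF r(2) card_ran[OF fj(1)[OF j]] card_ran[OF fj(2)[OF j]]])
        qed
        show "|a ` {..<\<alpha>} \<union> a' ` {..<\<alpha>}| \<le>o |?R|"
          by (rule card_of_Un_le[OF r(2) card_ran[OF a(1)] card_ran[OF a(2)]])
      qed
      moreover have "B0 \<subseteq> A" unfolding B0_def
        by (intro Un_least UN_least) (simp_all add: ran(1) fj(1,2) a(1,2))
      ultimately obtain c where c: "c \<in> A" "\<forall>(\<alpha>, a)\<in>tuples k B0. ptype N \<alpha> c a = ptype N \<alpha> b a"
        using sat[of B0] by blast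
      have c': "ptype N \<beta> c e = ptype N \<beta> b e" if "(\<beta>, e) \<in> tuples k A" "e ` {..<\<beta>} \<subseteq> B0" for \<beta> e
        using c(2) tuples_mono[OF that(2)] ran(2)[OF that(1)] by blast
      have "P f i (\<alpha>, a, a', c)" unfolding P_def al_def aa_def bb_def cc_def fst_conv snd_conv
      proof (intro impI conjI allI)
        show "(\<alpha>, a) \<in> tuples k A" "(\<alpha>, a') \<in> tuples k A" "c \<in> A" "ptype N \<alpha> b a \<noteq> ptype N \<alpha> b a'"
          using a c by auto
        show "ptype N \<alpha> c a = ptype N \<alpha> b a" by (rule c'[OF a(1)]) (simp add: B0_def le_supI1 le_supI2)
        show "ptype N \<alpha> c a' = ptype N \<alpha> b a'" by (rule c'[OF a(2)]) (simp add: B0_def le_supI1 le_supI2)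
        fix j assume j: "j < i"
        show "ptype N \<alpha> (snd (snd (snd (f j)))) a = ptype N \<alpha> (snd (snd (snd (f j)))) a'"
          using a(3) j by (simp add: cc_def)
        have s: "aa (f j) ` {..<al (f j)} \<subseteq> B0" "bb (f j) ` {..<al (f j)} \<subseteq> B0" using j unfolding B0_def by blast+
        show "ptype N (fst (f j)) c (fst (snd (f j))) = ptype N (fst (f j)) b (fst (snd (f j)))"
          using c'[OF fj(1)[OF j] s(1)] by (simp add: al_def aa_def)
        show "ptype N (fst (f j)) c (fst (snd (snd (f j)))) = ptype N (fst (f j)) b (fst (snd (snd (f j))))"
          using c'[OF fj(2)[OF j] s(2)] by (simp add: al_def bb_def)
      qed
      then show ?thesis ..
    qed
  qed
  then obtain f where f: "\<And>i. P f i (f i)" by blast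

  have alk: "al (f i) < k" "cardinal (al (f i))" if "i < card_succ r" for i
    using f[of i] that unfolding P_def by (simp_all add: tuples_def)
  \<comment> \<open>The lengths vary with the stage, but there are at most r of them and r^+ stages,
    so one length occurs more than r times.\<close>
  have "(\<lambda>i. al (f i)) ` {..<card_succ r} \<subseteq> {..<k}" using alk by auto
  then obtain \<alpha> where \<alpha>: "\<alpha> \<in> {..<k}" "|?R| <o |{i \<in> {..<card_succ r}. al (f i) = \<alpha>}|"
    using pigeonhole_card[OF r(2) kr card_of_less_card_succ] by metis
  define W where "W = {i \<in> {..<card_succ r}. al (f i) = \<alpha>}"
  have "W \<noteq> {}"
  proof
    assume "W = {}"
    then have "|?R| <o |{} :: 'u set|" using \<alpha>(2)[folded W_def] by (simp only:)
    then show False using card_of_empty not_ordLess_ordLeq by blast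
  qed
  then have "cardinal \<alpha>" using alk(2) by (auto simp: W_def)
  moreover have "cc (f w) \<in> points N \<and> aa (f w) \<in> {..<\<alpha>} \<rightarrow>\<^sub>E points N \<and> bb (f w) \<in> {..<\<alpha>} \<rightarrow>\<^sub>E points N"
    if "w \<in> W" for w
  proof -
    have w: "w < card_succ r" "al (f w) = \<alpha>" using that by (auto simp: W_def)
    have "cc (f w) \<in> A" "(\<alpha>, aa (f w)) \<in> tuples k A" "(\<alpha>, bb (f w)) \<in> tuples k A"
      using f[of w] w unfolding P_def by auto
    moreover have "{..<\<alpha>} \<rightarrow>\<^sub>E A \<subseteq> {..<\<alpha>} \<rightarrow>\<^sub>E points N" using A by (intro PiE_mono)
    ultimately show ?thesis using A unfolding tuples_def by auto
  qed
  moreover have "(ptype N \<alpha> (cc (f v)) (aa (f w)) = ptype N \<alpha> (cc (f v)) (bb (f w))) = (v < w)"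
    if "v \<in> W" "w \<in> W" for v w
  proof -
    have vw: "v < card_succ r" "al (f v) = \<alpha>" "w < card_succ r" "al (f w) = \<alpha>" using that by (auto simp: W_def)
    show ?thesis
    proof (cases "v < w")
      case True
      then show ?thesis using f[of w] vw unfolding P_def by simp
    next
      case False
      have "ptype N \<alpha> (cc (f v)) (aa (f w)) = ptype N \<alpha> b (aa (f w)) \<and>
        ptype N \<alpha> (cc (f v)) (bb (f w)) = ptype N \<alpha> b (bb (f w))"
      proof (cases "v = w")
        case True
        then show ?thesis using f[of w] vw unfolding P_def by simp
      next
        case ne: False
        then have "w < v" using False by order
        then show ?thesis using f[of v] vw unfolding P_def by auto
      qed
      moreover have "ptype N \<alpha> b (aa (f w)) \<noteq> ptype N \<alpha> b (bb (f w))" using f[of w] vw unfolding P_def by simp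
      ultimately show ?thesis using False by simp
    qed
  qed
  ultimately show ?thesis using \<alpha> unfolding W_def[symmetric]
    by (intro exI[of _ \<alpha>] exI[of _ W] exI[of _ "\<lambda>i. cc (f i)"] exI[of _ "\<lambda>i. aa (f i)"] exI[of _ "\<lambda>i. bb (f i)"]) simp
qed

end

section \<open>Counting types that do not split\<close>

context aec_ap
begin

text \<open>The embedding that matches the concatenations fixes every entry of a, hence the range of
  a pointwise. This and its converse below pass between types over a set and types of pairs over the
  empty set.\<close>

lemma ptype_eq_imp_gtp1_eq:
  assumes "N \<in> models K" "b \<in> points N" "b' \<in> points N" "a \<in> {..<\<alpha>} \<rightarrow>\<^sub>E points N"
    "ptype N \<alpha> b a = ptype N \<alpha> b' a"
  shows "gtp1 K b (a ` {..<\<alpha>}) N = gtp1 K b' (a ` {..<\<alpha>}) N"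
proof -
  obtain N' f where N': "strong K N N'" "embedding K f N N'"
    "\<forall>i\<in>{()} <+> {..<\<alpha>}. f (case_sum (\<lambda>_. b') a i) = case_sum (\<lambda>_. b) a i"
    using gtp_eqD[OF assms(5)[unfolded ptype_def] ptype_triple[OF assms(1,2,4)] ptype_triple[OF assms(1,3,4)]] by blast
  have f: "f b' = b" using N'(3)[rule_format, of "Inl ()"] by (simp add: InlI)
  have fa: "f (a i) = a i" if "i < \<alpha>" for i using N'(3)[rule_format, of "Inr i"] that by (simp add: InrI)
  have sub: "a ` {..<\<alpha>} \<subseteq> points N" using assms(4) by auto
  show ?thesis unfolding gtp1_def
    by (rule gtp_eqI_embedding[OF gtp1_triple[OF assms(1,2) sub] gtp1_triple[OF assms(1,3) sub]
        strong_embedding[OF N'(1)] N'(2)]) (use f fa in auto)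
qed

lemma gtp1_eq_imp_ptype_eq:
  assumes "N \<in> models K" "b \<in> points N" "b' \<in> points N" "A \<subseteq> points N" "a \<in> {..<\<alpha>} \<rightarrow>\<^sub>E A"
    "gtp1 K b A N = gtp1 K b' A N"
  shows "ptype N \<alpha> b a = ptype N \<alpha> b' a"
proof -
  obtain N' f where N': "strong K N N'" "embedding K f N N'" "\<forall>x\<in>A. f x = x" "f b' = b"
    using gtp_eqD[OF assms(6)[unfolded gtp1_def] gtp1_triple[OF assms(1,2,4)] gtp1_triple[OF assms(1,3,4)]] by auto
  have a: "a \<in> {..<\<alpha>} \<rightarrow>\<^sub>E points N" using assms(4,5) by (auto simp: PiE_iff)
  show ?thesis unfolding ptype_def
  proof (rule gtp_eqI_embedding[OF ptype_triple[OF assms(1,2) a] ptype_triple[OF assms(1,3) a]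
        strong_embedding[OF N'(1)] N'(2)])
    fix i assume "i \<in> {()} <+> {..<\<alpha>}"
    then show "case_sum (\<lambda>_. b) a i = f (case_sum (\<lambda>_. b') a i)"
      using N'(3,4) assms(5) by (cases i) (auto simp: PiE_iff)
  qed auto
qed

lemma card_of_ptypes_le:
  fixes k r \<chi> :: 'u
  assumes N: "N \<in> models K" and \<chi>: "|{..<LS K}| \<le>o |{..<\<chi>}|" "\<And>x. x < k \<Longrightarrow> |{..<x}| \<le>o |{..<\<chi>}|"
    and r: "infinite {..<r}" "|Pow {..<\<chi>}| \<le>o |{..<r}|" "|{..<k}| \<le>o |{..<r}|"
  shows "|\<Union>\<alpha>\<in>{..<k}. {ptype N \<alpha> c a | c a. c \<in> points N \<and> a \<in> {..<\<alpha>} \<rightarrow>\<^sub>E points N}| \<le>o |{..<r}|"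
proof (rule card_of_UN_le[OF r(1,3)])
  fix \<alpha> assume "\<alpha> \<in> {..<k}"
  have inf: "infinite {..<\<chi>}" using infinite_card_of_le[OF infinite_LS \<chi>(1)] .
  let ?I = "{()} <+> {..<\<alpha>}"
  have "|{..<\<alpha>}| \<le>o |{..<\<chi>}|" using \<chi>(2) \<open>\<alpha> \<in> {..<k}\<close> by simp
  then have "|?I| \<le>o |{..<\<chi>}|" by (intro card_of_Plus_le inf card_of_finite_le[OF inf, of "{()}"]) simp_all
  then have "|{gtp K ?I b {} N | b N. (b, {}, N) \<in> triples K ?I}| \<le>o |Pow {..<\<chi>}|"
    by (intro card_of_types_le \<chi>(1) card_of_empty)
  then have "|{gtp K ?I b {} N | b N. (b, {}, N) \<in> triples K ?I}| \<le>o |{..<r}|"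
    by (rule ordLeq_transitive[OF _ r(2)])
  moreover have "{ptype N \<alpha> c a | c a. c \<in> points N \<and> a \<in> {..<\<alpha>} \<rightarrow>\<^sub>E points N} \<subseteq>
      {gtp K ?I b {} N | b N. (b, {}, N) \<in> triples K ?I}"
    unfolding ptype_def using ptype_triple[OF N] by blast
  ultimately show "|{ptype N \<alpha> c a | c a. c \<in> points N \<and> a \<in> {..<\<alpha>} \<rightarrow>\<^sub>E points N}| \<le>o |{..<r}|"
    by (rule card_of_subset_le[rotated])
qed

text \<open>A type that does not split over B is determined by B together with a function: it sends
  the profile of a tuple, that is its types with the members of B, to its type with b. There are at
  most |L|^r choices of B and 2^(2^r) such functions for each. By tameness the types with all tuples
  of length below k determine the type over the model.\<close>

lemma nonsplitting_count:
  fixes k r \<chi> :: 'u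
  assumes k: "infinite_cardinal k" "tame_below K k"
    and \<chi>: "|{..<LS K}| \<le>o |{..<\<chi>}|" "\<And>x. x < k \<Longrightarrow> |{..<x}| \<le>o |{..<\<chi>}|"
    and r: "infinite {..<r}" "|Pow {..<\<chi>}| \<le>o |{..<r}|" "|{..<k}| \<le>o |{..<r}|"
    and L: "|Pow (Pow {..<r})| \<le>o |L|" "|{..<r} \<rightarrow>\<^sub>E L| \<le>o |L|"
    and P: "strong K P N" "|points P| \<le>o |L|"
    and ns: "\<And>b. b \<in> points N \<Longrightarrow> nonsplits k r N (points P) b"
  shows "|(\<lambda>b. gtp1 K b (points P) N) ` points N| \<le>o |L|"
proof -
  let ?R = "{..<r}" and ?A = "points P"
  have infL: "infinite L" using infinite_card_of_le[OF _ L(1)] r(1) by simp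
  have N: "N \<in> models K" "?A \<subseteq> points N" using strong_models[OF P(1)] strong_points[OF P(1)] by auto
  define Typ where "Typ = (\<Union>\<alpha>\<in>{..<k}. {ptype N \<alpha> c a | c a. c \<in> points N \<and> a \<in> {..<\<alpha>} \<rightarrow>\<^sub>E points N})"
  have Typ: "|Typ| \<le>o |?R|" unfolding Typ_def by (rule card_of_ptypes_le[OF N(1) \<chi> r])
  have tA: "\<alpha> < k \<and> cardinal \<alpha> \<and> a \<in> {..<\<alpha>} \<rightarrow>\<^sub>E points N" if "(\<alpha>, a) \<in> tuples k ?A" for \<alpha> a
    using that N(2) by (auto simp: tuples_def PiE_iff)
  have inTyp: "ptype N \<alpha> c a \<in> Typ" if "(\<alpha>, a) \<in> tuples k ?A" "c \<in> points N" for \<alpha> a c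
    unfolding Typ_def using tA[OF that(1)] that(2) by blast
  have "\<forall>b\<in>points N. \<exists>B. B \<subseteq> ?A \<and> |B| \<le>o |?R| \<and>
    (\<forall>\<alpha> a a'. (\<alpha>, a) \<in> tuples k ?A \<longrightarrow> (\<alpha>, a') \<in> tuples k ?A \<longrightarrow>
      (\<forall>c\<in>B. ptype N \<alpha> c a = ptype N \<alpha> c a') \<longrightarrow> ptype N \<alpha> b a = ptype N \<alpha> b a')"
    using ns unfolding nonsplits_def by (rule ballI)
  from bchoice[OF this] obtain Bf where Bf: "\<forall>b\<in>points N. Bf b \<subseteq> ?A \<and> |Bf b| \<le>o |?R| \<and>
    (\<forall>\<alpha> a a'. (\<alpha>, a) \<in> tuples k ?A \<longrightarrow> (\<alpha>, a') \<in> tuples k ?A \<longrightarrow>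
      (\<forall>c\<in>Bf b. ptype N \<alpha> c a = ptype N \<alpha> c a') \<longrightarrow> ptype N \<alpha> b a = ptype N \<alpha> b a')" by (elim exE)
  \<comment> \<open>The second component is the graph of that function with the length of the tuple
    added; it is single-valued since b does not split over \<open>Bf b\<close>.\<close>
  define key where "key = (\<lambda>b. (Bf b, (\<lambda>(\<alpha>, a). (\<alpha>, restrict (\<lambda>c. ptype N \<alpha> c a) (Bf b), ptype N \<alpha> b a)) ` tuples k ?A))"
  show ?thesis
  proof (rule card_of_le_if_factors[of "points N" key])
    let ?S = "SIGMA B:{B. B \<subseteq> ?A \<and> |B| \<le>o |?R|}. Pow ({..<k} \<times> ((B \<rightarrow>\<^sub>E Typ) \<times> Typ))"
    have "|?S| \<le>o |L|"
    proof (rule card_of_Sigma_ordLeq_infinite[OF infL card_of_subsets_le[OF L(2) P(2) infL]], rule ballI)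
      fix B assume "B \<in> {B. B \<subseteq> ?A \<and> |B| \<le>o |?R|}"
      then have B: "|B| \<le>o |?R|" by simp
      have RP: "|?R| \<le>o |Pow ?R|" by (rule card_of_le_Pow)
      have "infinite (Pow ?R)" using r(1) by simp
      then have "|{..<k} \<times> ((B \<rightarrow>\<^sub>E Typ) \<times> Typ)| \<le>o |Pow ?R|"
        by (intro card_of_Times_le ordLeq_transitive[OF r(3) RP] ordLeq_transitive[OF Typ RP]
            card_of_PiE_le_Pow r(1) B)
      then have "|Pow ({..<k} \<times> ((B \<rightarrow>\<^sub>E Typ) \<times> Typ))| \<le>o |Pow (Pow ?R)|" by (rule card_of_Pow_mono)
      then show "|Pow ({..<k} \<times> ((B \<rightarrow>\<^sub>E Typ) \<times> Typ))| \<le>o |L|" by (rule ordLeq_transitive[OF _ L(1)])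
    qed
    moreover have "key ` points N \<subseteq> ?S"
    proof (rule image_subsetI)
      fix b assume b: "b \<in> points N"
      have B: "Bf b \<subseteq> ?A" "|Bf b| \<le>o |?R|" using Bf b by auto
      have "(\<lambda>(\<alpha>, a). (\<alpha>, restrict (\<lambda>c. ptype N \<alpha> c a) (Bf b), ptype N \<alpha> b a)) ` tuples k ?A
        \<subseteq> {..<k} \<times> ((Bf b \<rightarrow>\<^sub>E Typ) \<times> Typ)"
      proof (rule image_subsetI)
        fix z assume z: "z \<in> tuples k ?A"
        obtain \<alpha> a where za: "z = (\<alpha>, a)" by (cases z)
        have t: "(\<alpha>, a) \<in> tuples k ?A" using z za by simp
        have "restrict (\<lambda>c. ptype N \<alpha> c a) (Bf b) \<in> Bf b \<rightarrow>\<^sub>E Typ"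
          using inTyp[OF t] B(1) N(2) by auto
        then show "(\<lambda>(\<alpha>, a). (\<alpha>, restrict (\<lambda>c. ptype N \<alpha> c a) (Bf b), ptype N \<alpha> b a)) z
          \<in> {..<k} \<times> ((Bf b \<rightarrow>\<^sub>E Typ) \<times> Typ)"
          unfolding za case_prod_conv using tA[OF t] inTyp[OF t b] by (intro SigmaI) simp_all
      qed
      then show "key b \<in> ?S" unfolding key_def using B by simp
    qed
    ultimately show "|key ` points N| \<le>o |L|" by (rule card_of_subset_le[rotated])
  next
    fix b b' assume b: "b \<in> points N" "b' \<in> points N" and eq: "key b = key b'"
    have eqB: "Bf b = Bf b'" using eq by (simp add: key_def)
    have same: "ptype N \<alpha> b a = ptype N \<alpha> b' a" if t: "(\<alpha>, a) \<in> tuples k ?A" for \<alpha> a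
    proof -
      \<comment> \<open>Equality of keys only gives some tuple a' with the profile of a whose type
        with b' equals the type of a with b; non-splitting of b' then replaces a' by a.\<close>
      have "(\<alpha>, restrict (\<lambda>c. ptype N \<alpha> c a) (Bf b), ptype N \<alpha> b a) \<in> snd (key b)"
        unfolding key_def using t by (auto intro!: image_eqI[of _ _ "(\<alpha>, a)"])
      then have "(\<alpha>, restrict (\<lambda>c. ptype N \<alpha> c a) (Bf b), ptype N \<alpha> b a) \<in> snd (key b')" using eq by simp
      then obtain a' where a': "(\<alpha>, a') \<in> tuples k ?A" "ptype N \<alpha> b a = ptype N \<alpha> b' a'"
        "restrict (\<lambda>c. ptype N \<alpha> c a) (Bf b) = restrict (\<lambda>c. ptype N \<alpha> c a') (Bf b')"
        unfolding key_def by auto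
      have cs: "\<forall>c\<in>Bf b'. ptype N \<alpha> c a = ptype N \<alpha> c a'"
      proof
        fix c assume "c \<in> Bf b'"
        then show "ptype N \<alpha> c a = ptype N \<alpha> c a'" using fun_cong[OF a'(3), of c] eqB by simp
      qed
      have "ptype N \<alpha> b' a = ptype N \<alpha> b' a'"
        by (rule conjunct2[OF conjunct2[OF bspec[OF Bf b(2)]],
            THEN spec, THEN spec, THEN spec, THEN mp, THEN mp, THEN mp, OF t a'(1) cs])
      then show ?thesis using a'(2) by simp
    qed
    show "gtp1 K b ?A N = gtp1 K b' ?A N"
    proof (rule ccontr)
      assume ne: "gtp1 K b ?A N \<noteq> gtp1 K b' ?A N"
      have "gtp1 K b ?A N \<in> gS K P" "gtp1 K b' ?A N \<in> gS K P" using P(1) b unfolding gS_def by blast+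
      moreover have "P \<in> models K" using strong_models[OF P(1)] by simp
      ultimately obtain A0 where A0: "A0 \<subseteq> ?A" "|A0| <o |{..<k}|"
        "gtp_restrict K {()} (gtp1 K b ?A N) A0 \<noteq> gtp_restrict K {()} (gtp1 K b' ?A N) A0"
        using k(2) ne unfolding tame_below_def by meson
      have ne0: "gtp1 K b A0 N \<noteq> gtp1 K b' A0 N"
        using A0(3) gtp_restrict_gtp[OF gtp1_triple[OF N(1) b(1) N(2)] A0(1)]
          gtp_restrict_gtp[OF gtp1_triple[OF N(1) b(2) N(2)] A0(1)] unfolding gtp1_def by simp
      define \<alpha> where "\<alpha> = (cardinality A0 :: 'u)"
      have A0U: "|A0| <o |UNIV :: 'u set|" by (rule le_ordinal_less_universe[OF ordLess_imp_ordLeq[OF A0(2)]])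
      note c = card_of_cardinality[OF A0U \<alpha>_def] cardinal_cardinality[OF A0U \<alpha>_def]
      have "|{..<\<alpha>}| <o |{..<k}|" using ordIso_ordLess_trans[OF c(1) A0(2)] .
      then have \<alpha>k: "\<alpha> < k" using cardinal_less_iff[OF c(2)] k(1) by (simp add: infinite_cardinal_def)
      obtain a where a: "bij_betw a {..<\<alpha>} A0" using c(1) card_of_ordIso by blast
      let ?a = "restrict a {..<\<alpha>}"
      have im: "?a ` {..<\<alpha>} = A0" using a by (simp add: bij_betw_def)
      have t: "(\<alpha>, ?a) \<in> tuples k ?A" using \<alpha>k c(2) im A0(1) by (auto simp: tuples_def)
      have "gtp1 K b (?a ` {..<\<alpha>}) N = gtp1 K b' (?a ` {..<\<alpha>}) N"
        using ptype_eq_imp_gtp1_eq[OF N(1) b _ same[OF t]] tA[OF t] by simp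
      then show False using ne0 im by simp
    qed
  qed
qed

text \<open>Saturation is relative to N: over sets of size r the submodel realizes the profiles that
  N realizes. No saturated model has to exist for this; a subset of N is closed off, and it is
  closed under a family of submodels as well, so that it is itself the set of points of a
  model.\<close>

lemma saturated_submodel:
  fixes k r \<chi> :: 'u
  assumes r: "cardinal r" "infinite {..<r}" "|Pow {..<\<chi>}| \<le>o |{..<r}|" "|{..<k}| \<le>o |{..<r}|"
    and \<chi>: "|{..<LS K}| \<le>o |{..<\<chi>}|" "\<And>x. x < k \<Longrightarrow> |{..<x}| \<le>o |{..<\<chi>}|"
    and L: "|Pow (Pow {..<r})| \<le>o |L|" "|{..<r} \<rightarrow>\<^sub>E L| \<le>o |L|"
    and N: "N \<in> models K" "A \<subseteq> points N" "|A| \<le>o |L|"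
  shows "\<exists>P. strong K P N \<and> A \<subseteq> points P \<and> |points P| \<le>o |L| \<and>
    (\<forall>b\<in>points N. \<forall>B. B \<subseteq> points P \<longrightarrow> |B| \<le>o |{..<r}| \<longrightarrow>
      (\<exists>c\<in>points P. \<forall>(\<alpha>, a)\<in>tuples k B. ptype N \<alpha> c a = ptype N \<alpha> b a))"
proof -
  let ?R = "{..<r}"
  have infL: "infinite L" using infinite_card_of_le[OF _ L(1)] r(2) by simp
  have RP: "|?R| \<le>o |Pow ?R|" by (rule card_of_le_Pow)
  have PL: "|Pow ?R| \<le>o |L|" by (rule ordLeq_transitive[OF card_of_le_Pow L(1)])
  have RL: "|?R| \<le>o |L|" by (rule ordLeq_transitive[OF RP PL])
  have \<chi>R: "|{..<\<chi>}| \<le>o |?R|" by (rule ordLeq_transitive[OF card_of_le_Pow r(3)])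
  have LSL: "|{..<LS K}| \<le>o |L|" by (rule ordLeq_transitive[OF \<chi>(1) ordLeq_transitive[OF \<chi>R RL]])
  define Typ where "Typ = (\<Union>\<alpha>\<in>{..<k}. {ptype N \<alpha> c a | c a. c \<in> points N \<and> a \<in> {..<\<alpha>} \<rightarrow>\<^sub>E points N})"
  have Typ: "|Typ| \<le>o |?R|" unfolding Typ_def by (rule card_of_ptypes_le[OF N(1) \<chi> r(2-4)])
  have "\<exists>S. \<forall>F\<in>Fpow (points N). strong K (S F) N \<and> (\<forall>x\<in>F. {x} \<subseteq> points (S F)) \<and>
    (\<forall>G\<subseteq>F. points (S G) \<subseteq> points (S F)) \<and> |points (S F)| \<le>o |L|"
  proof (rule submodel_family[OF N(1) _ LSL])
    fix x assume "x \<in> points N"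
    then show "{x} \<subseteq> points N \<and> |{x}| \<le>o |L|" using card_of_finite_le[OF infL, of "{x}"] by simp
  qed
  then obtain S where S: "\<forall>F\<in>Fpow (points N). strong K (S F) N \<and> (\<forall>x\<in>F. {x} \<subseteq> points (S F)) \<and>
    (\<forall>G\<subseteq>F. points (S G) \<subseteq> points (S F)) \<and> |points (S F)| \<le>o |L|" by (elim exE)
  define T where "T = (\<lambda>B y. restrict (\<lambda>(\<alpha>, a). ptype N \<alpha> y a) (tuples k B))"
  define pick where "pick = (\<lambda>B t. SOME y. y \<in> points N \<and> T B y = t)"
  \<comment> \<open>The first half realizes profiles over B. The second half, for finite B only,
    makes the closed set a directed union of submodels.\<close>
  define \<Phi> where "\<Phi> = (\<lambda>B. pick B ` (T B ` points N) \<union> (if finite B then points (S B) else {}))"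
  have pick: "pick B (T B y) \<in> points N \<and> T B (pick B (T B y)) = T B y" if "y \<in> points N" for B y
    unfolding pick_def by (rule someI[of _ y]) (use that in simp)
  have \<Phi>: "\<Phi> B \<subseteq> points N \<and> |\<Phi> B| \<le>o |L|" if B: "B \<subseteq> points N" "|B| \<le>o |?R|" for B
  proof -
    have tup: "|tuples k B| \<le>o |Pow ?R|"
    proof -
      have "tuples k B \<subseteq> (\<Union>\<alpha>\<in>{..<k}. {\<alpha>} \<times> ({..<\<alpha>} \<rightarrow>\<^sub>E B))" by (auto simp: tuples_def)
      moreover have "|\<Union>\<alpha>\<in>{..<k}. {\<alpha>} \<times> ({..<\<alpha>} \<rightarrow>\<^sub>E B)| \<le>o |Pow ?R|"
      proof (intro card_of_UN_le ordLeq_transitive[OF r(4) RP] card_of_Times_le card_of_PiE_le_Pow r(2))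
        show "infinite (Pow ?R)" "infinite (Pow ?R)" using r(2) by simp_all
        show "|{\<alpha>}| \<le>o |Pow ?R|" for \<alpha> :: 'u by (rule card_of_finite_le) (use r(2) in simp_all)
        show "|{..<\<alpha>}| \<le>o |?R|" if "\<alpha> \<in> {..<k}" for \<alpha>
          using ordLeq_transitive[OF \<chi>(2) \<chi>R] that by simp
        show "|B| \<le>o |Pow ?R|" by (rule ordLeq_transitive[OF B(2) RP])
      qed
      ultimately show ?thesis by (rule card_of_subset_le)
    qed
    have "T B ` points N \<subseteq> tuples k B \<rightarrow>\<^sub>E Typ"
    proof (rule image_subsetI)
      fix y assume y: "y \<in> points N"
      have "ptype N \<alpha> y a \<in> Typ" if "(\<alpha>, a) \<in> tuples k B" for \<alpha> a
      proof -
        have "\<alpha> \<in> {..<k}" "a \<in> {..<\<alpha>} \<rightarrow>\<^sub>E points N" using that B(1) by (auto simp: tuples_def PiE_iff)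
        then show ?thesis unfolding Typ_def using y by blast
      qed
      then show "T B y \<in> tuples k B \<rightarrow>\<^sub>E Typ" unfolding T_def by auto
    qed
    \<comment> \<open>At most 2^r tuples over B and at most r types leave 2^(2^r) profiles, which is
      why |L| has to reach that size.\<close>
    moreover have "|tuples k B \<rightarrow>\<^sub>E Typ| \<le>o |Pow (Pow ?R)|"
      using r(2) by (intro card_of_PiE_le_Pow tup ordLeq_transitive[OF Typ ordLeq_transitive[OF RP card_of_le_Pow]]) simp
    ultimately have "|T B ` points N| \<le>o |L|"
      using card_of_subset_le ordLeq_transitive[OF _ L(1)] by blast
    then have 1: "|pick B ` (T B ` points N)| \<le>o |L|" by (rule card_of_image_le)
    have 2: "points (S B) \<subseteq> points N \<and> |points (S B)| \<le>o |L|" if "finite B"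
    proof -
      have "B \<in> Fpow (points N)" using that B(1) by (simp add: Fpow_def)
      from bspec[OF S this] show ?thesis using strong_points[of "S B" N] by simp
    qed
    have "pick B ` (T B ` points N) \<subseteq> points N" using pick by auto
    moreover have "|\<Phi> B| \<le>o |L|" unfolding \<Phi>_def
      by (rule card_of_Un_le[OF infL 1]) (cases "finite B"; simp add: 2 card_of_empty)
    ultimately show ?thesis using 2 unfolding \<Phi>_def by simp
  qed
  have "\<exists>A'. A \<subseteq> A' \<and> A' \<subseteq> points N \<and> |A'| \<le>o |L| \<and> (\<forall>B. B \<subseteq> A' \<longrightarrow> |B| \<le>o |?R| \<longrightarrow> \<Phi> B \<subseteq> A')"
    by (rule closed_set_exists[OF r(1,2) PL L(2) N(2,3) \<Phi>])
  then obtain A' where A': "A \<subseteq> A'" "A' \<subseteq> points N" "|A'| \<le>o |L|"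
    "\<forall>B. B \<subseteq> A' \<longrightarrow> |B| \<le>o |?R| \<longrightarrow> \<Phi> B \<subseteq> A'" by (elim exE conjE)
  have FN: "F \<in> Fpow (points N)" if "F \<in> Fpow A'" for F using that A'(2) by (auto simp: Fpow_def)
  have S': "strong K (S F) N" "\<And>G. G \<subseteq> F \<Longrightarrow> points (S G) \<subseteq> points (S F)" "F \<subseteq> points (S F)" if "F \<in> Fpow A'" for F
    using bspec[OF S FN[OF that]] by auto
  have "\<exists>P. P \<in> models K \<and> (\<forall>F\<in>Fpow A'. strong K (S F) P) \<and>
    (\<forall>N'. N' \<in> models K \<longrightarrow> (\<forall>F\<in>Fpow A'. strong K (S F) N') \<longrightarrow> strong K P N') \<and>
    points P = (\<Union>F\<in>Fpow A'. points (S F))"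
  proof (rule directed_union)
    show "|A'| <o |UNIV :: 'u set|"
      by (rule ordLeq_ordLess_trans[OF card_of_mono1[OF A'(2)] model_points_less[OF N(1)]])
    show "S F \<in> models K" if "F \<in> Fpow A'" for F using S'(1)[OF that] strong_models by blast
    show "strong K (S F) (S G)" if FG: "F \<subseteq> G" "G \<in> Fpow A'" for F G
    proof -
      have "F \<in> Fpow A'" using FG finite_subset by (auto simp: Fpow_def)
      then show ?thesis using strong_if_subset[OF S'(1) S'(1)[OF FG(2)] S'(2)[OF FG(2) FG(1)]] by blast
    qed
  qed
  then obtain P where P: "\<forall>N'. N' \<in> models K \<longrightarrow> (\<forall>F\<in>Fpow A'. strong K (S F) N') \<longrightarrow> strong K P N'"
    "points P = (\<Union>F\<in>Fpow A'. points (S F))" by (elim exE conjE)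
  have PN: "strong K P N" using P(1) N(1) S'(1) by simp
  have "points P = A'"
  proof
    show "points P \<subseteq> A'" unfolding P(2)
    proof (rule UN_least)
      fix F assume F: "F \<in> Fpow A'"
      then have "finite F" "F \<subseteq> A'" by (auto simp: Fpow_def)
      then have "\<Phi> F \<subseteq> A'" using A'(4) card_of_finite_le[OF r(2)] by blast
      then show "points (S F) \<subseteq> A'" using \<open>finite F\<close> unfolding \<Phi>_def by simp
    qed
    show "A' \<subseteq> points P"
    proof
      fix x assume "x \<in> A'"
      then have x: "{x} \<in> Fpow A'" by (simp add: Fpow_def)
      then have "x \<in> points (S {x})" using S'(3) by blast
      then show "x \<in> points P" unfolding P(2) using x by blast
    qed
  qed
  moreover have "\<exists>c\<in>A'. \<forall>(\<alpha>, a)\<in>tuples k B. ptype N \<alpha> c a = ptype N \<alpha> b a"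
    if b: "b \<in> points N" and B: "B \<subseteq> A'" "|B| \<le>o |?R|" for b B
  proof (rule bexI[of _ "pick B (T B b)"])
    have "\<Phi> B \<subseteq> A'" using A'(4) B by blast
    then show "pick B (T B b) \<in> A'" unfolding \<Phi>_def using b by auto
    have eq: "T B (pick B (T B b)) = T B b" using pick[OF b] by blast
    show "\<forall>(\<alpha>, a)\<in>tuples k B. ptype N \<alpha> (pick B (T B b)) a = ptype N \<alpha> b a"
    proof (rule ballI, rule case_prodI2)
      fix z \<alpha> a assume "z \<in> tuples k B" "z = (\<alpha>, a)"
      then show "ptype N \<alpha> (pick B (T B b)) a = ptype N \<alpha> b a" using fun_cong[OF eq, of z] unfolding T_def by simp
    qed
  qed
  ultimately show ?thesis using PN A' by (intro exI[of _ P]) simp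
qed

lemma unstable_imp_splitting_sequence:
  fixes k r \<chi> l :: 'u
  assumes k: "infinite_cardinal k" "tame_below K k"
    and \<chi>: "|{..<LS K}| \<le>o |{..<\<chi>}|" "\<And>x. x < k \<Longrightarrow> |{..<x}| \<le>o |{..<\<chi>}|"
    and r: "cardinal r" "infinite {..<r}" "|Pow {..<\<chi>}| \<le>o |{..<r}|" "|{..<k}| \<le>o |{..<r}|"
    and L: "|Pow (Pow {..<r})| \<le>o |{..<l}|" "|{..<r} \<rightarrow>\<^sub>E {..<l}| \<le>o |{..<l}|"
    and unstable: "\<not> stable_in K l"
  shows "\<exists>N \<alpha> W c a a'. N \<in> models K \<and> \<alpha> < k \<and> cardinal \<alpha> \<and> |{..<r}| <o |W| \<and>
    (\<forall>w\<in>W. c w \<in> points N \<and> a w \<in> {..<\<alpha>} \<rightarrow>\<^sub>E points N \<and> a' w \<in> {..<\<alpha>} \<rightarrow>\<^sub>E points N) \<and>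
    (\<forall>v\<in>W. \<forall>w\<in>W. (ptype N \<alpha> (c v) (a w) = ptype N \<alpha> (c v) (a' w)) = ((v::'u) < w))"
proof -
  obtain N A where N: "N \<in> models K" "A \<subseteq> points N" "|A| \<le>o |{..<l}|"
    and un: "\<not> |{gtp1 K b A N | b. b \<in> points N}| \<le>o |{..<l}|"
    using unstable unfolding stable_in_def by blast
  have "\<exists>P. strong K P N \<and> A \<subseteq> points P \<and> |points P| \<le>o |{..<l}| \<and>
    (\<forall>b\<in>points N. \<forall>B. B \<subseteq> points P \<longrightarrow> |B| \<le>o |{..<r}| \<longrightarrow>
      (\<exists>c\<in>points P. \<forall>(\<alpha>, a)\<in>tuples k B. ptype N \<alpha> c a = ptype N \<alpha> b a))"
    by (rule saturated_submodel[OF r \<chi>(1) _ L N]) (rule \<chi>(2))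
  then obtain P where P: "strong K P N" "A \<subseteq> points P" "|points P| \<le>o |{..<l}|"
    "\<forall>b\<in>points N. \<forall>B. B \<subseteq> points P \<longrightarrow> |B| \<le>o |{..<r}| \<longrightarrow>
      (\<exists>c\<in>points P. \<forall>(\<alpha>, a)\<in>tuples k B. ptype N \<alpha> c a = ptype N \<alpha> b a)"
    by (elim exE conjE)
  have "\<exists>b\<in>points N. \<not> nonsplits k r N (points P) b"
  proof (rule ccontr)
    assume "\<not> ?thesis"
    then have ns: "\<And>b. b \<in> points N \<Longrightarrow> nonsplits k r N (points P) b" by blast
    have "|(\<lambda>b. gtp1 K b (points P) N) ` points N| \<le>o |{..<l}|"
      by (rule nonsplitting_count[OF k \<chi> r(2-4) L P(1,3) ns])
    \<comment> \<open>Types over the larger set P determine the types over A, so A has no more of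
      them.\<close>
    then have "|(\<lambda>b. gtp1 K b A N) ` points N| \<le>o |{..<l}|"
      by (rule card_of_le_if_factors[rotated])
        (rule gtp1_restrict[OF N(1) _ _ P(2) strong_points[OF P(1)]])
    moreover have "(\<lambda>b. gtp1 K b A N) ` points N = {gtp1 K b A N | b. b \<in> points N}" by auto
    ultimately show False using un by simp
  qed
  then obtain b where b: "b \<in> points N" "\<not> nonsplits k r N (points P) b" by blast
  have "\<exists>\<alpha> W c a a'. \<alpha> < k \<and> cardinal \<alpha> \<and> |{..<r}| <o |W| \<and>
    (\<forall>w\<in>W. c w \<in> points N \<and> a w \<in> {..<\<alpha>} \<rightarrow>\<^sub>E points N \<and> a' w \<in> {..<\<alpha>} \<rightarrow>\<^sub>E points N) \<and>
    (\<forall>v\<in>W. \<forall>w\<in>W. (ptype N \<alpha> (c v) (a w) = ptype N \<alpha> (c v) (a' w)) = ((v::'u) < w))"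
    by (rule splitting_sequence[OF r(1,2,4) strong_points[OF P(1)] b(2)]) (use P(4) b(1) in simp)
  then show ?thesis using N(1) by (intro exI[of _ N]) simp
qed

end

section \<open>Stability for longer types\<close>

context aec
begin

text \<open>A uniform upper bound of M and a chain above it: the base at zero, the last member at a
  successor, the union at a limit. Recursions on chains then need no distinction of cases.\<close>

definition lub :: "'u struct \<Rightarrow> 'u \<Rightarrow> ('u \<Rightarrow> 'u struct) \<Rightarrow> 'u struct" where
  "lub M i f = (if is_zero i then M else if \<exists>j. i = osucc j then f (THE j. i = osucc j) else chain_union i f)"

lemma lub_zero: "is_zero i \<Longrightarrow> lub M i f = M"
  by (simp add: lub_def)

lemma lub_osucc: "lub M (osucc j) f = f j"
proof -
  have "\<not> is_zero (osucc j)" using less_osucc[of j] unfolding is_zero_def by blast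
  then show ?thesis by (simp add: lub_def)
qed

lemma lub_limit: "limit_ordinal i \<Longrightarrow> lub M i f = chain_union i f"
  by (auto simp: lub_def limit_ordinal_def succ_of_iff)

lemma lub_cong: "(\<And>j. j < i \<Longrightarrow> f j = g j) \<Longrightarrow> lub M i f = lub M i g"
proof (cases i rule: ordinal_cases)
  case limit
  assume eq: "\<And>j. j < i \<Longrightarrow> f j = g j"
  have *: "(LEAST j. j < i \<and> set xs \<subseteq> points (f j)) = (LEAST j. j < i \<and> set xs \<subseteq> points (g j))" for xs
    using eq by metis
  have L: "f (LEAST j. j < i \<and> set xs \<subseteq> points (g j)) = g (LEAST j. j < i \<and> set xs \<subseteq> points (g j))"
    if "\<exists>j<i. set xs \<subseteq> points (g j)" for xs
    using eq LeastI_ex[OF that] by blast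
  have ex: "(\<exists>j<i. set xs \<subseteq> points (f j)) \<longleftrightarrow> (\<exists>j<i. set xs \<subseteq> points (g j))" for xs
    using eq by (metis (lifting))
  have "chain_union i f = chain_union i g"
  proof (rule struct.equality)
    show "fun_int (chain_union i f) = fun_int (chain_union i g)"
    proof (intro ext)
      fix s xs
      show "fun_int (chain_union i f) s xs = fun_int (chain_union i g) s xs"
        using L[of xs] by (auto simp: chain_union_def ex *)
    qed
  qed (use eq in \<open>auto simp: chain_union_def\<close>)
  then show ?thesis by (simp add: lub_limit limit)
qed (auto simp: lub_zero lub_osucc)

text \<open>Smoothness is applied twice to the chain of images: its union is strong in N, and also
  strong in the image of the union. The latter two have the same points and so coincide.\<close>

lemma chain_union_embedding:
  assumes lim: "limit_ordinal i" and fm: "\<And>j. j < i \<Longrightarrow> f j \<in> models K"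
    and ch: "\<And>j k. j \<le> k \<Longrightarrow> k < i \<Longrightarrow> strong K (f j) (f k)"
    and e: "\<And>j. j < i \<Longrightarrow> embedding K g (f j) N"
  shows "embedding K g (chain_union i f) N"
proof -
  let ?U = "chain_union i f"
  have U: "?U \<in> models K" by (rule chain_union_model[OF lim fm ch])
  have up: "strong K (f j) ?U" if "j < i" for j by (rule chain_union_upper[OF lim fm ch that])
  have pU: "points ?U = (\<Union>j\<in>{..<i}. points (f j))" by (simp add: chain_union_def)
  have ge: "inj_on g (points (f j))" "strong K (img V g (f j)) N" if "j < i" for j
    using e[OF that] by (auto simp: embedding_iff)
  obtain j0 where j0: "j0 < i" using limit_nonempty[OF lim] by blast
  have N: "N \<in> models K" using ge(2)[OF j0] strong_models by blast
  have inj: "inj_on g (points ?U)"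
  proof (rule inj_onI)
    fix x y assume xy: "x \<in> points ?U" "y \<in> points ?U" "g x = g y"
    obtain j k where jk: "j < i" "x \<in> points (f j)" "k < i" "y \<in> points (f k)"
      using xy(1,2) unfolding pU by blast
    define m where "m = max j k"
    have m: "m < i" "j \<le> m" "k \<le> m" using jk by (auto simp: m_def)
    then have "x \<in> points (f m)" "y \<in> points (f m)"
      using jk strong_points[OF ch[OF m(2,1)]] strong_points[OF ch[OF m(3,1)]] by auto
    then show "x = y" using ge(1)[OF m(1)] xy(3) by (simp add: inj_on_eq_iff)
  qed
  let ?C = "\<lambda>j. img V g (f j)"
  have Cm: "?C j \<in> models K" if "j < i" for j using ge(2)[OF that] strong_models by blast
  have Cch: "strong K (?C j) (?C k)" if "j \<le> k" "k < i" for j k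
    by (rule img_strong[OF ch[OF that] ge(1)[OF that(2)]])
  have CN: "strong K (chain_union i ?C) N" by (rule smoothness[OF lim Cm Cch N ge(2)])
  have "strong K (chain_union i ?C) (img V g ?U)"
    by (rule smoothness[OF lim Cm Cch img_model(2)[OF U inj] img_strong[OF up inj]])
  moreover have "points (chain_union i ?C) = points (img V g ?U)"
    by (simp add: chain_union_def image_UN)
  ultimately have "chain_union i ?C = img V g ?U"
    using substructure_eqI strong_substructure by blast
  then show ?thesis unfolding embedding_iff using U inj CN by simp
qed

lemma
  assumes M: "M \<in> models K" and Mf: "\<And>j. j < i \<Longrightarrow> strong K M (f j)"
    and ch: "\<And>j k. j < k \<Longrightarrow> k < i \<Longrightarrow> strong K (f j) (f k)"
  shows lub_base: "strong K M (lub M i f)"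
    and lub_upper: "\<And>j. j < i \<Longrightarrow> strong K (f j) (lub M i f)"
    and lub_embedding: "\<And>g N. embedding K g M N \<Longrightarrow> (\<And>j. j < i \<Longrightarrow> embedding K g (f j) N) \<Longrightarrow>
      embedding K g (lub M i f) N"
    and lub_points: "points (lub M i f) = points M \<union> (\<Union>j\<in>{..<i}. points (f j))"
proof -
  have fm: "f j \<in> models K" if "j < i" for j using Mf[OF that] strong_models by blast
  have ch': "strong K (f j) (f k)" if "j \<le> k" "k < i" for j k
    using ch[of j k] strong_refl[OF fm[OF that(2)]] that by (cases "j = k") (auto simp: less_le)
  have "strong K M (lub M i f) \<and> (\<forall>j<i. strong K (f j) (lub M i f)) \<and>
    (\<forall>g N. embedding K g M N \<longrightarrow> (\<forall>j<i. embedding K g (f j) N) \<longrightarrow> embedding K g (lub M i f) N) \<and>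
    points (lub M i f) = points M \<union> (\<Union>j\<in>{..<i}. points (f j))"
  proof (cases i rule: ordinal_cases)
    case zero
    then have "\<not> j < i" for j by (simp add: is_zero_def)
    then have "{..<i} = {}" "\<forall>j. \<not> j < i" by auto
    then show ?thesis using strong_refl[OF M] lub_zero[OF zero] by simp
  next
    case (succ j)
    have j: "j < i" unfolding succ by (rule less_osucc)
    have le: "k \<le> j" if "k < i" for k using that unfolding succ by simp
    have s: "strong K (f k) (f j)" if "k < i" for k using ch'[OF le[OF that] j] .
    have "points (f j) = points M \<union> (\<Union>k\<in>{..<i}. points (f k))"
      using strong_points[OF Mf[OF j]] strong_points[OF s] j by blast
    then show ?thesis using Mf[OF j] s j unfolding succ lub_osucc by simp
  next
    case limit
    note eq = lub_limit[OF limit, of M f]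
    obtain j0 where j0: "j0 < i" using limit_nonempty[OF limit] by blast
    have up: "strong K (f j) (chain_union i f)" if "j < i" for j by (rule chain_union_upper[OF limit fm ch' that])
    have "strong K M (chain_union i f)" by (rule strong_trans[OF Mf[OF j0] up[OF j0]])
    moreover have "points (chain_union i f) = points M \<union> (\<Union>j\<in>{..<i}. points (f j))"
    proof -
      have "points (chain_union i f) = (\<Union>j\<in>{..<i}. points (f j))" by (simp add: chain_union_def)
      moreover have "points M \<subseteq> (\<Union>j\<in>{..<i}. points (f j))" using strong_points[OF Mf[OF j0]] j0 by blast
      ultimately show ?thesis by blast
    qed
    moreover have "embedding K g (chain_union i f) N" if "\<forall>j<i. embedding K g (f j) N" for g N
      by (rule chain_union_embedding[OF limit fm ch']) (use that in simp_all)
    ultimately show ?thesis unfolding eq using up by simp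
  qed
  note * = conjunct1[OF this] conjunct2[OF this]
  show "strong K M (lub M i f)" by (rule *(1))
  show "\<And>j. j < i \<Longrightarrow> strong K (f j) (lub M i f)" using *(2) by simp
  show "points (lub M i f) = points M \<union> (\<Union>j\<in>{..<i}. points (f j))" using *(2) by (elim conjE)
  show "embedding K g (lub M i f) N" if "embedding K g M N" "\<And>j. j < i \<Longrightarrow> embedding K g (f j) N" for g N
  proof -
    have "\<forall>g N. embedding K g M N \<longrightarrow> (\<forall>j<i. embedding K g (f j) N) \<longrightarrow> embedding K g (lub M i f) N"
      using *(2) by (elim conjE)
    then show ?thesis using that by simp
  qed
qed

section \<open>Realizing all types over a model, and absorbing tuples\<close>

definition realizes :: "'u struct \<Rightarrow> 'u struct \<Rightarrow> bool" where
  "realizes M M' \<longleftrightarrow> (\<forall>N b. strong K M N \<longrightarrow> b \<in> points N \<longrightarrow>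
     (\<exists>c\<in>points M'. gtp1 K c (points M) M' = gtp1 K b (points M) N))"

lemma gtp1_strong:
  assumes "strong K M N" "A \<subseteq> points M" "b \<in> points M"
  shows "gtp1 K b A M = gtp1 K b A N"
  unfolding gtp1_def by (rule gtp_strong[OF assms(1,2)]) (use assms(3) in \<open>auto simp: PiE_iff extensional_def\<close>)

end

context aec_ap
begin

text \<open>The types of single elements over M form a small set. They are listed in an ordinal
  length and realized one after the other, each by amalgamation over M.\<close>

lemma realizing_extension:
  assumes M: "M \<in> models K"
  shows "\<exists>M'. strong K M M' \<and> realizes M M'"
proof -
  let ?A = "points M"
  define W where "W = {gtp1 K b ?A N | b N. strong K M N \<and> b \<in> points N}"
  obtain y :: 'u where y: "|?A| \<le>o |{..<y}|" using ex_ordinal_ge[OF model_points_less[OF M]] by blast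
  define m where "m = max y (LS K)"
  have m: "|?A| \<le>o |{..<m}|" "|{..<LS K}| \<le>o |{..<m}|"
    using ordLeq_transitive[OF y card_of_lessThan_mono, of m] card_of_lessThan_mono[of "LS K" m] by (auto simp: m_def)
  have inf: "infinite {..<m}" using infinite_card_of_le[OF infinite_LS m(2)] .
  have "|{gtp K {()} b ?A N | b N. (b, ?A, N) \<in> triples K {()}}| \<le>o |Pow {..<m}|"
    by (intro card_of_types_le m card_of_finite_le[OF inf]) simp
  moreover have "W \<subseteq> {gtp K {()} b ?A N | b N. (b, ?A, N) \<in> triples K {()}}"
  proof
    fix t assume "t \<in> W"
    then obtain b N where bN: "t = gtp1 K b ?A N" "strong K M N" "b \<in> points N" unfolding W_def by blast
    then have "((\<lambda>_. b), ?A, N) \<in> triples K {()}" using strong_models strong_points by (intro gtp1_triple) blast+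
    then show "t \<in> {gtp K {()} b ?A N | b N. (b, ?A, N) \<in> triples K {()}}" unfolding bN(1) gtp1_def by blast
  qed
  ultimately have "|W| \<le>o |Pow {..<m}|" by (rule card_of_subset_le[rotated])
  then have WU: "|W| <o |UNIV :: 'u set|" using ordLeq_ordLess_trans[OF _ strong_limit_universe] by blast
  obtain \<delta> :: 'u where \<delta>: "|W| \<le>o |{..<\<delta>}|" using ex_ordinal_ge[OF WU] by blast
  obtain a where "a \<in> ?A" using model_nonempty[OF M] by blast
  then have "W \<noteq> {}" using strong_refl[OF M] unfolding W_def by blast
  then obtain w where w: "w ` {..<\<delta>} = W" using card_of_le_surj[OF \<delta>] by metis
  \<comment> \<open>Stage i realizes type number i for i below \<delta>; stage \<delta> has no type
    of its own to realize and serves as an upper bound of the earlier stages.\<close>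
  define P where "P = (\<lambda>f (i::'u) r. strong K M r \<and> (\<forall>j<i. strong K (f j) r) \<and>
    (i < \<delta> \<longrightarrow> (\<exists>c\<in>points r. gtp1 K c ?A r = w i)))"
  have "\<exists>f. \<forall>i. P f i (f i)"
  proof (rule dependent_wellorder_choice)
    fix r i and f g :: "'u \<Rightarrow> 'u struct"
    assume "\<And>j. j < i \<Longrightarrow> f j = g j"
    then show "P f i r = P g i r" by (simp add: P_def)
  next
    fix i and f :: "'u \<Rightarrow> 'u struct"
    assume IH: "\<And>j. j < i \<Longrightarrow> P f j (f j)"
    have Mf: "strong K M (f j)" if "j < i" for j using IH[OF that] by (simp add: P_def)
    have ch: "strong K (f j) (f k)" if "j < k" "k < i" for j k using IH[OF that(2)] that(1) by (simp add: P_def)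
    let ?u = "lub M i f"
    have u: "strong K M ?u" by (rule lub_base[OF M Mf ch])
    have fu: "strong K (f j) ?u" if "j < i" for j by (rule lub_upper[OF M Mf ch that])
    show "\<exists>r. P f i r"
    proof (cases "i < \<delta>")
      case False
      then show ?thesis using u fu by (intro exI[of _ ?u]) (simp add: P_def)
    next
      case True
      then have "w i \<in> W" using w by auto
      then obtain b N where bN: "w i = gtp1 K b ?A N" "strong K M N" "b \<in> points N" unfolding W_def by blast
      obtain r h where r: "strong K ?u r" "embedding K h N r" "\<forall>x\<in>?A. h x = x"
        using amalgamation_extend[OF bN(2) strong_embedding[OF u]] by blast
      have hb: "h b \<in> points r" using embedding_points[OF r(2)] bN(3) by blast
      have "gtp1 K b ?A N = gtp1 K (h b) ?A r" unfolding gtp1_def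
        by (rule gtp_embedding[OF r(2) strong_points[OF bN(2)]])
          (use r(3) bN(3) hb in \<open>auto simp: PiE_iff extensional_def\<close>)
      then have "P f i r" unfolding P_def using strong_trans[OF u r(1)] strong_trans[OF fu r(1)] hb bN(1) by auto
      then show ?thesis ..
    qed
  qed
  then obtain f where f: "\<And>i. P f i (f i)" by blast
  have Mf: "strong K M (f i)" for i using f[of i] by (simp add: P_def)
  have "realizes M (f \<delta>)" unfolding realizes_def
  proof (intro allI impI)
    fix N b assume "strong K M N" "b \<in> points N"
    then have "gtp1 K b ?A N \<in> W" unfolding W_def by blast
    then obtain i where i: "i < \<delta>" "gtp1 K b ?A N = w i" using w by auto
    then obtain c where c: "c \<in> points (f i)" "gtp1 K c ?A (f i) = w i" using f[of i] unfolding P_def by blast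
    have s: "strong K (f i) (f \<delta>)" using f[of \<delta>] i(1) by (simp add: P_def)
    have "gtp1 K c ?A (f \<delta>) = gtp1 K b ?A N"
      using gtp1_strong[OF s strong_points[OF Mf] c(1)] c(2) i(2) by simp
    then show "\<exists>c\<in>points (f \<delta>). gtp1 K c ?A (f \<delta>) = gtp1 K b ?A N"
      using c(1) strong_points[OF s] by blast
  qed
  then show ?thesis using Mf by blast
qed

text \<open>Stability leaves only l types over M, so a submodel of size l around M and one
  realization of each is enough.\<close>

lemma realizing_extension_small:
  fixes l :: 'u
  assumes l: "|{..<LS K}| \<le>o |{..<l}|" "stable_in K l" and M: "M \<in> models K" "|points M| \<le>o |{..<l}|"
  shows "\<exists>M'. strong K M M' \<and> |points M'| \<le>o |{..<l}| \<and> realizes M M'"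
proof -
  let ?A = "points M"
  have inf: "infinite {..<l}" using infinite_card_of_le[OF infinite_LS l(1)] .
  obtain N where N: "strong K M N" "realizes M N" using realizing_extension[OF M(1)] by blast
  have Nm: "N \<in> models K" "?A \<subseteq> points N" using strong_models[OF N(1)] strong_points[OF N(1)] by auto
  define T where "T = {gtp1 K b ?A N | b. b \<in> points N}"
  have T: "|T| \<le>o |{..<l}|" using l(2) Nm M(2) unfolding stable_in_def T_def by blast
  define pick where "pick = (\<lambda>t. SOME b. b \<in> points N \<and> gtp1 K b ?A N = t)"
  have pick: "pick t \<in> points N \<and> gtp1 K (pick t) ?A N = t" if "t \<in> T" for t
  proof -
    obtain b where "b \<in> points N" "gtp1 K b ?A N = t" using \<open>t \<in> T\<close> unfolding T_def by blast
    then have "b \<in> points N \<and> gtp1 K b ?A N = t" by simp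
    then show ?thesis unfolding pick_def by (rule someI)
  qed
  have "?A \<union> pick ` T \<subseteq> points N" using Nm(2) pick by auto
  moreover have "|?A \<union> pick ` T| \<le>o |{..<l}|" by (intro card_of_Un_le inf M(2) card_of_image_le T)
  ultimately obtain M' where M': "strong K M' N" "?A \<union> pick ` T \<subseteq> points M'" "|points M'| \<le>o |{..<l}|"
    using LS_submodel[OF Nm(1) _ _ l(1)] by blast
  have MM': "strong K M M'" by (rule strong_if_subset[OF N(1) M'(1)]) (use M'(2) in simp)
  have "realizes M M'" unfolding realizes_def
  proof (intro allI impI)
    fix N' b assume "strong K M N'" "b \<in> points N'"
    then obtain c where c: "c \<in> points N" "gtp1 K c ?A N = gtp1 K b ?A N'" using N(2) unfolding realizes_def by blast
    have t: "gtp1 K c ?A N \<in> T" unfolding T_def using c(1) by blast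
    let ?c = "pick (gtp1 K c ?A N)"
    have cM: "?c \<in> points M'" using M'(2) t by blast
    have "gtp1 K ?c ?A M' = gtp1 K b ?A N'"
      using gtp1_strong[OF M'(1) strong_points[OF MM'] cM] pick[OF t] c(2) by simp
    then show "\<exists>c\<in>points M'. gtp1 K c ?A M' = gtp1 K b ?A N'" using cM by blast
  qed
  then show ?thesis using MM' M'(3) by blast
qed

text \<open>The forth half of a back-and-forth step: the type of b over the image of U is realized
  by some c in M, and the equality of types yields an extension of g that sends c to b, at the price
  of enlarging N.\<close>

lemma absorb_element:
  assumes g: "embedding K g U N" and UM: "strong K U M" "realizes U M" and b: "b \<in> points N"
  shows "\<exists>N' h. strong K N N' \<and> embedding K h M N' \<and> (\<forall>x\<in>points U. h x = g x) \<and> b \<in> h ` points M"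
proof -
  obtain N1 k where k: "strong K U N1" "embedding K k N N1" "\<forall>x\<in>points U. k (g x) = x"
    using embedding_rename[OF g] by blast
  have kb: "k b \<in> points N1" using embedding_points[OF k(2)] b by blast
  obtain c where c: "c \<in> points M" "gtp1 K c (points U) M = gtp1 K (k b) (points U) N1"
    using UM(2) k(1) kb unfolding realizes_def by blast
  have tr: "((\<lambda>_. k b), points U, N1) \<in> triples K {()}" "((\<lambda>_. c), points U, M) \<in> triples K {()}"
    using gtp1_triple kb c(1) strong_models[OF k(1)] strong_models[OF UM(1)]
      strong_points[OF k(1)] strong_points[OF UM(1)] by auto
  obtain N2 h where h: "strong K N1 N2" "embedding K h M N2" "\<forall>x\<in>points U. h x = x" "h c = k b"
    using gtp_eqD[OF c(2)[symmetric, unfolded gtp1_def] tr] by auto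
  obtain N3 k' where k': "strong K N N3" "embedding K k' N2 N3" "\<forall>x\<in>points N. k' (k x) = x"
    using embedding_rename[OF embedding_strong_right[OF k(2) h(1)]] by blast
  have "(k' \<circ> h) x = g x" if "x \<in> points U" for x
  proof -
    have "g x \<in> points N" using embedding_points[OF g] that by blast
    then have "k' (k (g x)) = g x" using k'(3) by simp
    then show ?thesis using k(3) h(3) that by simp
  qed
  moreover have "(k' \<circ> h) c = b" using h(4) k'(3) b by simp
  then have "b \<in> (k' \<circ> h) ` points M" using c(1) by blast
  ultimately show ?thesis using k'(1) embedding_comp[OF h(2) k'(2)] by blast
qed

lemma glue_embeddings:
  fixes F :: "'u \<Rightarrow> 'u struct \<times> ('u \<Rightarrow> 'u)"
  assumes M0: "M0 \<in> models K" "strong K M0 N"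
    and Mf: "\<And>j. j < i \<Longrightarrow> strong K M0 (f j)" "\<And>j k. j < k \<Longrightarrow> k < i \<Longrightarrow> strong K (f j) (f k)"
    and NF: "\<And>j. j < i \<Longrightarrow> strong K N (fst (F j))"
      "\<And>j k. j < k \<Longrightarrow> k < i \<Longrightarrow> strong K (fst (F j)) (fst (F k))"
    and e: "\<And>j. j < i \<Longrightarrow> embedding K (snd (F j)) (f j) (fst (F j))"
    and fix0: "\<And>j x. j < i \<Longrightarrow> x \<in> points M0 \<Longrightarrow> snd (F j) x = x"
    and coh: "\<And>j k x. j < k \<Longrightarrow> k < i \<Longrightarrow> x \<in> points (f j) \<Longrightarrow> snd (F k) x = snd (F j) x"
  shows "\<exists>g. embedding K g (lub M0 i f) (lub N i (\<lambda>j. fst (F j))) \<and> (\<forall>x\<in>points M0. g x = x) \<and>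
    (\<forall>j<i. \<forall>x\<in>points (f j). g x = snd (F j) x)"
proof -
  have N: "N \<in> models K" using strong_models[OF M0(2)] by simp
  let ?N = "lub N i (\<lambda>j. fst (F j))"
  have N0: "strong K N ?N" by (rule lub_base[OF N, where f = "\<lambda>j. fst (F j)"]) (use NF in simp_all)
  have Nj: "strong K (fst (F j)) ?N" if "j < i" for j
    by (rule lub_upper[OF N _ _ that, where f = "\<lambda>j. fst (F j)"]) (use NF in simp_all)
  \<comment> \<open>By coherence any stage that contains x gives the same value; the least one is
    taken.\<close>
  define g where "g = (\<lambda>x. if x \<in> points M0 then x else snd (F (LEAST j. j < i \<and> x \<in> points (f j))) x)"
  have gj: "g x = snd (F j) x" if j: "j < i" "x \<in> points (f j)" for j x
  proof (cases "x \<in> points M0")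
    case True
    then show ?thesis using fix0[OF j(1)] by (simp add: g_def)
  next
    case False
    define m where "m = (LEAST j. j < i \<and> x \<in> points (f j))"
    have m: "m < i \<and> x \<in> points (f m)" unfolding m_def by (rule LeastI[of _ j]) (use j in simp)
    have "m \<le> j" unfolding m_def by (rule Least_le) (use j in simp)
    then have "snd (F j) x = snd (F m) x" using coh[of m j x] j(1) m by (cases "m = j") (auto simp: less_le)
    then show ?thesis using False by (simp add: g_def m_def)
  qed
  have "embedding K g (lub M0 i f) ?N"
  proof (rule lub_embedding[OF M0(1) Mf])
    have "strong K M0 ?N" by (rule strong_trans[OF M0(2) N0])
    then show "embedding K g M0 ?N" by (rule embedding_cong[OF strong_embedding]) (simp add: g_def)
    fix j assume j: "j < i"
    have "embedding K (snd (F j)) (f j) ?N" by (rule embedding_strong_right[OF e[OF j] Nj[OF j]])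
    then show "embedding K g (f j) ?N" by (rule embedding_cong) (rule gj[OF j])
  qed
  then show ?thesis using gj by (intro exI[of _ g]) (simp add: g_def)
qed

text \<open>A chain of length \<alpha> of models of size l, each realizing all types of single
  elements over the preceding part, absorbs any \<alpha>-tuple of N coordinate by coordinate. All
  types of \<alpha>-tuples over A are thus realized in one model of size l, which has at most
  l^\<alpha> = l tuples.\<close>

theorem stable_long_types:
  fixes l \<alpha> :: 'u
  assumes l: "|{..<LS K}| \<le>o |{..<l}|" "stable_in K l" and pow: "|{..<\<alpha>} \<rightarrow>\<^sub>E {..<l}| \<le>o |{..<l}|"
    and \<alpha>l: "|{..<\<alpha>}| \<le>o |{..<l}|" and N: "N \<in> models K" "A \<subseteq> points N" "|A| \<le>o |{..<l}|"
  shows "|{gtp K {..<\<alpha>} b A N | b. b \<in> {..<\<alpha>} \<rightarrow>\<^sub>E points N}| \<le>o |{..<l}|"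
proof -
  let ?L = "{..<l}"
  have inf: "infinite ?L" using infinite_card_of_le[OF infinite_LS l(1)] .
  obtain M0 where M0: "strong K M0 N" "A \<subseteq> points M0" "|points M0| \<le>o |?L|"
    using LS_submodel[OF N l(1)] by blast
  have M0m: "M0 \<in> models K" using strong_models[OF M0(1)] by simp
  define P where "P = (\<lambda>f (i::'u) r. i < \<alpha> \<longrightarrow>
    strong K (lub M0 i f) r \<and> strong K M0 r \<and> (\<forall>j<i. strong K (f j) r) \<and> |points r| \<le>o |?L| \<and> realizes (lub M0 i f) r)"
  have lubL: "|points (lub M0 i f)| \<le>o |?L|" and lub0: "strong K M0 (lub M0 i f)"
    and lubf: "\<And>j. j < i \<Longrightarrow> strong K (f j) (lub M0 i f)"
    if i: "i \<le> \<alpha>" and IH: "\<And>j. j < i \<Longrightarrow> P f j (f j)" for i f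
  proof -
    have j\<alpha>: "j < \<alpha>" if "j < i" for j using that i by order
    have Mf: "strong K M0 (f j)" if "j < i" for j using IH[OF that] j\<alpha>[OF that] by (simp add: P_def)
    have ch: "strong K (f j) (f k)" if "j < k" "k < i" for j k
      using IH[OF that(2)] j\<alpha>[OF that(2)] that(1) by (simp add: P_def)
    have fL: "|points (f j)| \<le>o |?L|" if "j < i" for j using IH[OF that] j\<alpha>[OF that] by (simp add: P_def)
    show "strong K M0 (lub M0 i f)" by (rule lub_base[OF M0m Mf ch])
    show "strong K (f j) (lub M0 i f)" if "j < i" for j by (rule lub_upper[OF M0m Mf ch that])
    have "|{..<i}| \<le>o |?L|" by (rule ordLeq_transitive[OF card_of_lessThan_mono[OF i] \<alpha>l])
    then have "|points M0 \<union> (\<Union>j\<in>{..<i}. points (f j))| \<le>o |?L|"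
      using fL by (intro card_of_Un_le card_of_UN_le inf M0(3)) simp_all
    moreover have "points (lub M0 i f) = points M0 \<union> (\<Union>j\<in>{..<i}. points (f j))" by (rule lub_points[OF M0m Mf ch])
    ultimately show "|points (lub M0 i f)| \<le>o |?L|" by simp
  qed
  have "\<exists>f. \<forall>i. P f i (f i)"
  proof (rule dependent_wellorder_choice)
    fix r i and f g :: "'u \<Rightarrow> 'u struct"
    assume eq: "\<And>j. j < i \<Longrightarrow> f j = g j"
    have "lub M0 i f = lub M0 i g" by (rule lub_cong[OF eq])
    then show "P f i r = P g i r" using eq by (simp add: P_def)
  next
    fix i and f :: "'u \<Rightarrow> 'u struct"
    assume IH: "\<And>j. j < i \<Longrightarrow> P f j (f j)"
    show "\<exists>r. P f i r"
    proof (cases "i < \<alpha>")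
      case False
      then show ?thesis by (simp add: P_def)
    next
      case True
      let ?u = "lub M0 i f"
      have i: "i \<le> \<alpha>" using True by order
      note u = lubL[OF i IH] lub0[OF i IH] lubf[OF i IH]
      have "?u \<in> models K" using strong_models[OF u(2)] by simp
      then obtain r where r: "strong K ?u r" "|points r| \<le>o |?L|" "realizes ?u r"
        using realizing_extension_small[OF l _ u(1)] by blast
      then have "P f i r" unfolding P_def using strong_trans[OF u(2) r(1)] strong_trans[OF u(3) r(1)] by simp
      then show ?thesis ..
    qed
  qed
  then obtain f where f: "\<And>i. P f i (f i)" by blast
  have Mf: "strong K M0 (f j)" if "j < \<alpha>" for j using f[of j] that by (simp add: P_def)
  have ch: "strong K (f j) (f k)" if "j < k" "k < \<alpha>" for j k using f[of k] that by (simp add: P_def)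
  let ?M = "lub M0 \<alpha> f"
  have cardM: "|points ?M| \<le>o |?L|" by (rule lubL[OF order_refl f])
  have M0M: "strong K M0 ?M" by (rule lub0[OF order_refl f])
  have fM: "strong K (f j) ?M" if "j < \<alpha>" for j by (rule lubf[OF order_refl f that])
  have A: "A \<subseteq> points ?M" using M0(2) strong_points[OF M0M] by blast
  have "\<exists>c\<in>{..<\<alpha>} \<rightarrow>\<^sub>E points ?M. gtp K {..<\<alpha>} b A N = gtp K {..<\<alpha>} c A ?M" if b: "b \<in> {..<\<alpha>} \<rightarrow>\<^sub>E points N" for b
  proof -
    \<comment> \<open>A second recursion, for one fixed tuple b: stage i extends the earlier
      embeddings of the chain so that entry i of b falls into the image, in a growing extension of
      N.\<close>
    define P2 where "P2 = (\<lambda>F (i::'u) (z :: 'u struct \<times> ('u \<Rightarrow> 'u)). i < \<alpha> \<longrightarrow>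
      strong K N (fst z) \<and> (\<forall>j<i. strong K (fst (F j)) (fst z)) \<and> embedding K (snd z) (f i) (fst z) \<and>
      (\<forall>x\<in>points M0. snd z x = x) \<and> (\<forall>j<i. \<forall>x\<in>points (f j). snd z x = snd (F j) x) \<and>
      b i \<in> snd z ` points (f i))"
    have glue: "\<exists>g. embedding K g (lub M0 i f) (lub N i (\<lambda>j. fst (F j))) \<and> (\<forall>x\<in>points M0. g x = x) \<and>
        (\<forall>j<i. \<forall>x\<in>points (f j). g x = snd (F j) x)"
      and lubN: "strong K N (lub N i (\<lambda>j. fst (F j)))"
      and lubF: "\<And>j. j < i \<Longrightarrow> strong K (fst (F j)) (lub N i (\<lambda>j. fst (F j)))"
      if i: "i \<le> \<alpha>" and IH: "\<And>j. j < i \<Longrightarrow> P2 F j (F j)" for i F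
    proof -
      have j\<alpha>: "j < \<alpha>" if "j < i" for j using that i by order
      have q: "strong K N (fst (F j))" "\<forall>k<j. strong K (fst (F k)) (fst (F j))" "embedding K (snd (F j)) (f j) (fst (F j))"
        "\<forall>x\<in>points M0. snd (F j) x = x" "\<forall>k<j. \<forall>x\<in>points (f k). snd (F j) x = snd (F k) x" if "j < i" for j
        using IH[OF that] j\<alpha>[OF that] unfolding P2_def by simp_all
      show "\<exists>g. embedding K g (lub M0 i f) (lub N i (\<lambda>j. fst (F j))) \<and> (\<forall>x\<in>points M0. g x = x) \<and>
        (\<forall>j<i. \<forall>x\<in>points (f j). g x = snd (F j) x)"
        by (rule glue_embeddings[OF M0m M0(1)]) (use q Mf ch j\<alpha> in simp_all)
      have q2: "strong K (fst (F j)) (fst (F k))" if "j < k" "k < i" for j k using q(2)[OF that(2)] that(1) by simp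
      show "strong K N (lub N i (\<lambda>j. fst (F j)))" by (rule lub_base[OF N(1), where f = "\<lambda>j. fst (F j)"]) (use q(1) q2 in simp_all)
      show "strong K (fst (F j)) (lub N i (\<lambda>j. fst (F j)))" if "j < i" for j
        by (rule lub_upper[OF N(1) _ _ that, where f = "\<lambda>j. fst (F j)"]) (use q(1) q2 in simp_all)
    qed
    have "\<exists>F. \<forall>i. P2 F i (F i)"
    proof (rule dependent_wellorder_choice)
      fix z i and F G :: "'u \<Rightarrow> 'u struct \<times> ('u \<Rightarrow> 'u)"
      assume "\<And>j. j < i \<Longrightarrow> F j = G j"
      then show "P2 F i z = P2 G i z" by (simp add: P2_def)
    next
      fix i and F :: "'u \<Rightarrow> 'u struct \<times> ('u \<Rightarrow> 'u)"
      assume IH: "\<And>j. j < i \<Longrightarrow> P2 F j (F j)"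
      show "\<exists>z. P2 F i z"
      proof (cases "i < \<alpha>")
        case False
        then show ?thesis by (simp add: P2_def)
      next
        case True
        let ?N = "lub N i (\<lambda>j. fst (F j))"
        have i: "i \<le> \<alpha>" using True by order
        have "\<exists>g. embedding K g (lub M0 i f) ?N \<and> (\<forall>x\<in>points M0. g x = x) \<and>
          (\<forall>j<i. \<forall>x\<in>points (f j). g x = snd (F j) x)" by (rule glue[OF i]) (rule IH)
        then obtain g where g: "embedding K g (lub M0 i f) ?N" "\<forall>x\<in>points M0. g x = x"
          "\<forall>j<i. \<forall>x\<in>points (f j). g x = snd (F j) x" by (elim exE conjE)
        have NN: "strong K N ?N" by (rule lubN[OF i]) (rule IH)
        have "b i \<in> points ?N" using b True strong_points[OF NN] by auto
        moreover have "strong K (lub M0 i f) (f i)" "realizes (lub M0 i f) (f i)" using f[of i] True by (simp_all add: P_def)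
        ultimately obtain N' h where h: "strong K ?N N'" "embedding K h (f i) N'"
          "\<forall>x\<in>points (lub M0 i f). h x = g x" "b i \<in> h ` points (f i)"
          using absorb_element[OF g(1)] by blast
        have s0: "points M0 \<subseteq> points (lub M0 i f)" using strong_points[OF lub0[OF i f]] .
        have sj: "points (f j) \<subseteq> points (lub M0 i f)" if "j < i" for j using strong_points[OF lubf[OF i f that]] .
        have "P2 F i (N', h)" unfolding P2_def fst_conv snd_conv
        proof (intro impI conjI allI ballI)
          show "strong K N N'" by (rule strong_trans[OF NN h(1)])
          show "strong K (fst (F j)) N'" if "j < i" for j
          proof -
            have "strong K (fst (F j)) ?N" by (rule lubF[OF i _ that]) (rule IH)
            then show ?thesis using h(1) by (rule strong_trans)
          qed
          show "h x = x" if "x \<in> points M0" for x using h(3) g(2) s0 that by (metis subsetD)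
          show "h x = snd (F j) x" if "j < i" "x \<in> points (f j)" for j x
          proof -
            have "x \<in> points (lub M0 i f)" using sj that by blast
            then show ?thesis using h(3) g(3) that by simp
          qed
        qed (rule h)+
        then show ?thesis ..
      qed
    qed
    then obtain F where F: "\<And>i. P2 F i (F i)" by blast
    let ?N = "lub N \<alpha> (\<lambda>j. fst (F j))"
    have "\<exists>g. embedding K g ?M ?N \<and> (\<forall>x\<in>points M0. g x = x) \<and>
      (\<forall>j<\<alpha>. \<forall>x\<in>points (f j). g x = snd (F j) x)" by (rule glue[OF order_refl]) (rule F)
    then obtain g where g: "embedding K g ?M ?N" "\<forall>x\<in>points M0. g x = x"
      "\<forall>j<\<alpha>. \<forall>x\<in>points (f j). g x = snd (F j) x" by (elim exE conjE)
    have NN: "strong K N ?N" by (rule lubN[OF order_refl F])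
    have "\<exists>c. c \<in> points ?M \<and> g c = b i" if i: "i < \<alpha>" for i
    proof -
      have "b i \<in> snd (F i) ` points (f i)" using F[of i] i by (simp add: P2_def)
      then obtain c where c: "c \<in> points (f i)" "b i = snd (F i) c" by blast
      then have "g c = b i" using g(3) i by simp
      then show ?thesis using c(1) strong_points[OF fM[OF i]] by blast
    qed
    then obtain c0 where c0: "\<And>i. i < \<alpha> \<Longrightarrow> c0 i \<in> points ?M \<and> g (c0 i) = b i" by metis
    let ?c = "restrict c0 {..<\<alpha>}"
    have c: "?c \<in> {..<\<alpha>} \<rightarrow>\<^sub>E points ?M" using c0 by auto
    have bN: "b \<in> {..<\<alpha>} \<rightarrow>\<^sub>E points ?N" using b strong_points[OF NN] by (auto simp: PiE_iff)
    have "gtp K {..<\<alpha>} ?c A ?M = gtp K {..<\<alpha>} b A ?N"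
    proof (rule gtp_embedding[OF g(1) A c _ bN])
      show "g x = x" if "x \<in> A" for x using g(2) M0(2) that by blast
      show "b i = g (?c i)" if "i \<in> {..<\<alpha>}" for i using c0 that by simp
    qed
    then show ?thesis using gtp_strong[OF NN N(2) b] c by (intro bexI[of _ ?c]) simp_all
  qed
  then have "{gtp K {..<\<alpha>} b A N | b. b \<in> {..<\<alpha>} \<rightarrow>\<^sub>E points N} \<subseteq>
      (\<lambda>c. gtp K {..<\<alpha>} c A ?M) ` ({..<\<alpha>} \<rightarrow>\<^sub>E points ?M)" by blast
  moreover have "|{..<\<alpha>} \<rightarrow>\<^sub>E points ?M| \<le>o |?L|"
  proof -
    have "points ?M \<noteq> {}" using model_nonempty strong_models[OF M0M] by blast
    then have "|{..<\<alpha>} \<rightarrow>\<^sub>E points ?M| \<le>o |{..<\<alpha>} \<rightarrow>\<^sub>E ?L|" by (intro card_of_PiE_mono cardM card_of_mono1 subset_refl)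
    then show ?thesis by (rule ordLeq_transitive[OF _ pow])
  qed
  ultimately show ?thesis using card_of_subset_le card_of_image_le by meson
qed

end

section \<open>Linear orders with many cuts\<close>

text \<open>The lexicographic order of characteristic functions.\<close>

definition lex :: "'u::universe set \<Rightarrow> 'u set \<Rightarrow> bool" where
  "lex x y \<longleftrightarrow> (\<exists>\<delta>. \<delta> \<notin> x \<and> \<delta> \<in> y \<and> (\<forall>\<epsilon><\<delta>. \<epsilon> \<in> x \<longleftrightarrow> \<epsilon> \<in> y))"

lemma lex_irrefl: "\<not> lex x x"
  by (auto simp: lex_def)

lemma lex_trans:
  assumes "lex x y" "lex y z"
  shows "lex x z"
proof -
  obtain \<delta> \<delta>' where d: "\<delta> \<notin> x" "\<delta> \<in> y" "\<forall>\<epsilon><\<delta>. \<epsilon> \<in> x \<longleftrightarrow> \<epsilon> \<in> y"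
    "\<delta>' \<notin> y" "\<delta>' \<in> z" "\<forall>\<epsilon><\<delta>'. \<epsilon> \<in> y \<longleftrightarrow> \<epsilon> \<in> z"
    using assms unfolding lex_def by (elim exE conjE)
  consider "\<delta> < \<delta>'" | "\<delta>' < \<delta>" | "\<delta> = \<delta>'" by (rule linorder_cases)
  then show ?thesis
  proof cases
    case 1
    have "\<epsilon> \<in> x \<longleftrightarrow> \<epsilon> \<in> z" if "\<epsilon> < \<delta>" for \<epsilon> using d(3,6) that less_trans[OF that 1] by simp
    then show ?thesis unfolding lex_def using d 1 by (intro exI[of _ \<delta>]) simp
  next
    case 2
    have "\<epsilon> \<in> x \<longleftrightarrow> \<epsilon> \<in> z" if "\<epsilon> < \<delta>'" for \<epsilon> using d(3,6) that less_trans[OF that 2] by simp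
    then show ?thesis unfolding lex_def using d 2 by (intro exI[of _ \<delta>']) simp
  next
    case 3
    then show ?thesis using d by simp
  qed
qed

lemma lex_total:
  assumes "x \<noteq> y"
  shows "lex x y \<or> lex y x"
proof -
  have ex: "\<exists>\<delta>. (\<delta> \<in> x) \<noteq> (\<delta> \<in> y)" using assms by blast
  define \<delta> where "\<delta> = (LEAST \<delta>. (\<delta> \<in> x) \<noteq> (\<delta> \<in> y))"
  have d: "(\<delta> \<in> x) \<noteq> (\<delta> \<in> y)" unfolding \<delta>_def using ex by (rule LeastI_ex)
  have "\<epsilon> \<in> x \<longleftrightarrow> \<epsilon> \<in> y" if "\<epsilon> < \<delta>" for \<epsilon> using not_less_Least[OF that[unfolded \<delta>_def]] by simp
  then show ?thesis unfolding lex_def using d by (cases "\<delta> \<in> x") (auto intro!: exI[of _ \<delta>])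
qed

text \<open>Cut y off just after the first difference. The remaining initial part already exceeds x;
  it is below y, unless it is all of y.\<close>

lemma lex_dense:
  assumes "lex x y"
  shows "\<exists>\<delta>\<in>y. lex x (y \<inter> {..\<delta>}) \<and> (lex (y \<inter> {..\<delta>}) y \<or> y \<inter> {..\<delta>} = y)"
proof -
  obtain \<delta> where d: "\<delta> \<notin> x" "\<delta> \<in> y" "\<forall>\<epsilon><\<delta>. \<epsilon> \<in> x \<longleftrightarrow> \<epsilon> \<in> y" using assms unfolding lex_def by (elim exE conjE)
  let ?z = "y \<inter> {..\<delta>}"
  have "lex x ?z" unfolding lex_def using d by (intro exI[of _ \<delta>]) (auto simp: less_imp_le)
  moreover have "lex ?z y" if "?z \<noteq> y"
  proof -
    have "\<not> lex y ?z"
    proof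
      assume "lex y ?z"
      then show False unfolding lex_def by blast
    qed
    then show ?thesis using lex_total[OF that] by blast
  qed
  ultimately show ?thesis using d(2) by blast
qed

text \<open>Take the least \<nu> with 2^\<nu> > l and all subsets of \<nu>. The subsets bounded in
  \<nu> are dense by truncation, and by minimality of \<nu> there are at most l of them.\<close>

lemma dense_order_exists:
  fixes l :: "'u::universe"
  assumes inf: "infinite {..<l}"
  shows "\<exists>X J :: 'u set set. J \<subseteq> X \<and> |X| <o |UNIV :: 'u set| \<and> |{..<l}| <o |X| \<and> |J| \<le>o |{..<l}| \<and>
    (\<forall>x\<in>X. \<forall>y\<in>X. lex x y \<longrightarrow> (\<exists>z\<in>J. lex x z \<and> (lex z y \<or> z = y)))"
proof -
  define \<nu> where "\<nu> = (LEAST x::'u. |{..<l}| <o |Pow {..<x}| )"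
  have l: "|{..<l}| <o |Pow {..<l}|" by (rule card_of_Pow)
  have \<nu>: "|{..<l}| <o |Pow {..<\<nu>}|" unfolding \<nu>_def by (rule LeastI[of _ l]) (rule l)
  have \<nu>l: "\<nu> \<le> l" unfolding \<nu>_def by (rule Least_le) (rule l)
  have below: "|Pow {..<\<delta>}| \<le>o |{..<l}|" if "\<delta> < \<nu>" for \<delta>
    using not_less_Least[OF that[unfolded \<nu>_def]] by (simp add: not_card_of_ordLess_iff)
  define J where "J = (\<Union>\<delta>\<in>{..<\<nu>}. Pow {..\<delta>})"
  have "|J| \<le>o |{..<l}|" unfolding J_def
  proof (rule card_of_UN_le[OF inf card_of_lessThan_mono[OF \<nu>l]])
    fix \<delta> assume "\<delta> \<in> {..<\<nu>}"
    then have "|Pow (insert \<delta> {..<\<delta>})| \<le>o |{..<l}|" by (intro card_of_Pow_insert inf below) simp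
    moreover have "insert \<delta> {..<\<delta>} = {..\<delta>}" by (auto simp: le_less)
    ultimately show "|Pow {..\<delta>}| \<le>o |{..<l}|" by simp
  qed
  moreover have "J \<subseteq> Pow {..<\<nu>}" unfolding J_def by (auto dest: le_less_trans)
  moreover have "\<exists>z\<in>J. lex x z \<and> (lex z y \<or> z = y)" if xy: "y \<in> Pow {..<\<nu>}" "lex x y" for x y
  proof -
    obtain \<delta> where d: "\<delta> \<in> y" "lex x (y \<inter> {..\<delta>})" "lex (y \<inter> {..\<delta>}) y \<or> y \<inter> {..\<delta>} = y"
      using lex_dense[OF xy(2)] by blast
    have "y \<inter> {..\<delta>} \<in> J" unfolding J_def using d(1) xy(1) by blast
    then show ?thesis using d(2,3) by blast
  qed
  ultimately show ?thesis using \<nu> strong_limit_universe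
    by (intro exI[of _ "Pow {..<\<nu>}"] exI[of _ J]) simp
qed

section \<open>The order property and stability\<close>

context aec_ap
begin

definition splitting :: "'u \<Rightarrow> 'u struct \<Rightarrow> 'x set \<Rightarrow> ('x \<Rightarrow> 'x \<Rightarrow> bool) \<Rightarrow> ('x \<Rightarrow> 'u) \<Rightarrow>
    ('x \<Rightarrow> 'u \<Rightarrow> 'u) \<Rightarrow> ('x \<Rightarrow> 'u \<Rightarrow> 'u) \<Rightarrow> bool" where
  "splitting \<alpha> N X lt c a a' \<longleftrightarrow> N \<in> models K \<and>
    (\<forall>x\<in>X. c x \<in> points N \<and> a x \<in> {..<\<alpha>} \<rightarrow>\<^sub>E points N \<and> a' x \<in> {..<\<alpha>} \<rightarrow>\<^sub>E points N) \<and>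
    (\<forall>x\<in>X. \<forall>y\<in>X. (ptype N \<alpha> (c x) (a y) = ptype N \<alpha> (c x) (a' y)) = lt x y)"

text \<open>The lengths are cofinal below the Hanf number of \<chi>, with the same \<alpha> for all
  of them.\<close>

definition long_splitting :: "'u \<Rightarrow> 'u \<Rightarrow> bool" where
  "long_splitting \<chi> \<alpha> \<longleftrightarrow> (\<forall>j<card_succ (two_power \<chi>). \<exists>N (W :: 'u set) c a a'.
     |{..<beth j}| \<le>o |W| \<and> splitting \<alpha> N W (<) c a a')"

text \<open>The elements c and both tuples are concatenated to one tuple per index, to which the
  Ehrenfeucht-Mostowski theorem applies with R saying that the pattern holds.\<close>

lemma splitting_any_order:
  fixes \<chi> \<alpha> :: 'u and X :: "'x set"
  assumes \<chi>: "cardinal \<chi>" "|{..<LS K}| \<le>o |{..<\<chi>}|" "|{..<\<alpha>}| \<le>o |{..<\<chi>}|"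
    and long: "long_splitting \<chi> \<alpha>" and X: "|X| <o |UNIV :: 'u set|"
    and lt: "\<And>x. \<not> lt x x" "\<And>x y z. lt x y \<Longrightarrow> lt y z \<Longrightarrow> lt x z" "\<And>x y. x \<noteq> y \<Longrightarrow> lt x y \<or> lt y x"
  shows "\<exists>N c a a'. splitting \<alpha> N X lt c a a'"
proof -
  define Ind where "Ind = ({()} <+> ({..<\<alpha>} <+> {..<\<alpha>}))"
  have inf: "infinite {..<\<chi>}" using infinite_card_of_le[OF infinite_LS \<chi>(2)] .
  have Ind: "|Ind| \<le>o |{..<\<chi>}|" unfolding Ind_def
    by (intro card_of_Plus_le inf \<chi>(3) card_of_finite_le[OF inf, of "{()}"]) simp
  \<comment> \<open>These read the tuples a and a' off the concatenation; the restriction is there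
    because tuples are extensional.\<close>
  define fa where "fa = (\<lambda>e :: unit + ('u + 'u) \<Rightarrow> 'u. restrict (\<lambda>i. e (Inr (Inl i))) {..<\<alpha>})"
  define fb where "fb = (\<lambda>e :: unit + ('u + 'u) \<Rightarrow> 'u. restrict (\<lambda>i. e (Inr (Inr i))) {..<\<alpha>})"
  define R where "R = (\<lambda>N (W :: 'u set) d. splitting \<alpha> N W (<) (\<lambda>w. d w (Inl ())) (\<lambda>w. fa (d w)) (\<lambda>w. fb (d w)))"
  have IndI: "Inl () \<in> Ind" "\<And>i. i < \<alpha> \<Longrightarrow> Inr (Inl i) \<in> Ind" "\<And>i. i < \<alpha> \<Longrightarrow> Inr (Inr i) \<in> Ind"
    unfolding Ind_def by auto
  have ex: "\<exists>N W d. R N W d \<and> N \<in> models K \<and> |{..<beth j}| \<le>o |W| \<and> (\<forall>w\<in>W. \<forall>p\<in>Ind. d w p \<in> points N)"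
    if j: "j < card_succ (two_power \<chi>)" for j
  proof -
    obtain N and W :: "'u set" and c a a' where s: "|{..<beth j}| \<le>o |W|" "splitting \<alpha> N W (<) c a a'"
      using long[unfolded long_splitting_def, THEN spec, THEN mp, OF j] by (elim exE conjE)
    have q: "N \<in> models K" "\<forall>x\<in>W. c x \<in> points N \<and> a x \<in> {..<\<alpha>} \<rightarrow>\<^sub>E points N \<and> a' x \<in> {..<\<alpha>} \<rightarrow>\<^sub>E points N"
      "\<forall>x\<in>W. \<forall>y\<in>W. (ptype N \<alpha> (c x) (a y) = ptype N \<alpha> (c x) (a' y)) = (x < y)"
      using s(2) unfolding splitting_def by simp_all
    define d where "d = (\<lambda>w. case_sum (\<lambda>_::unit. c w) (case_sum (a w) (a' w)))"
    have fd: "fa (d w) = a w" "fb (d w) = a' w" if "w \<in> W" for w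
      using q(2) that unfolding fa_def fb_def d_def by (auto simp: PiE_iff extensional_def)
    have "R N W d" unfolding R_def splitting_def
    proof (intro conjI q(1))
      show "\<forall>x\<in>W. d x (Inl ()) \<in> points N \<and> fa (d x) \<in> {..<\<alpha>} \<rightarrow>\<^sub>E points N \<and> fb (d x) \<in> {..<\<alpha>} \<rightarrow>\<^sub>E points N"
        using q(2) fd by (simp add: d_def)
      show "\<forall>x\<in>W. \<forall>y\<in>W. (ptype N \<alpha> (d x (Inl ())) (fa (d y)) = ptype N \<alpha> (d x (Inl ())) (fb (d y))) = (x < y)"
        using q(3) fd by (simp add: d_def)
    qed
    moreover have "d w p \<in> points N" if "w \<in> W" "p \<in> Ind" for w p
    proof -
      have "c w \<in> points N" "a w \<in> {..<\<alpha>} \<rightarrow>\<^sub>E points N" "a' w \<in> {..<\<alpha>} \<rightarrow>\<^sub>E points N" using q(2) that(1) by auto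
      then show ?thesis using that(2) unfolding d_def Ind_def by (auto simp: PiE_iff)
    qed
    ultimately show ?thesis using q(1) s(1) by (intro exI[of _ N] exI[of _ W] exI[of _ d]) simp
  qed
  have "\<exists>N d. N \<in> models K \<and> (\<forall>x\<in>X. \<forall>p\<in>Ind. d x p \<in> points N) \<and>
    (\<forall>F\<in>Fpow X. \<exists>N' W d' e. R N' W d' \<and> N' \<in> models K \<and> (\<forall>w\<in>W. \<forall>p\<in>Ind. d' w p \<in> points N') \<and>
      e ` F \<subseteq> W \<and> (\<forall>x\<in>F. \<forall>y\<in>F. lt x y \<longrightarrow> e x < e y) \<and>
      gtp K (F \<times> Ind) (restrict (\<lambda>(x, p). d x p) (F \<times> Ind)) {} N =
      gtp K (F \<times> Ind) (restrict (\<lambda>(x, p). d' (e x) p) (F \<times> Ind)) {} N')"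
  proof (rule Ehrenfeucht_Mostowski[OF \<chi>(1,2) Ind _ X])
    show "\<exists>N W d. R N W d \<and> N \<in> models K \<and> |{..<beth j}| \<le>o |W| \<and> (\<forall>w\<in>W. \<forall>p\<in>Ind. d w p \<in> points N)"
      if "j < card_succ (two_power \<chi>)" for j by (rule ex[OF that])
    show "\<not> lt x x" for x by (rule lt(1))
    show "lt x z" if "lt x y" "lt y z" for x y z by (rule lt(2)[OF that])
    show "lt x y \<or> lt y x" if "x \<noteq> y" for x y by (rule lt(3)[OF that])
  qed
  then obtain N d where N: "N \<in> models K" "\<forall>x\<in>X. \<forall>p\<in>Ind. d x p \<in> points N"
    and fin: "\<forall>F\<in>Fpow X. \<exists>N' W d' e. R N' W d' \<and> N' \<in> models K \<and> (\<forall>w\<in>W. \<forall>p\<in>Ind. d' w p \<in> points N') \<and>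
      e ` F \<subseteq> W \<and> (\<forall>x\<in>F. \<forall>y\<in>F. lt x y \<longrightarrow> e x < e y) \<and>
      gtp K (F \<times> Ind) (restrict (\<lambda>(x, p). d x p) (F \<times> Ind)) {} N =
      gtp K (F \<times> Ind) (restrict (\<lambda>(x, p). d' (e x) p) (F \<times> Ind)) {} N'" by (elim exE conjE)
  have mem: "d x (Inl ()) \<in> points N" "fa (d x) \<in> {..<\<alpha>} \<rightarrow>\<^sub>E points N" "fb (d x) \<in> {..<\<alpha>} \<rightarrow>\<^sub>E points N"
    if "x \<in> X" for x using N(2) that IndI unfolding fa_def fb_def by auto
  have "(ptype N \<alpha> (d x (Inl ())) (fa (d y)) = ptype N \<alpha> (d x (Inl ())) (fb (d y))) = lt x y"
    if xy: "x \<in> X" "y \<in> X" for x y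
  proof -
    \<comment> \<open>The pattern compares the c of one index with the tuples of another, so two
      indices decide it.\<close>
    let ?F = "{x, y}"
    have F: "?F \<in> Fpow X" using xy by (simp add: Fpow_def)
    obtain N' W d' e where e: "R N' W d'" "N' \<in> models K" "\<forall>w\<in>W. \<forall>p\<in>Ind. d' w p \<in> points N'"
      "e ` ?F \<subseteq> W" "\<forall>x\<in>?F. \<forall>y\<in>?F. lt x y \<longrightarrow> e x < e y"
      and eq: "gtp K (?F \<times> Ind) (restrict (\<lambda>(x, p). d x p) (?F \<times> Ind)) {} N =
      gtp K (?F \<times> Ind) (restrict (\<lambda>(x, p). d' (e x) p) (?F \<times> Ind)) {} N'"
      using bspec[OF fin F] by (elim exE conjE)
    have eW: "e x \<in> W" "e y \<in> W" using e(4) by auto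
    have tr1: "(restrict (\<lambda>(x, p). d x p) (?F \<times> Ind), {}, N) \<in> triples K (?F \<times> Ind)"
      using N xy by (intro tripleI) auto
    have tr2: "(restrict (\<lambda>(x, p). d' (e x) p) (?F \<times> Ind), {}, N') \<in> triples K (?F \<times> Ind)"
      using e(2,3) eW by (intro tripleI) auto
    have mem': "d' (e x) (Inl ()) \<in> points N'" "fa (d' (e y)) \<in> {..<\<alpha>} \<rightarrow>\<^sub>E points N'" "fb (d' (e y)) \<in> {..<\<alpha>} \<rightarrow>\<^sub>E points N'"
      using e(3) eW IndI unfolding fa_def fb_def by auto
    have "ptype N \<alpha> (d x (Inl ())) (fa (d y)) = ptype N' \<alpha> (d' (e x) (Inl ())) (fa (d' (e y)))"
      unfolding ptype_def
    proof (rule gtp_reindex[OF eq tr1 tr2 case_sum_PiE[OF mem(1)[OF xy(1)] mem(2)[OF xy(2)]] case_sum_PiE[OF mem'(1,2)]])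
      fix j assume "j \<in> {()} <+> {..<\<alpha>}"
      then consider "j = Inl ()" | i where "i < \<alpha>" "j = Inr i" by auto
      then show "\<exists>i\<in>?F \<times> Ind. case_sum (\<lambda>_. d x (Inl ())) (fa (d y)) j = restrict (\<lambda>(x, p). d x p) (?F \<times> Ind) i \<and>
          case_sum (\<lambda>_. d' (e x) (Inl ())) (fa (d' (e y))) j = restrict (\<lambda>(x, p). d' (e x) p) (?F \<times> Ind) i"
      proof cases
        case 1
        then show ?thesis using IndI(1) by (intro bexI[of _ "(x, Inl ())"]) auto
      next
        case 2
        then show ?thesis using IndI(2)[OF 2(1)] by (intro bexI[of _ "(y, Inr (Inl i))"]) (auto simp: fa_def)
      qed
    qed simp
    moreover have "ptype N \<alpha> (d x (Inl ())) (fb (d y)) = ptype N' \<alpha> (d' (e x) (Inl ())) (fb (d' (e y)))"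
      unfolding ptype_def
    proof (rule gtp_reindex[OF eq tr1 tr2 case_sum_PiE[OF mem(1)[OF xy(1)] mem(3)[OF xy(2)]] case_sum_PiE[OF mem'(1,3)]])
      fix j assume "j \<in> {()} <+> {..<\<alpha>}"
      then consider "j = Inl ()" | i where "i < \<alpha>" "j = Inr i" by auto
      then show "\<exists>i\<in>?F \<times> Ind. case_sum (\<lambda>_. d x (Inl ())) (fb (d y)) j = restrict (\<lambda>(x, p). d x p) (?F \<times> Ind) i \<and>
          case_sum (\<lambda>_. d' (e x) (Inl ())) (fb (d' (e y))) j = restrict (\<lambda>(x, p). d' (e x) p) (?F \<times> Ind) i"
      proof cases
        case 1
        then show ?thesis using IndI(1) by (intro bexI[of _ "(x, Inl ())"]) auto
      next
        case 2
        then show ?thesis using IndI(3)[OF 2(1)] by (intro bexI[of _ "(y, Inr (Inr i))"]) (auto simp: fb_def)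
      qed
    qed simp
    moreover have "(ptype N' \<alpha> (d' (e x) (Inl ())) (fa (d' (e y))) = ptype N' \<alpha> (d' (e x) (Inl ())) (fb (d' (e y)))) = (e x < e y)"
      using e(1) eW unfolding R_def splitting_def by simp
    moreover have "e x < e y \<longleftrightarrow> lt x y"
    proof (cases "x = y")
      case True
      then show ?thesis using lt(1) by simp
    next
      case False
      then consider "lt x y" | "lt y x" using lt(3) by blast
      then show ?thesis
      proof cases
        case 1
        then show ?thesis using e(5) by simp
      next
        case 2
        then have "e y < e x" using e(5) by simp
        moreover have "\<not> lt x y" using lt(1)[of x] lt(2)[of x y x] 2 by blast
        ultimately show ?thesis by (simp add: less_asym)
      qed
    qed
    ultimately show ?thesis by simp
  qed
  then have "splitting \<alpha> N X lt (\<lambda>x. d x (Inl ())) (\<lambda>x. fa (d x)) (\<lambda>x. fb (d x))"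
    unfolding splitting_def using N(1) mem by simp
  then show ?thesis by blast
qed

text \<open>Concatenate c, a and a' at each index; the length is still below k. If an increasing
  pair had the type of a decreasing one, then the equality of types that holds for the former would
  hold for the latter, against the pattern.\<close>

lemma splitting_imp_order_property:
  fixes \<chi> \<alpha> k :: 'u
  assumes \<chi>: "cardinal \<chi>" "|{..<LS K}| \<le>o |{..<\<chi>}|" "|{..<\<alpha>}| \<le>o |{..<\<chi>}|"
    and long: "long_splitting \<chi> \<alpha>" and k: "infinite_cardinal k" "\<alpha> < k"
  shows "order_property_below K k"
proof -
  define Ind where "Ind = ({()} <+> ({..<\<alpha>} <+> {..<\<alpha>}))"
  have kk: "cardinal k" "infinite {..<k}" using k(1) by (auto simp: infinite_cardinal_def)
  have ak: "|{..<\<alpha>}| <o |{..<k}|" using kk(1) k(2) unfolding cardinal_def by blast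
  have "|{()}| <o |{..<k}|" by (rule card_of_finite_less) (use kk in simp_all)
  then have Indk: "|Ind| <o |{..<k}|" unfolding Ind_def
    by (intro card_of_Plus_ordLess_infinite kk(2) ak)
  have IndU: "|Ind| <o |UNIV :: 'u set|" by (rule le_ordinal_less_universe[OF ordLess_imp_ordLeq[OF Indk]])
  define \<beta> where "\<beta> = (cardinality Ind :: 'u)"
  note c = card_of_cardinality[OF IndU \<beta>_def] cardinal_cardinality[OF IndU \<beta>_def]
  have \<beta>k: "\<beta> < k" using cardinal_less_iff[OF c(2) kk(1)] ordIso_ordLess_trans[OF c(1) Indk] by simp
  obtain h where h: "bij_betw h {..<\<beta>} Ind" using c(1) card_of_ordIso by blast
  have him: "h ` {..<\<beta>} = Ind" using h by (simp add: bij_betw_def)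
  have "\<exists>N\<in>models K. has_order_property_of_length K N \<beta> m" for m :: 'u
  proof -
    have "\<exists>N c a a'. splitting \<alpha> N {..<m} (<) c a a'"
      by (rule splitting_any_order[OF \<chi> long initial_segment_small]) auto
    then obtain N c a a' where s: "splitting \<alpha> N {..<m} (<) c a a'" by (elim exE)
    have N: "N \<in> models K" and mem: "\<And>x. x < m \<Longrightarrow> c x \<in> points N" "\<And>x. x < m \<Longrightarrow> a x \<in> {..<\<alpha>} \<rightarrow>\<^sub>E points N"
      "\<And>x. x < m \<Longrightarrow> a' x \<in> {..<\<alpha>} \<rightarrow>\<^sub>E points N"
      and pat: "\<And>x y. x < m \<Longrightarrow> y < m \<Longrightarrow> (ptype N \<alpha> (c x) (a y) = ptype N \<alpha> (c x) (a' y)) = (x < y)"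
      using s unfolding splitting_def by simp_all
    define d where "d = (\<lambda>w. case_sum (\<lambda>_::unit. c w) (case_sum (a w) (a' w)))"
    have dN: "d w p \<in> points N" if "w < m" "p \<in> Ind" for w p
      using mem[OF that(1)] that(2) unfolding d_def Ind_def by (auto simp: PiE_iff)
    define D where "D = (\<lambda>w. restrict (\<lambda>i. d w (h i)) {..<\<beta>})"
    have D: "D w \<in> {..<\<beta>} \<rightarrow>\<^sub>E points N" if "w < m" for w unfolding D_def using dN[OF that] him by auto
    let ?II = "{..<\<beta>} <+> {..<\<beta>}"
    have DD: "(case_sum (D v) (D w), {}, N) \<in> triples K ?II" if "v < m" "w < m" for v w
      using D[OF that(1)] D[OF that(2)] N by (intro tripleI) (auto simp: PiE_iff extensional_def split: sum.splits)
    have pt: "ptype N \<alpha> (c v) (e w) = ptype N \<alpha> (c v') (e w')"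
      if eq: "gtp K ?II (case_sum (D v) (D w)) {} N = gtp K ?II (case_sum (D v') (D w')) {} N"
        and m: "v < m" "w < m" "v' < m" "w' < m"
        and e: "\<And>x. x < m \<Longrightarrow> e x \<in> {..<\<alpha>} \<rightarrow>\<^sub>E points N" "\<And>i. i < \<alpha> \<Longrightarrow> \<exists>p\<in>Ind. \<forall>x. e x i = d x p" for v w v' w' e
      unfolding ptype_def
    proof (rule gtp_reindex[OF eq DD[OF m(1,2)] DD[OF m(3,4)] case_sum_PiE[OF mem(1)[OF m(1)] e(1)[OF m(2)]]
          case_sum_PiE[OF mem(1)[OF m(3)] e(1)[OF m(4)]]])
      fix j assume "j \<in> {()} <+> {..<\<alpha>}"
      then consider "j = Inl ()" | i where "i < \<alpha>" "j = Inr i" by auto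
      then show "\<exists>i\<in>?II. case_sum (\<lambda>_. c v) (e w) j = case_sum (D v) (D w) i \<and>
          case_sum (\<lambda>_. c v') (e w') j = case_sum (D v') (D w') i"
      proof cases
        case 1
        have "Inl () \<in> Ind" unfolding Ind_def by auto
        then obtain i where i: "i < \<beta>" "h i = Inl ()" using him by (metis imageE lessThan_iff)
        show ?thesis by (rule bexI[of _ "Inl i"]) (use 1 i in \<open>auto simp: D_def d_def\<close>)
      next
        case 2
        obtain p where p: "p \<in> Ind" "\<forall>x. e x i = d x p" using e(2)[OF 2(1)] by blast
        then obtain i' where i': "i' < \<beta>" "h i' = p" using him by (metis imageE lessThan_iff)
        show ?thesis by (rule bexI[of _ "Inr i'"]) (use 2 i' p in \<open>auto simp: D_def\<close>)
      qed
    qed simp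
    have "has_order_property_of_length K N \<beta> m" unfolding has_order_property_of_length_def
    proof (intro exI[of _ D] conjI allI impI)
      fix i assume "i < m"
      then show "D i \<in> {..<\<beta>} \<rightarrow>\<^sub>E points N" by (rule D)
    next
      fix i0 j0 i1 j1 assume as: "i0 < j0 \<and> j0 < m \<and> i1 < j1 \<and> j1 < m"
      then have m: "i0 < m" "j0 < m" "j1 < m" "i1 < m" by auto
      show "gtp K ?II (case_sum (D i0) (D j0)) {} N \<noteq> gtp K ?II (case_sum (D j1) (D i1)) {} N"
      proof
        assume eq: "gtp K ?II (case_sum (D i0) (D j0)) {} N = gtp K ?II (case_sum (D j1) (D i1)) {} N"
        have "ptype N \<alpha> (c i0) (a j0) = ptype N \<alpha> (c j1) (a i1)"
          by (rule pt[OF eq m mem(2)]) (auto simp: d_def Ind_def intro!: bexI[of _ "Inr (Inl _)"])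
        moreover have "ptype N \<alpha> (c i0) (a' j0) = ptype N \<alpha> (c j1) (a' i1)"
          by (rule pt[OF eq m mem(3)]) (auto simp: d_def Ind_def intro!: bexI[of _ "Inr (Inr _)"])
        moreover have "ptype N \<alpha> (c i0) (a j0) = ptype N \<alpha> (c i0) (a' j0)" using pat[OF m(1,2)] as by simp
        ultimately have "j1 < i1" using pat[OF m(3,4)] by simp
        then show False using as by auto
      qed
    qed
    then show ?thesis using N by blast
  qed
  then have "order_property_at K \<beta>" unfolding order_property_at_def by simp
  then show ?thesis unfolding order_property_below_def using \<beta>k c(2) by blast
qed

text \<open>Use the order with more than l members and a dense set J of size at most l. The tuples
  at J form a set A of size at most l, and the elements c at distinct x have distinct types over A,
  because some z in J separates them. As the c are single elements, this contradicts stability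
  without any assumption on powers of l.\<close>

lemma splitting_imp_unstable:
  fixes \<chi> \<alpha> l :: 'u
  assumes \<chi>: "cardinal \<chi>" "|{..<LS K}| \<le>o |{..<\<chi>}|" "|{..<\<alpha>}| \<le>o |{..<\<chi>}|"
    and long: "long_splitting \<chi> \<alpha>" and l: "infinite {..<l}" "|{..<\<alpha>}| \<le>o |{..<l}|"
  shows "\<not> stable_in K l"
proof
  assume stable: "stable_in K l"
  obtain X J :: "'u set set" where X: "J \<subseteq> X" "|X| <o |UNIV :: 'u set|" "|{..<l}| <o |X|" "|J| \<le>o |{..<l}|"
    and dense: "\<forall>x\<in>X. \<forall>y\<in>X. lex x y \<longrightarrow> (\<exists>z\<in>J. lex x z \<and> (lex z y \<or> z = y))"
    using dense_order_exists[OF l(1)] by (elim exE conjE)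
  have "\<exists>N c a a'. splitting \<alpha> N X lex c a a'"
    by (rule splitting_any_order[OF \<chi> long X(2) lex_irrefl lex_trans lex_total])
  then obtain N c a a' where s: "splitting \<alpha> N X lex c a a'" by (elim exE)
  have N: "N \<in> models K" and mem: "\<And>x. x \<in> X \<Longrightarrow> c x \<in> points N" "\<And>x. x \<in> X \<Longrightarrow> a x \<in> {..<\<alpha>} \<rightarrow>\<^sub>E points N"
    "\<And>x. x \<in> X \<Longrightarrow> a' x \<in> {..<\<alpha>} \<rightarrow>\<^sub>E points N"
    and pat: "\<And>x y. x \<in> X \<Longrightarrow> y \<in> X \<Longrightarrow> (ptype N \<alpha> (c x) (a y) = ptype N \<alpha> (c x) (a' y)) = lex x y"
    using s unfolding splitting_def by simp_all
  define A where "A = (\<Union>z\<in>J. a z ` {..<\<alpha>} \<union> a' z ` {..<\<alpha>})"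
  have JX: "z \<in> X" if "z \<in> J" for z using that X(1) by blast
  have AN: "A \<subseteq> points N" unfolding A_def using mem(2,3)[OF JX] by (auto simp: PiE_iff)
  have "|A| \<le>o |{..<l}|" unfolding A_def by (intro card_of_UN_le card_of_Un_le card_of_image_le l X(4))
  then have T: "|{gtp1 K b A N | b. b \<in> points N}| \<le>o |{..<l}|"
    using stable N AN unfolding stable_in_def by blast
  have ne: "gtp1 K (c x) A N \<noteq> gtp1 K (c y) A N" if xy: "x \<in> X" "y \<in> X" "lex x y" for x y
  proof
    assume eq: "gtp1 K (c x) A N = gtp1 K (c y) A N"
    obtain z where z: "z \<in> J" "lex x z" "lex z y \<or> z = y" using dense xy by blast
    \<comment> \<open>Whether z lies below y or equals y, the pattern makes c at y tell
      \<open>a z\<close> from \<open>a' z\<close>, which c at x does not.\<close>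
    have nyz: "\<not> lex y z" using z(3) lex_irrefl lex_trans by blast
    have aA: "a z \<in> {..<\<alpha>} \<rightarrow>\<^sub>E A" "a' z \<in> {..<\<alpha>} \<rightarrow>\<^sub>E A"
      using mem(2,3)[OF JX[OF z(1)]] z(1) unfolding A_def by (auto simp: PiE_iff)
    have "ptype N \<alpha> (c x) (a z) = ptype N \<alpha> (c y) (a z)"
      by (rule gtp1_eq_imp_ptype_eq[OF N mem(1)[OF xy(1)] mem(1)[OF xy(2)] AN aA(1) eq])
    moreover have "ptype N \<alpha> (c x) (a' z) = ptype N \<alpha> (c y) (a' z)"
      by (rule gtp1_eq_imp_ptype_eq[OF N mem(1)[OF xy(1)] mem(1)[OF xy(2)] AN aA(2) eq])
    ultimately show False using pat[OF xy(1) JX[OF z(1)]] pat[OF xy(2) JX[OF z(1)]] z(2) nyz by simp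
  qed
  have "inj_on (\<lambda>x. gtp1 K (c x) A N) X"
  proof (rule inj_onI)
    fix x y assume xy: "x \<in> X" "y \<in> X" "gtp1 K (c x) A N = gtp1 K (c y) A N"
    then show "x = y" using lex_total[of x y] ne[OF xy(1,2)] ne[OF xy(2,1)] by metis
  qed
  moreover have "(\<lambda>x. gtp1 K (c x) A N) ` X \<subseteq> {gtp1 K b A N | b. b \<in> points N}" using mem(1) by blast
  ultimately have "|X| \<le>o |{gtp1 K b A N | b. b \<in> points N}|" by (rule card_of_inj_on_le)
  then have "|X| \<le>o |{..<l}|" using T by (rule ordLeq_transitive)
  then show False using X(3) not_ordLess_ordLeq by blast
qed

end

section \<open>The order property against stability, and long patterns from failure of (4)\<close>

context aec_ap
begin

text \<open>Along the order with many cuts, the tuples at distinct places outside J have distinct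
  types over those at J: if z lies strictly between x and y, the pair at (x, z) is increasing and
  the pair at (y, z) decreasing. These are types of \<alpha>-tuples, whence the detour through
  \<open>stable_long_types\<close>.\<close>

lemma order_property_imp_unstable:
  fixes \<alpha> l :: 'u
  assumes op: "order_property_at K \<alpha>" and \<alpha>: "cardinal \<alpha>"
    and l: "|{..<LS K}| \<le>o |{..<l}|" "|{..<\<alpha>} \<rightarrow>\<^sub>E {..<l}| \<le>o |{..<l}|" "|{..<\<alpha>}| \<le>o |{..<l}|"
  shows "\<not> stable_in K l"
proof
  assume stable: "stable_in K l"
  have inf: "infinite {..<l}" using infinite_card_of_le[OF infinite_LS l(1)] .
  obtain X J :: "'u set set" where X: "J \<subseteq> X" "|X| <o |UNIV :: 'u set|" "|{..<l}| <o |X|" "|J| \<le>o |{..<l}|"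
    and dense: "\<forall>x\<in>X. \<forall>y\<in>X. lex x y \<longrightarrow> (\<exists>z\<in>J. lex x z \<and> (lex z y \<or> z = y))"
    using dense_order_exists[OF inf] by (elim exE conjE)
  \<comment> \<open>Here \<chi> depends on \<alpha>, which is harmless because the order property
    supplies sequences of every length.\<close>
  define \<chi> where "\<chi> = max (LS K) \<alpha>"
  have \<chi>: "cardinal \<chi>" "|{..<LS K}| \<le>o |{..<\<chi>}|" "|{..<\<alpha>}| \<le>o |{..<\<chi>}|"
    using cardinal_LS \<alpha> card_of_lessThan_mono[of "LS K" \<chi>] card_of_lessThan_mono[of \<alpha> \<chi>]
    by (auto simp: \<chi>_def max_def)
  let ?I = "{..<\<alpha>}" and ?II = "{..<\<alpha>} <+> {..<\<alpha>}"
  define q where "q = (\<lambda>N b b'. gtp K ?II (case_sum (restrict b ?I) (restrict b' ?I)) {} N)"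
  define R where "R = (\<lambda>N (W :: 'u set) d. \<forall>i0\<in>W. \<forall>j0\<in>W. \<forall>i1\<in>W. \<forall>j1\<in>W. i0 < j0 \<longrightarrow> i1 < j1 \<longrightarrow> q N (d i0) (d j0) \<noteq> q N (d j1) (d i1))"
  have ex: "\<exists>N W d. R N W d \<and> N \<in> models K \<and> |{..<beth j}| \<le>o |W| \<and> (\<forall>w\<in>W. \<forall>p\<in>?I. d w p \<in> points N)" for j :: 'u
  proof -
    obtain N where N: "N \<in> models K" "has_order_property_of_length K N \<alpha> (beth j)"
      using op cardinal_beth[of j] unfolding order_property_at_def by blast
    obtain a where a: "\<forall>i<beth j. a i \<in> ?I \<rightarrow>\<^sub>E points N"
      "\<forall>i0 j0 i1 j1. i0 < j0 \<and> j0 < beth j \<and> i1 < j1 \<and> j1 < beth j \<longrightarrow>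
         gtp K ?II (case_sum (a i0) (a j0)) {} N \<noteq> gtp K ?II (case_sum (a j1) (a i1)) {} N"
      using N(2) unfolding has_order_property_of_length_def by (elim exE conjE)
    have ra: "restrict (a i) ?I = a i" if "i < beth j" for i
      using a(1) that by (intro extensional_restrict) (auto simp: PiE_iff)
    have "R N {..<beth j} a" unfolding R_def
    proof (intro ballI impI)
      fix i0 j0 i1 j1 assume m: "i0 \<in> {..<beth j}" "j0 \<in> {..<beth j}" "i1 \<in> {..<beth j}" "j1 \<in> {..<beth j}" "i0 < j0" "i1 < j1"
      then show "q N (a i0) (a j0) \<noteq> q N (a j1) (a i1)" using a(2) ra unfolding q_def by simp
    qed
    moreover have "a w p \<in> points N" if "w \<in> {..<beth j}" "p \<in> ?I" for w p using a(1) that by auto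
    ultimately show ?thesis using N(1)
      by (intro exI[of _ N] exI[of _ "{..<beth j}"] exI[of _ a] conjI ballI card_of_mono1 subset_refl)
  qed
  have "\<exists>N d. N \<in> models K \<and> (\<forall>x\<in>X. \<forall>p\<in>?I. d x p \<in> points N) \<and>
    (\<forall>F\<in>Fpow X. \<exists>N' W d' e. R N' W d' \<and> N' \<in> models K \<and> (\<forall>w\<in>W. \<forall>p\<in>?I. d' w p \<in> points N') \<and>
      e ` F \<subseteq> W \<and> (\<forall>x\<in>F. \<forall>y\<in>F. lex x y \<longrightarrow> e x < e y) \<and>
      gtp K (F \<times> ?I) (restrict (\<lambda>(x, p). d x p) (F \<times> ?I)) {} N =
      gtp K (F \<times> ?I) (restrict (\<lambda>(x, p). d' (e x) p) (F \<times> ?I)) {} N')"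
  proof (rule Ehrenfeucht_Mostowski[OF \<chi> _ X(2)])
    show "\<exists>N W d. R N W d \<and> N \<in> models K \<and> |{..<beth j}| \<le>o |W| \<and> (\<forall>w\<in>W. \<forall>p\<in>?I. d w p \<in> points N)" for j :: 'u by (rule ex)
    show "\<not> lex x x" for x :: "'u set" by (rule lex_irrefl)
    show "lex x z" if "lex x y" "lex y z" for x y z :: "'u set" by (rule lex_trans[OF that])
    show "lex x y \<or> lex y x" if "x \<noteq> y" for x y :: "'u set" by (rule lex_total[OF that])
  qed
  then obtain N d where N: "N \<in> models K" "\<forall>x\<in>X. \<forall>p\<in>?I. d x p \<in> points N"
    and fin: "\<forall>F\<in>Fpow X. \<exists>N' W d' e. R N' W d' \<and> N' \<in> models K \<and> (\<forall>w\<in>W. \<forall>p\<in>?I. d' w p \<in> points N') \<and>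
      e ` F \<subseteq> W \<and> (\<forall>x\<in>F. \<forall>y\<in>F. lex x y \<longrightarrow> e x < e y) \<and>
      gtp K (F \<times> ?I) (restrict (\<lambda>(x, p). d x p) (F \<times> ?I)) {} N =
      gtp K (F \<times> ?I) (restrict (\<lambda>(x, p). d' (e x) p) (F \<times> ?I)) {} N'" by (elim exE conjE)
  define D where "D = (\<lambda>x. restrict (d x) ?I)"
  have D: "D x \<in> ?I \<rightarrow>\<^sub>E points N" if "x \<in> X" for x unfolding D_def using N(2) that by auto
  have pairI: "case_sum b b' \<in> ?II \<rightarrow>\<^sub>E Y" if "b \<in> ?I \<rightarrow>\<^sub>E Y" "b' \<in> ?I \<rightarrow>\<^sub>E Y" for b b' :: "'u \<Rightarrow> 'u" and Y
    using that by (auto simp: PiE_iff extensional_def split: sum.splits)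
  have ne: "q N (d x) (d y) \<noteq> q N (d y') (d x')" if x: "x \<in> X" "y \<in> X" "x' \<in> X" "y' \<in> X" "lex x y" "lex x' y'" for x y x' y'
  proof -
    \<comment> \<open>The order property compares two pairs with each other, so four indices are
      moved at once.\<close>
    let ?F = "{x, y, x', y'}"
    have F: "?F \<in> Fpow X" using x by (simp add: Fpow_def)
    obtain N' W d' e where e: "R N' W d'" "N' \<in> models K" "\<forall>w\<in>W. \<forall>p\<in>?I. d' w p \<in> points N'"
      "e ` ?F \<subseteq> W" "\<forall>x\<in>?F. \<forall>y\<in>?F. lex x y \<longrightarrow> e x < e y"
      and eq: "gtp K (?F \<times> ?I) (restrict (\<lambda>(x, p). d x p) (?F \<times> ?I)) {} N =
      gtp K (?F \<times> ?I) (restrict (\<lambda>(x, p). d' (e x) p) (?F \<times> ?I)) {} N'"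
      using bspec[OF fin F] by (elim exE conjE)
    have eW: "e z \<in> W" if "z \<in> ?F" for z using e(4) that by blast
    have FX: "z \<in> X" if "z \<in> ?F" for z using F that by (auto simp: Fpow_def)
    have tr1: "(restrict (\<lambda>(x, p). d x p) (?F \<times> ?I), {}, N) \<in> triples K (?F \<times> ?I)"
      using N FX by (intro tripleI restrict_PiE_iff[THEN iffD2]) auto
    have tr2: "(restrict (\<lambda>(x, p). d' (e x) p) (?F \<times> ?I), {}, N') \<in> triples K (?F \<times> ?I)"
      using e(2,3) eW by (intro tripleI restrict_PiE_iff[THEN iffD2]) auto
    have qq: "q N (d v) (d w) = q N' (d' (e v)) (d' (e w))" if vw: "v \<in> ?F" "w \<in> ?F" for v w
      unfolding q_def
    proof (rule gtp_reindex[OF eq tr1 tr2])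
      show "case_sum (restrict (d v) ?I) (restrict (d w) ?I) \<in> ?II \<rightarrow>\<^sub>E points N"
        using D[OF FX[OF vw(1)]] D[OF FX[OF vw(2)]] unfolding D_def by (rule pairI)
      show "case_sum (restrict (d' (e v)) ?I) (restrict (d' (e w)) ?I) \<in> ?II \<rightarrow>\<^sub>E points N'"
        using e(3) eW[OF vw(1)] eW[OF vw(2)] by (intro pairI) auto
      fix j assume "j \<in> ?II"
      then consider i where "i < \<alpha>" "j = Inl i" | i where "i < \<alpha>" "j = Inr i" by auto
      then show "\<exists>i\<in>?F \<times> ?I. case_sum (restrict (d v) ?I) (restrict (d w) ?I) j = restrict (\<lambda>(x, p). d x p) (?F \<times> ?I) i \<and>
          case_sum (restrict (d' (e v)) ?I) (restrict (d' (e w)) ?I) j = restrict (\<lambda>(x, p). d' (e x) p) (?F \<times> ?I) i"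
      proof cases
        case 1
        then show ?thesis using vw(1) by (intro bexI[of _ "(v, i)"]) simp_all
      next
        case 2
        then show ?thesis using vw(2) by (intro bexI[of _ "(w, i)"]) simp_all
      qed
    qed simp
    have "q N' (d' (e x)) (d' (e y)) \<noteq> q N' (d' (e y')) (d' (e x'))"
      using e(1) eW e(5) x(5,6) unfolding R_def by simp
    then show ?thesis using qq[of x y] qq[of y' x'] by simp
  qed
  define A where "A = (\<Union>z\<in>J. D z ` ?I)"
  have JX: "z \<in> X" if "z \<in> J" for z using that X(1) by blast
  have AN: "A \<subseteq> points N" unfolding A_def using D[OF JX] by (auto simp: PiE_iff)
  have "|A| \<le>o |{..<l}|" unfolding A_def by (intro card_of_UN_le card_of_image_le inf l X(4))
  then have T: "|{gtp K ?I b A N | b. b \<in> ?I \<rightarrow>\<^sub>E points N}| \<le>o |{..<l}|"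
    by (rule stable_long_types[OF l(1) stable l(2,3) N(1) AN])
  \<comment> \<open>Excluding y from J makes z strictly smaller than y, which the order property
    needs.\<close>
  have ne2: "gtp K ?I (D x) A N \<noteq> gtp K ?I (D y) A N" if xy: "x \<in> X" "y \<in> X" "y \<notin> J" "lex x y" for x y
  proof
    assume eq: "gtp K ?I (D x) A N = gtp K ?I (D y) A N"
    obtain z where "z \<in> J" "lex x z" "lex z y \<or> z = y" using dense xy by blast
    then have z: "z \<in> J" "lex x z" "lex z y" using xy(3) by auto
    obtain N' f where N': "strong K N N'" "embedding K f N N'" "\<forall>x\<in>A. f x = x" "\<forall>i\<in>?I. f (D y i) = D x i"
      using gtp_eqD[OF eq tripleI[OF N(1) AN D[OF xy(1)]] tripleI[OF N(1) AN D[OF xy(2)]]] by (elim exE conjE)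
    note Dz = D[OF JX[OF z(1)]]
    have "gtp K ?II (case_sum (D x) (D z)) {} N = gtp K ?II (case_sum (D y) (D z)) {} N"
    proof (rule gtp_eqI_embedding[OF _ _ strong_embedding[OF N'(1)] N'(2)])
      have "case_sum (D x) (D z) \<in> ?II \<rightarrow>\<^sub>E points N" "case_sum (D y) (D z) \<in> ?II \<rightarrow>\<^sub>E points N"
        by (rule pairI[OF D[OF xy(1)] Dz], rule pairI[OF D[OF xy(2)] Dz])
      then show "(case_sum (D x) (D z), {}, N) \<in> triples K ?II" "(case_sum (D y) (D z), {}, N) \<in> triples K ?II"
        using N(1) by (auto intro!: tripleI)
      fix i assume "i \<in> ?II"
      then show "case_sum (D x) (D z) i = f (case_sum (D y) (D z) i)"
        using N'(3,4) z(1) unfolding A_def by (cases i) auto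
    qed simp_all
    then show False using ne[OF xy(1) JX[OF z(1)] JX[OF z(1)] xy(2) z(2,3)] unfolding q_def D_def by simp
  qed
  have "inj_on (\<lambda>x. gtp K ?I (D x) A N) (X - J)"
  proof (rule inj_onI)
    fix x y assume xy: "x \<in> X - J" "y \<in> X - J" "gtp K ?I (D x) A N = gtp K ?I (D y) A N"
    show "x = y"
    proof (rule ccontr)
      assume "x \<noteq> y"
      then have "lex x y \<or> lex y x" by (rule lex_total)
      then show False using xy ne2[of x y] ne2[of y x] by auto
    qed
  qed
  moreover have "(\<lambda>x. gtp K ?I (D x) A N) ` (X - J) \<subseteq> {gtp K ?I b A N | b. b \<in> ?I \<rightarrow>\<^sub>E points N}" using D by blast
  ultimately have "|X - J| \<le>o |{gtp K ?I b A N | b. b \<in> ?I \<rightarrow>\<^sub>E points N}|" by (rule card_of_inj_on_le)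
  then have "|X - J| \<le>o |{..<l}|" using T by (rule ordLeq_transitive)
  then have "|(X - J) \<union> J| \<le>o |{..<l}|" using X(4) by (intro card_of_Un_le inf)
  moreover have "(X - J) \<union> J = X" using X(1) by blast
  ultimately show False using X(3) not_ordLess_ordLeq by auto
qed

lemma unstable_imp_long_splitting:
  fixes k \<chi> :: 'u
  assumes k: "infinite_cardinal k" "tame_below K k"
    and \<chi>: "cardinal \<chi>" "|{..<LS K}| \<le>o |{..<\<chi>}|" "\<And>x. x < k \<Longrightarrow> |{..<x}| \<le>o |{..<\<chi>}|" "|{..<k}| \<le>o |Pow {..<\<chi>}|"
    and unstable: "\<And>\<mu> l0. infinite_cardinal \<mu> \<Longrightarrow> cardinal l0 \<Longrightarrow> \<mu> \<le> l0 \<Longrightarrow> l0 < hanf \<chi> \<Longrightarrow>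
      \<exists>l. cardinal l \<and> l0 \<le> l \<and> card_power_less l \<mu> = l \<and> \<not> stable_in K l"
  shows "\<exists>\<alpha><k. cardinal \<alpha> \<and> long_splitting \<chi> \<alpha>"
proof -
  define \<theta> where "\<theta> = card_succ (two_power \<chi>)"
  have tp: "cardinal (two_power \<chi>)" by (rule cardinal_two_power)
  have inf: "infinite {..<\<chi>}" using infinite_card_of_le[OF infinite_LS \<chi>(2)] .
  have inf2: "infinite {..<two_power \<chi>}"
    using infinite_card_of_le[OF inf ordLess_imp_ordLeq[OF card_of_less_two_power]] .
  have lim: "limit_ordinal \<theta>" unfolding \<theta>_def
    by (rule infinite_cardinal_limit[OF cardinal_card_succ infinite_card_succ[OF inf2]])
  have Pow2: "|Pow {..<\<chi>}| \<le>o |{..<two_power \<chi>}|"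
    by (rule ordIso_imp_ordLeq[OF ordIso_symmetric[OF card_of_two_power]])
  have k2: "|{..<k}| \<le>o |{..<two_power \<chi>}|" by (rule ordLeq_transitive[OF \<chi>(4) Pow2])
  define ok where "ok = (\<lambda>i \<alpha>. cardinal \<alpha> \<and> (\<exists>N (W :: 'u set) c a a'. |{..<beth (i::'u)}| \<le>o |W| \<and> splitting \<alpha> N W (<) c a a'))"
  have "\<exists>\<alpha>. \<alpha> \<in> {..<k} \<and> ok i \<alpha>" if i: "i < \<theta>" for i
  proof -
    \<comment> \<open>Raising i to at least 2^\<chi> ensures that r = beth_i1 is at least 2^\<chi>,
      and hence at least k.\<close>
    define i1 where "i1 = max i (two_power \<chi>)"
    have i1: "i1 < \<theta>" using i less_card_succ unfolding i1_def \<theta>_def by simp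
    define r where "r = beth i1"
    have r: "cardinal r" "infinite {..<r}" unfolding r_def by (simp_all add: cardinal_beth infinite_beth)
    have "two_power \<chi> \<le> r" unfolding r_def i1_def by (rule order_trans[OF max.cobounded2 le_beth])
    then have tr: "|{..<two_power \<chi>}| \<le>o |{..<r}|" by (rule card_of_lessThan_mono)
    have \<chi>r: "|Pow {..<\<chi>}| \<le>o |{..<r}|" by (rule ordLeq_transitive[OF Pow2 tr])
    have kr: "|{..<k}| \<le>o |{..<r}|" by (rule ordLeq_transitive[OF k2 tr])
    \<comment> \<open>With \<mu> = r^+ the condition on l includes l^r = l; with l0 two beth steps
      above r it also gives 2^(2^r) \<le> l. Both \<mu> and l0 stay below the Hanf number.\<close>
    define \<mu> where "\<mu> = card_succ r"
    define l0 where "l0 = beth (osucc (osucc i1))"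
    have \<mu>: "infinite_cardinal \<mu>" unfolding \<mu>_def infinite_cardinal_def using cardinal_card_succ infinite_card_succ[OF r(2)] by simp
    have l0: "cardinal l0" unfolding l0_def by (rule cardinal_beth)
    have o: "osucc (osucc i1) < \<theta>" using limit_osucc[OF lim limit_osucc[OF lim i1]] .
    have "r < l0" unfolding r_def l0_def by (rule beth_strict_mono) (simp add: less_imp_le)
    then have \<mu>l: "\<mu> \<le> l0" unfolding \<mu>_def by (rule card_succ_least[OF l0])
    have "l0 < hanf \<chi>" unfolding l0_def hanf_def \<theta>_def[symmetric] by (rule beth_strict_mono[OF o])
    then obtain l where l: "cardinal l" "l0 \<le> l" "card_power_less l \<mu> = l" "\<not> stable_in K l"
      using unstable[OF \<mu> l0 \<mu>l] by (elim exE conjE meta_impE)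
    have "|Pow (Pow {..<r})| \<le>o |Pow {..<beth (osucc i1)}|" unfolding r_def
      by (rule card_of_Pow_mono[OF ordIso_imp_ordLeq[OF ordIso_symmetric[OF card_of_beth_osucc]]])
    also have "|Pow {..<beth (osucc i1)}| \<le>o |{..<l0}|" unfolding l0_def
      by (rule ordIso_imp_ordLeq[OF ordIso_symmetric[OF card_of_beth_osucc]])
    also have "|{..<l0}| \<le>o |{..<l}|" by (rule card_of_lessThan_mono[OF l(2)])
    finally have L1: "|Pow (Pow {..<r})| \<le>o |{..<l}|" .
    have "card_power l r \<le> card_power_less l \<mu>"
      by (rule card_power_le_card_power_less[OF r(1)]) (simp add: \<mu>_def less_card_succ)
    then have "|{..<card_power l r}| \<le>o |{..<l}|" unfolding l(3) by (rule card_of_lessThan_mono)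
    then have L2: "|{..<r} \<rightarrow>\<^sub>E {..<l}| \<le>o |{..<l}|"
      by (rule ordIso_ordLeq_trans[OF ordIso_symmetric[OF card_of_card_power(1)]])
    have "\<exists>N \<alpha> W c a a'. N \<in> models K \<and> \<alpha> < k \<and> cardinal \<alpha> \<and> |{..<r}| <o |W| \<and>
      (\<forall>w\<in>W. c w \<in> points N \<and> a w \<in> {..<\<alpha>} \<rightarrow>\<^sub>E points N \<and> a' w \<in> {..<\<alpha>} \<rightarrow>\<^sub>E points N) \<and>
      (\<forall>v\<in>W. \<forall>w\<in>W. (ptype N \<alpha> (c v) (a w) = ptype N \<alpha> (c v) (a' w)) = ((v::'u) < w))"
      by (rule unstable_imp_splitting_sequence[OF k \<chi>(2) _ r \<chi>r kr L1 L2 l(4)]) (rule \<chi>(3))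
    then obtain N \<alpha> and W :: "'u set" and c a a' where s: "N \<in> models K" "\<alpha> < k" "cardinal \<alpha>" "|{..<r}| <o |W|"
      "\<forall>w\<in>W. c w \<in> points N \<and> a w \<in> {..<\<alpha>} \<rightarrow>\<^sub>E points N \<and> a' w \<in> {..<\<alpha>} \<rightarrow>\<^sub>E points N"
      "\<forall>v\<in>W. \<forall>w\<in>W. (ptype N \<alpha> (c v) (a w) = ptype N \<alpha> (c v) (a' w)) = (v < w)" by (elim exE conjE)
    have "|{..<beth i}| \<le>o |{..<r}|" unfolding r_def i1_def by (intro card_of_lessThan_mono beth_mono) simp
    then have "|{..<beth i}| \<le>o |W|" by (rule ordLeq_transitive[OF _ ordLess_imp_ordLeq[OF s(4)]])
    moreover have "splitting \<alpha> N W (<) c a a'" unfolding splitting_def using s(1,5,6) by simp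
    ultimately have "ok i \<alpha>" unfolding ok_def using s(3) by (intro conjI exI)
    then show ?thesis using s(2) by (intro exI[of _ \<alpha>]) simp
  qed
  then obtain al where al: "\<And>i. i < \<theta> \<Longrightarrow> al i \<in> {..<k}" "\<And>i. i < \<theta> \<Longrightarrow> ok i (al i)" by metis
  \<comment> \<open>The length found depends on i. As k \<le> 2^\<chi> and \<theta> = (2^\<chi>)^+,
    one length occurs cofinally often and then serves every j.\<close>
  obtain \<alpha> where \<alpha>: "\<alpha> \<in> {..<k}" "\<And>j. j < \<theta> \<Longrightarrow> \<exists>j'. j \<le> j' \<and> j' < \<theta> \<and> al j' = \<alpha>"
    using pigeonhole_cofinal[OF tp inf2 k2, of al] al(1) unfolding \<theta>_def by metis
  have "\<exists>N (W :: 'u set) c a a'. |{..<beth j}| \<le>o |W| \<and> splitting \<alpha> N W (<) c a a'" "cardinal \<alpha>" if j: "j < \<theta>" for j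
  proof -
    obtain j' where j': "j \<le> j'" "j' < \<theta>" "al j' = \<alpha>" using \<alpha>(2)[OF j] by blast
    have o: "ok j' \<alpha>" using al(2)[OF j'(2)] j'(3) by simp
    then show "cardinal \<alpha>" by (simp add: ok_def)
    obtain N and W :: "'u set" and c a a' where s: "|{..<beth j'}| \<le>o |W|" "splitting \<alpha> N W (<) c a a'"
      using o unfolding ok_def by (elim exE conjE)
    have "|{..<beth j}| \<le>o |W|" by (rule ordLeq_transitive[OF card_of_lessThan_mono[OF beth_mono[OF j'(1)]] s(1)])
    then show "\<exists>N (W :: 'u set) c a a'. |{..<beth j}| \<le>o |W| \<and> splitting \<alpha> N W (<) c a a'" using s(2) by (intro exI conjI)
  qed
  moreover obtain j0 where "j0 < \<theta>" using limit_nonempty[OF lim] by blast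
  ultimately have "long_splitting \<chi> \<alpha>" "cardinal \<alpha>" unfolding long_splitting_def \<theta>_def by simp_all
  then show ?thesis using \<alpha>(1) by (intro exI[of _ \<alpha>]) simp
qed

end

text \<open>This makes the condition in (4) hold in unboundedly many cardinals, namely in 2^c for
  every c \<ge> \<mu>.\<close>

lemma card_power_less_two_power:
  fixes c \<mu> :: "'u::universe"
  assumes c: "infinite {..<c}" and \<mu>: "\<mu> \<le> c" "infinite {..<\<mu>}"
  shows "card_power_less (two_power c) \<mu> = two_power c"
  unfolding card_power_less_def
proof (rule Least_equality)
  let ?l = "two_power c"
  show "\<forall>t. cardinal t \<and> t < \<mu> \<longrightarrow> card_power ?l t \<le> ?l"
  proof (intro allI impI)
    fix t assume "cardinal t \<and> t < \<mu>"
    then have "|{..<t}| \<le>o |{..<c}|" using \<mu>(1) by (intro card_of_lessThan_mono) (auto intro: less_imp_le less_le_trans)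
    then have "|{..<t} \<rightarrow>\<^sub>E {..<?l}| \<le>o |Pow {..<c}|"
      by (intro card_of_PiE_le_Pow c ordIso_imp_ordLeq[OF card_of_two_power])
    then have "|{..<card_power ?l t}| \<le>o |{..<?l}|"
      using ordIso_ordLeq_trans[OF card_of_card_power(1) ordLeq_ordIso_trans[OF _ ordIso_symmetric[OF card_of_two_power]]] by blast
    then show "card_power ?l t \<le> ?l" using cardinal_le_iff[OF card_of_card_power(2) cardinal_two_power] by blast
  qed
  fix s assume s: "\<forall>t. cardinal t \<and> t < \<mu> \<longrightarrow> card_power ?l t \<le> s"
  \<comment> \<open>\<open>z\<close> is 0 and \<open>osucc z\<close> is 1. The exponent 1, available
    because \<mu> is infinite, shows that the supremum is not below 2^c.\<close>
  define z :: 'u where "z = (LEAST z. True)"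
  have z: "\<not> y < z" for y unfolding z_def using not_less_Least[of y "\<lambda>_. True"] by blast
  have seg: "{..<z} = {}" "{..<osucc z} = {z}" unfolding lessThan_osucc using z by auto
  have "cardinal (osucc z)" unfolding cardinal_def
  proof (intro allI impI)
    fix x assume "x < osucc z"
    then have "{..<x} \<subset> {..<osucc z}" using seg z by (auto simp: le_less)
    then show "|{..<x}| <o |{..<osucc z}|" by (rule card_of_psubset_less) (simp add: seg)
  qed
  moreover have "osucc z < \<mu>" by (rule finite_cardinal_less_infinite[OF _ \<mu>(2)]) (simp add: seg)
  ultimately have "card_power ?l (osucc z) \<le> s" using s by blast
  moreover have "?l \<le> card_power ?l (osucc z)"
  proof -
    have "|{..<?l}| \<le>o |{..<osucc z} \<rightarrow>\<^sub>E {..<?l}|" unfolding seg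
    proof (rule card_of_inj_on_le[of "\<lambda>x. restrict (\<lambda>_. x) {z}"])
      show "inj_on (\<lambda>x. restrict (\<lambda>_. x) {z}) {..<?l}" by (rule inj_onI) (metis restrict_apply' singletonI)
      show "(\<lambda>x. restrict (\<lambda>_. x) {z}) ` {..<?l} \<subseteq> {z} \<rightarrow>\<^sub>E {..<?l}" by (rule image_subsetI) simp
    qed
    then have "|{..<?l}| \<le>o |{..<card_power ?l (osucc z)}|"
      by (rule ordLeq_ordIso_trans[OF _ ordIso_symmetric[OF card_of_card_power(1)]])
    then show ?thesis using cardinal_le_iff[OF cardinal_two_power card_of_card_power(2)] by blast
  qed
  ultimately show "?l \<le> s" by order
qed

theorem theorem4p13:
  fixes K :: "'u::universe abstract_class" and \<kappa> :: 'u
  assumes "aec K" and "amalgamation K"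
    and "infinite_cardinal \<kappa>" and "tame_below K \<kappa>"
  shows
    "((\<exists>l. cardinal l \<and> card_add (LS K) (card_minus \<kappa>) \<le> l \<and> stable_in K l)
        \<longleftrightarrow> \<not> order_property K)
     \<and> (\<not> order_property K \<longleftrightarrow> \<not> order_property_below K \<kappa>)
     \<and> (\<not> order_property_below K \<kappa> \<longleftrightarrow>
         (\<exists>\<mu> l0. infinite_cardinal \<mu> \<and> cardinal l0 \<and>
            \<mu> \<le> l0 \<and> l0 < hanf_star (card_add \<kappa> (card_succ (LS K))) \<and>
            (\<forall>l. cardinal l \<and> l0 \<le> l \<and> card_power_less l \<mu> = l \<longrightarrow> stable_in K l)))
     \<and> (is_stable K \<longleftrightarrow> \<not> order_property K)"
proof -
  interpret aec_ap K using assms(1,2) by (simp add: aec_ap_def aec_ap_axioms_def)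
  \<comment> \<open>The summand \<open>card_succ (LS K)\<close> keeps LS(K) strictly below \<Theta>,
    so that \<Theta>^- is still at least LS(K).\<close>
  define \<Theta> where "\<Theta> = card_add \<kappa> (card_succ (LS K))"
  define \<chi> where "\<chi> = card_minus \<Theta>"
  have \<kappa>: "cardinal \<kappa>" "infinite {..<\<kappa>}" using assms(3) by (auto simp: infinite_cardinal_def)
  have \<Theta>max: "\<Theta> = max \<kappa> (card_succ (LS K))" unfolding \<Theta>_def by (rule card_add_eq_max[OF \<kappa>(1) cardinal_card_succ \<kappa>(2)])
  then have \<Theta>: "\<kappa> \<le> \<Theta>" "card_succ (LS K) \<le> \<Theta>" by simp_all
  have "infinite {..<\<Theta>}" using infinite_card_of_le[OF \<kappa>(2) card_of_lessThan_mono[OF \<Theta>(1)]] .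
  then have "infinite_cardinal \<Theta>" unfolding infinite_cardinal_def \<Theta>_def using cardinal_card_add by simp
  note cm = card_minus_cases[OF this, folded \<chi>_def]
  have \<chi>: "cardinal \<chi>" "\<And>x. x < \<Theta> \<Longrightarrow> |{..<x}| \<le>o |{..<\<chi>}|" using cm by auto
  have \<chi>LS: "|{..<LS K}| \<le>o |{..<\<chi>}|" by (rule \<chi>(2)) (rule less_le_trans[OF less_card_succ \<Theta>(2)])
  have \<chi>\<kappa>: "|{..<x}| \<le>o |{..<\<chi>}|" if "x < \<kappa>" for x by (rule \<chi>(2)) (rule less_le_trans[OF that \<Theta>(1)])
  \<comment> \<open>Since \<chi> bounds the size of every ordinal below \<Theta>, the cardinal
    \<chi>^+ is not among them. Hence \<kappa> \<le> \<chi>^+ \<le> 2^\<chi>.\<close>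
  have "\<not> card_succ \<chi> < \<Theta>"
  proof
    assume "card_succ \<chi> < \<Theta>"
    then have "|{..<card_succ \<chi>}| \<le>o |{..<\<chi>}|" by (rule \<chi>(2))
    then show False using card_of_less_card_succ[of \<chi>] not_ordLess_ordLeq by blast
  qed
  then have "\<kappa> \<le> card_succ \<chi>" using \<Theta>(1) by order
  then have \<kappa>Pow: "|{..<\<kappa>}| \<le>o |Pow {..<\<chi>}|"
    using ordLeq_transitive[OF card_of_lessThan_mono card_of_card_succ_le_Pow[OF \<chi>(1)]] by blast
  define S1 where "S1 \<longleftrightarrow> (\<exists>l. cardinal l \<and> card_add (LS K) (card_minus \<kappa>) \<le> l \<and> stable_in K l)"
  define S4 where "S4 \<longleftrightarrow> (\<exists>\<mu> l0. infinite_cardinal \<mu> \<and> cardinal l0 \<and> \<mu> \<le> l0 \<and> l0 < hanf_star \<Theta> \<and>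
    (\<forall>l. cardinal l \<and> l0 \<le> l \<and> card_power_less l \<mu> = l \<longrightarrow> stable_in K l))"
  have long: "\<exists>\<alpha><\<kappa>. cardinal \<alpha> \<and> long_splitting \<chi> \<alpha>" if n4: "\<not> S4"
  proof (rule unstable_imp_long_splitting[OF assms(3,4) \<chi>(1) \<chi>LS _ \<kappa>Pow])
    show "|{..<x}| \<le>o |{..<\<chi>}|" if "x < \<kappa>" for x by (rule \<chi>\<kappa>[OF that])
    fix \<mu> l0 assume as: "infinite_cardinal \<mu>" "cardinal l0" "\<mu> \<le> l0" "l0 < hanf \<chi>"
    show "\<exists>l. cardinal l \<and> l0 \<le> l \<and> card_power_less l \<mu> = l \<and> \<not> stable_in K l"
    proof (rule ccontr)
      assume "\<not> ?thesis"
      then have "\<forall>l. cardinal l \<and> l0 \<le> l \<and> card_power_less l \<mu> = l \<longrightarrow> stable_in K l" by blast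
      moreover have "l0 < hanf_star \<Theta>" using as(4) by (simp add: hanf_star_def \<chi>_def)
      ultimately have S4 unfolding S4_def using as by (intro exI conjI)
      then show False using n4 by simp
    qed
  qed
  have not3: "order_property_below K \<kappa>" if n4: "\<not> S4"
  proof -
    obtain \<alpha> where a: "\<alpha> < \<kappa>" "long_splitting \<chi> \<alpha>" using long[OF n4] by (elim exE conjE)
    show ?thesis by (rule splitting_imp_order_property[OF \<chi>(1) \<chi>LS \<chi>\<kappa>[OF a(1)] a(2) assms(3) a(1)])
  qed
  have not1: "\<not> S1" if n4: "\<not> S4"
  proof
    assume S1
    then obtain l where l: "cardinal l" "card_add (LS K) (card_minus \<kappa>) \<le> l" "stable_in K l" unfolding S1_def by (elim exE conjE)
    obtain \<alpha> where a: "\<alpha> < \<kappa>" "long_splitting \<chi> \<alpha>" using long[OF n4] by (elim exE conjE)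
    note cmk = card_minus_cases[OF assms(3)]
    have "card_add (LS K) (card_minus \<kappa>) = max (LS K) (card_minus \<kappa>)"
      using card_add_eq_max[OF cardinal_LS _ infinite_LS] cmk by simp
    \<comment> \<open>The bound LS(K) + \<kappa>^- in (1) is used here: the tuples of the pattern
      have length \<alpha> < \<kappa>, hence at most \<kappa>^- \<le> l.\<close>
    then have le: "LS K \<le> l" "card_minus \<kappa> \<le> l" using l(2) by simp_all
    have inf: "infinite {..<l}" using infinite_card_of_le[OF infinite_LS card_of_lessThan_mono[OF le(1)]] .
    have "|{..<\<alpha>}| \<le>o |{..<card_minus \<kappa>}|" using cmk a(1) by simp
    then have "|{..<\<alpha>}| \<le>o |{..<l}|" by (rule ordLeq_transitive[OF _ card_of_lessThan_mono[OF le(2)]])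
    then have "\<not> stable_in K l" by (rule splitting_imp_unstable[OF \<chi>(1) \<chi>LS \<chi>\<kappa>[OF a(1)] a(2) inf])
    then show False using l(3) by simp
  qed
  have ex: "\<exists>l\<ge>m. cardinal l \<and> stable_in K l \<and> |{..<LS K}| \<le>o |{..<l}| \<and>
      |{..<m} \<rightarrow>\<^sub>E {..<l}| \<le>o |{..<l}| \<and> |{..<m}| \<le>o |{..<l}|" if S4 for m :: 'u
  proof -
    obtain \<mu> l0 where s: "infinite_cardinal \<mu>" "cardinal l0" "\<mu> \<le> l0"
      "\<forall>l. cardinal l \<and> l0 \<le> l \<and> card_power_less l \<mu> = l \<longrightarrow> stable_in K l"
      using \<open>S4\<close> unfolding S4_def by (elim exE conjE)
    \<comment> \<open>l = 2^c satisfies l^m = l for the given m as well as l^t = l for every nonzero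
      t below \<mu>, so (4) makes K stable in it.\<close>
    define c where "c = max (max m l0) (LS K)"
    have c: "m \<le> c" "l0 \<le> c" "LS K \<le> c" by (auto simp: c_def le_max_iff_disj)
    have inf: "infinite {..<c}" using infinite_card_of_le[OF infinite_LS card_of_lessThan_mono[OF c(3)]] .
    let ?l = "two_power c"
    have cl: "c \<le> ?l" using less_two_power[of c] by order
    have "card_power_less ?l \<mu> = ?l"
      using s(1,3) c(2) by (intro card_power_less_two_power inf) (auto simp: infinite_cardinal_def)
    then have "stable_in K ?l" using s(4) cardinal_two_power c(2) cl by (meson order_trans)
    moreover have "|{..<m} \<rightarrow>\<^sub>E {..<?l}| \<le>o |{..<?l}|"
    proof -
      have "|{..<m} \<rightarrow>\<^sub>E {..<?l}| \<le>o |Pow {..<c}|"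
        by (intro card_of_PiE_le_Pow inf card_of_lessThan_mono c ordIso_imp_ordLeq[OF card_of_two_power])
      then show ?thesis by (rule ordLeq_ordIso_trans[OF _ ordIso_symmetric[OF card_of_two_power]])
    qed
    moreover have "m \<le> ?l" "LS K \<le> ?l" using c cl by order+
    ultimately show ?thesis using cardinal_two_power card_of_lessThan_mono by (intro exI[of _ ?l] conjI)
  qed
  have S42: "\<not> order_property K" if S4
  proof
    assume "order_property K"
    then obtain \<alpha> where a: "cardinal \<alpha>" "order_property_at K \<alpha>" unfolding order_property_def by (elim exE conjE)
    obtain l where l: "stable_in K l" "|{..<LS K}| \<le>o |{..<l}|" "|{..<\<alpha>} \<rightarrow>\<^sub>E {..<l}| \<le>o |{..<l}|" "|{..<\<alpha>}| \<le>o |{..<l}|"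
      using ex[OF \<open>S4\<close>, of \<alpha>] by (elim exE conjE)
    show False using order_property_imp_unstable[OF a(2,1) l(2-4)] l(1) by simp
  qed
  have S4s: "is_stable K" if S4 unfolding is_stable_def
  proof (intro allI impI)
    fix m :: 'u
    show "\<exists>l\<ge>m. cardinal l \<and> stable_in K l" using ex[OF \<open>S4\<close>, of m] by (elim exE conjE) (intro exI conjI)
  qed
  have s1: "S1" if "is_stable K" unfolding S1_def
    using that[unfolded is_stable_def, THEN spec, THEN mp, OF cardinal_card_add, of "LS K" "card_minus \<kappa>"]
    by (elim exE conjE) (intro exI conjI)
  have op: "order_property K" if "order_property_below K \<kappa>"
    using that unfolding order_property_below_def order_property_def by blast
  \<comment> \<open>The circle closes: absence of either form of the order property, or stability as
    in (1), yields (4); and (4) yields absence of the order property and unbounded stability, which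
    contains (1).\<close>
  have "S1 \<longleftrightarrow> \<not> order_property K" "\<not> order_property K \<longleftrightarrow> \<not> order_property_below K \<kappa>"
    "\<not> order_property_below K \<kappa> \<longleftrightarrow> S4" "is_stable K \<longleftrightarrow> \<not> order_property K"
    using not3 not1 S42 S4s s1 op by argo+
  then show ?thesis unfolding S1_def S4_def \<Theta>_def by (intro conjI)
qed

end
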